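(* Let $\alpha>0$ and let $\Phi:[0,\tfrac14]\to[0,\infty)$ be a bounded measurable function, continuous at $\tfrac14$, with $\Phi(\tfrac14)\ne0$, such that $\Phi(x)(\tfrac14-x)^\alpha$ is a probability density on $[0,\tfrac14]$; if $\alpha=1$ assume moreover that $\Phi$ is $\beta$-Hölder on $[0,\tfrac14]$ for some $\beta>0$. Let $(\theta^{(n)})_{n\ge1}$ be i.i.d. random variables with this density, and let $(\varepsilon^{(n)})_{n\ge1}$ be i.i.d. copies of a white noise $(\varepsilon_{i,j})_{(i,j)\in\mathbb{Z}^2}$ in $L^2$ with variance $\sigma_\varepsilon^2$, independent of the $\theta^{(n)}$. For each $n$, let $X^{(n)}$ be the random-coefficient isotropic autoregressive field solving, for all $(i,j)\in\mathbb{Z}^2$, $$X^{(n)}_{i,j}-\theta^{(n)}\bigl(X^{(n)}_{i-1,j}+X^{(n)}_{i+1,j}+X^{(n)}_{i,j-1}+X^{(n)}_{i,j+1}\bigr)=\varepsilon^{(n)}_{i,j},$$ given by $X^{(n)}_{i,j}=\sum_{(k,l)\in\mathbb{Z}^2}c_{k,l}(\theta^{(n)})\,\varepsilon^{(n)}_{i-k,j-l}$, where $c_{k,l}(\theta)$ are the Laurent coefficients of $\bigl(1-\theta(z_1+z_1^{-1}+z_2+z_2^{-1})\bigr)^{-1}$ near $\{|z_1|=|z_2|=1\}$. Set $Z^{(N)}_{i,j}=N^{-1/2}\sum_{n=1}^N X^{(n)}_{i,j}$. Then this series representation converges in $L^2$, and as $N\to\infty$, $Z^{(N)}$ converges (in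 finite-dimensional distributions) to a zero-mean stationary Gaussian random field $Z$ in $L^2$ with spectral density $$f(\lambda_1,\lambda_2)=\frac{\sigma_\varepsilon^2}{4\pi^2}\int_0^{1/4}\frac{\Phi(x)\,(\tfrac14-x)^{\alpha}}{\bigl(1-2x(\cos\lambda_1+\cos\lambda_2)\bigr)^2}\,dx,\qquad (\lambda_1,\lambda_2)\in[-\pi,\pi]^2 .$$ In particular: - if $\alpha>1$, $f$ is continuous on $[-\pi,\pi]^2$ ($Z$ is short-range dependent); - if $0<\alpha<1$, $f$ is unbounded near $0$ ($Z$ has long memory) and $f(\lambda_1,\lambda_2)\sim c_\alpha(\lambda_1^2+\lambda_2^2)^{\alpha-1}$ as $(\lambda_1,\lambda_2)\to(0,0)$, with $c_\alpha=\frac{\sigma_\varepsilon^2}{4\pi^2}16^{-\alpha}\Phi(\tfrac14)\int_0^\infty\frac{u^\alpha}{(1+u)^2}du$; - if $\alpha=1$, $f$ is unbounded near $0$ ($Z$ has long memory) and $f(\lambda_1,\lambda_2)\sim c_1|\ln(\lambda_1^2+\lambda_2^2)|$ as $(\lambda_1,\lambda_2)\to(0,0)$, with $c_1=\frac{\sigma_\varepsilon^2}{4\pi^2}16^{-1}\Phi(\tfrac14)$.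
   Context: A white noise is a centered, uncorrelated, constant-variance (here variance $\sigma_\varepsilon^2$) family of $L^2$ random variables indexed by $\mathbb{Z}^2$. $\Phi$ is $\beta$-Hölder means $|\Phi(x)-\Phi(y)|\le C|x-y|^\beta$ for some $C>0$ and all $x,y$. A stationary field with spectral density $f$ has covariance $\mathrm{Cov}(Z_{0,0},Z_{k,l})=\int_{[-\pi,\pi]^2}e^{i(k\lambda_1+l\lambda_2)}f(\lambda_1,\lambda_2)\,d\lambda_1 d\lambda_2$. "Short-range dependent" means continuous (bounded) spectral density; "long memory" means the spectral density is unbounded near the origin (autocovariances not summable). $g\sim h$ means $g/h\to1$. *)

theory Defs
  imports "HOL-Probability.Probability"
begin

text \<open>Laurent coefficients c_{k,l}(theta) of (1 - theta (z1 + 1/z1 + z2 + 1/z2))^(-1) near the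
  torus |z1| = |z2| = 1, computed by the Cauchy/Laurent coefficient formula on the torus
  (z1 = e^(i l1), z2 = e^(i l2)).\<close>
definition laurent_coeff :: "int \<Rightarrow> int \<Rightarrow> real \<Rightarrow> complex" where
  "laurent_coeff k l \<theta> =
     (1 / (4 * complex_of_real (pi ^ 2))) *
     set_lebesgue_integral lborel ({-pi..pi} \<times> {-pi..pi})
       (\<lambda>(l1::real, l2::real).
          (let z1 = exp (\<i> * complex_of_real l1); z2 = exp (\<i> * complex_of_real l2)
           in inverse (1 - complex_of_real \<theta> * (z1 + inverse z1 + z2 + inverse z2)))
          * exp (- \<i> * complex_of_real (real_of_int k * l1 + real_of_int l * l2)))"

definition L2_series_conv :: "'a measure \<Rightarrow> (int \<times> int \<Rightarrow> 'a \<Rightarrow> real) \<Rightarrow> ('a \<Rightarrow> real) \<Rightarrow> bool" where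
  "L2_series_conv M Y X \<longleftrightarrow>
     X \<in> borel_measurable M \<and> integrable M (\<lambda>\<omega>. (X \<omega>)\<^sup>2) \<and>
     (\<forall>e>0. \<exists>F0. finite F0 \<and>
        (\<forall>F. finite F \<and> F0 \<subseteq> F \<longrightarrow>
           (\<integral>\<^sup>+ \<omega>. ennreal ((X \<omega> - (\<Sum>q\<in>F. Y q \<omega>))\<^sup>2) \<partial>M) < ennreal e))"

definition spec_dens :: "real \<Rightarrow> (real \<Rightarrow> real) \<Rightarrow> real \<Rightarrow> real \<times> real \<Rightarrow> real" where
  "spec_dens \<sigma>2 \<Phi> \<alpha> = (\<lambda>(l1, l2).
     \<sigma>2 / (4 * pi ^ 2) *
     (LBINT x:{0..1/4}. \<Phi> x * (1/4 - x) powr \<alpha> / (1 - 2 * x * (cos l1 + cos l2))\<^sup>2))"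

definition spec_cov :: "(real \<times> real \<Rightarrow> real) \<Rightarrow> int \<Rightarrow> int \<Rightarrow> complex" where
  "spec_cov f k l =
     set_lebesgue_integral lborel ({-pi..pi} \<times> {-pi..pi})
       (\<lambda>(l1::real, l2::real).
          exp (\<i> * complex_of_real (real_of_int k * l1 + real_of_int l * l2))
          * complex_of_real (f (l1, l2)))"

definition gaussian_rv :: "'a measure \<Rightarrow> ('a \<Rightarrow> real) \<Rightarrow> real \<Rightarrow> real \<Rightarrow> bool" where
  "gaussian_rv M X m v \<longleftrightarrow>
     (v > 0 \<and> distributed M lborel X (\<lambda>x. ennreal (normal_density m (sqrt v) x))) \<or>
     (v = 0 \<and> X \<in> borel_measurable M \<and> (AE \<omega> in M. X \<omega> = m))"

definition gaussian_field_spec :: "(int \<times> int \<Rightarrow> real) measure \<Rightarrow> (real \<times> real \<Rightarrow> real) \<Rightarrow> bool" where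
  "gaussian_field_spec \<mu> f \<longleftrightarrow>
     prob_space \<mu> \<and> sets \<mu> = sets (PiM UNIV (\<lambda>_. borel)) \<and>
     (\<forall>p. integrable \<mu> (\<lambda>x. (x p)\<^sup>2)) \<and>
     (\<forall>p. (\<integral>x. x p \<partial>\<mu>) = 0) \<and>
     (\<forall>S a. finite S \<longrightarrow> (\<exists>v. gaussian_rv \<mu> (\<lambda>x. \<Sum>p\<in>S. a p * x p) 0 v)) \<and>
     (\<forall>p q. complex_of_real (\<integral>x. x p * x q \<partial>\<mu>)
              = spec_cov f (fst q - fst p) (snd q - snd p))"

text \<open>Convergence in finite-dimensional distributions of the random fields Zs N (on M)
  to the law mu: for every finite set S of sites, E g(Zs N) \<rightarrow> \<integral> g d mu for every bounded
  continuous g depending only on the coordinates in S (i.e. weak convergence of the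
  S-marginals).\<close>
definition fidi_conv :: "'a measure \<Rightarrow> (nat \<Rightarrow> int \<times> int \<Rightarrow> 'a \<Rightarrow> real)
                          \<Rightarrow> (int \<times> int \<Rightarrow> real) measure \<Rightarrow> bool" where
  "fidi_conv M Zs \<mu> \<longleftrightarrow>
     (\<forall>S (g :: (int \<times> int \<Rightarrow> real) \<Rightarrow> real).
        finite S \<and> continuous_on UNIV g \<and> bounded (range g) \<and>
        (\<forall>x y. (\<forall>p\<in>S. x p = y p) \<longrightarrow> g x = g y) \<longrightarrow>
        (\<lambda>N. \<integral>\<omega>. g (\<lambda>p. Zs N p \<omega>) \<partial>M) \<longlonglongrightarrow> (\<integral>x. g x \<partial>\<mu>))"

end

theory Submission
  imports Defs "HOL-Real_Asymp.Real_Asymp"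
begin

text \<open>
  For \<open>0 \<le> x < 1/4\<close> the Laurent coefficients are the Green function \<open>\<Sum>n. x ^ n * W n q\<close> of the
  walk counts \<open>W n q\<close>; they are nonnegative and summable, and Parseval's identity turns their
  autocorrelations into Fourier coefficients of \<open>(1 - 2 x (cos l1 + cos l2)) ^ (-2)\<close>.
  Conditionally on the coefficient, the field is therefore an absolutely convergent filter of the
  noise; integrating over the coefficient gives convergence in \<open>L\<^sup>2\<close> and the spectral density \<open>f\<close>.
  This needs \<open>f\<close> to be integrable: with \<open>y = 1/4 - x\<close> the symbol is at least a multiple of
  \<open>y + l1\<^sup>2 + l2\<^sup>2\<close>, and weighted AM--GM separates the three variables.
  The copies are i.i.d. in \<open>L\<^sup>2\<close>. The one-dimensional central limit theorem, applied to linear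
  combinations of sites, gives convergence of the expectations of trigonometric polynomials;
  tightness and Stone--Weierstrass extend this to bounded continuous functions.
  The Gaussian limit is obtained from i.i.d. standard normals by Cholesky decomposition of the
  covariance, i.e. by iterated Schur complements.
  Near the origin the substitution \<open>y = r u\<close> with \<open>r \<sim> (l1\<^sup>2 + l2\<^sup>2) / 16\<close> reduces \<open>f\<close> to the integral of
  \<open>\<Phi> (1/4 - r u) u powr \<alpha> / (1 + u)\<^sup>2\<close> over \<open>u \<le> 1 / (4 r)\<close>, which converges for \<open>\<alpha> < 1\<close> and
  diverges logarithmically for \<open>\<alpha> = 1\<close>.
\<close>

section \<open>Gaussian fields with a prescribed covariance\<close>

text \<open>At the critical coefficient 1/4 the symbol \<open>1 - x * walk_symbol t\<close> vanishes
  at the origin, so its inverse has no bound uniform in \<open>x\<close>, and the singularity must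
  be weighed against \<open>(1/4 - x) powr \<alpha>\<close>. With y = 1/4 - x the symbol is
  comparable to y + |t|^2 near the origin, so the torus integral of its inverse square grows like
  1/y; times y^\<alpha> this is integrable at 0 for every \<alpha> > 0. At t = 0, however, the
  density itself integrates y^(\<alpha> - 2), whence the threshold \<alpha> = 1.

  The field is built once, as a measurable function of a pair (coefficient, noise configuration)
  under a product law. Inserting i.i.d. pairs gives i.i.d. copies, and two L^2 sums of the same
  series agree almost surely, so the limit holds for every version of the fields. Within one copy
  the noise is merely uncorrelated: only second moments are computed there, and Gaussianity comes
  from averaging over copies. The covariance of one copy is a Gram matrix, hence positive
  semidefinite, which is what the construction of the limit requires.\<close>

definition psd_kernel :: "(nat \<Rightarrow> nat \<Rightarrow> real) \<Rightarrow> bool" where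
  "psd_kernel K \<longleftrightarrow> (\<forall>i j. K i j = K j i) \<and>
     (\<forall>N a. 0 \<le> (\<Sum>i<N. \<Sum>j<N. a i * a j * K i j))"

lemma psd_kernel_sym: "psd_kernel K \<Longrightarrow> K i j = K j i"
  by (simp add: psd_kernel_def)

lemma psd_kernel_nonneg: "psd_kernel K \<Longrightarrow> 0 \<le> (\<Sum>i<N. \<Sum>j<N. a i * a j * K i j)"
  by (simp add: psd_kernel_def)

lemma psd_kernel_two_point:
  assumes "psd_kernel K" "i \<noteq> j"
  shows "0 \<le> s\<^sup>2 * K i i + 2 * s * t * K i j + t\<^sup>2 * K j j"
proof -
  define N where "N = Suc (max i j)"
  define a where "a = (\<lambda>k. if k = i then s else if k = j then t else 0)"
  have "0 \<le> (\<Sum>k<N. \<Sum>l<N. a k * a l * K k l)"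
    using assms by (auto simp: psd_kernel_def)
  also have "\<dots> = (\<Sum>k\<in>{i,j}. \<Sum>l\<in>{i,j}. a k * a l * K k l)"
    by (intro sum.mono_neutral_cong_right sum.cong) (auto simp: N_def a_def intro!: sum.neutral)
  also have "\<dots> = s\<^sup>2 * K i i + 2 * s * t * K i j + t\<^sup>2 * K j j"
    using assms(2) psd_kernel_sym[OF assms(1), of i j]
    by (simp add: a_def power2_eq_square algebra_simps)
  finally show ?thesis .
qed

lemma psd_kernel_diag_nonneg:
  assumes "psd_kernel K" shows "0 \<le> K i i"
  using psd_kernel_two_point[OF assms, of i "Suc i" 1 0] by simp

text \<open>In the direction e_i + t * e_n the form is affine in \<open>t\<close>; being nonnegative
  for all \<open>t\<close>, it has slope zero.\<close>

lemma psd_kernel_diag_zero: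
  assumes K: "psd_kernel K" and z: "K n n = 0" shows "K i n = 0"
proof (cases "i = n")
  case False
  have "0 \<le> K i i + 2 * t * K i n" for t
    using psd_kernel_two_point[OF K False, of 1 t] z by simp
  \<comment> \<open>At this \<open>t\<close> the affine function would take the value -1.\<close>
  from this[of "- (K i i + 1) / (2 * K i n)"] show ?thesis
    by (cases "K i n = 0") (auto simp: field_simps)
qed (use z in auto)

lemma quadratic_form_bilinear:
  fixes K :: "nat \<Rightarrow> nat \<Rightarrow> real"
  assumes "\<And>i j. K i j = K j i"
  shows "(\<Sum>i<N. \<Sum>j<N. (a i + b i) * (a j + b j) * K i j) =
     (\<Sum>i<N. \<Sum>j<N. a i * a j * K i j) + 2 * (\<Sum>i<N. \<Sum>j<N. a i * b j * K i j)
     + (\<Sum>i<N. \<Sum>j<N. b i * b j * K i j)"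
proof -
  have "b j * a i * K j i = a i * b j * K i j" for i j
    by (simp add: assms[of j i])
  then have "(\<Sum>i<N. \<Sum>j<N. b i * a j * K i j) = (\<Sum>i<N. \<Sum>j<N. a i * b j * K i j)"
    by (subst sum.swap) (intro sum.cong refl)
  then show ?thesis by (simp add: algebra_simps sum.distrib)
qed

text \<open>The quotient is 0 when the pivot vanishes, and then the whole row vanishes anyway.\<close>

definition schur_complement :: "nat \<Rightarrow> (nat \<Rightarrow> nat \<Rightarrow> real) \<Rightarrow> nat \<Rightarrow> nat \<Rightarrow> real" where
  "schur_complement n K i j = K i j - K i n * K n j / K n n"

text \<open>Completing the square: with a positive pivot, the form of the Schur complement at
  \<open>a\<close> is the minimum of the form of \<open>K\<close> over all changes of the
  \<open>n\<close>-th coordinate of \<open>a\<close>, hence nonnegative.\<close>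

lemma psd_schur_complement:
  assumes K: "psd_kernel K"
  shows "psd_kernel (schur_complement n K)"
proof (cases "K n n = 0")
  case True
  have "schur_complement n K = K"
    by (intro ext) (simp add: schur_complement_def True)
  then show ?thesis using K by simp
next
  case False
  have sym: "K i j = K j i" for i j by (rule psd_kernel_sym[OF K])
  have "0 \<le> (\<Sum>i<N. \<Sum>j<N. a i * a j * schur_complement n K i j)" for N a
  proof -
    \<comment> \<open>Extending \<open>a\<close> by zero up to \<open>N'\<close> puts the pivot
      index \<open>n\<close> into the range of summation even if \<open>N \<le> n\<close>.\<close>
    define a' where "a' i = (if i < N then a i else 0)" for i
    define N' where "N' = Suc (max N n)"
    define m where "m = (\<Sum>i<N'. a' i * K i n)"
    \<comment> \<open>\<open>- m / K n n\<close> is the minimising change of the \<open>n\<close>-th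
      coordinate.\<close>
    define b where "b i = (if i = n then - m / K n n else 0)" for i
    have n: "n < N'" by (simp add: N'_def)
    have "(\<Sum>i<N. \<Sum>j<N. a i * a j * schur_complement n K i j)
        = (\<Sum>i<N'. \<Sum>j<N'. a' i * a' j * schur_complement n K i j)"
      by (intro sum.mono_neutral_cong_left) (auto simp: N'_def a'_def intro!: sum.mono_neutral_cong_left)
    also have "\<dots> = (\<Sum>i<N'. \<Sum>j<N'. a' i * a' j * K i j) - m * m / K n n"
    proof -
      have "m * m / K n n = (\<Sum>i<N'. \<Sum>j<N'. a' i * K i n * (a' j * K j n) / K n n)"
        by (simp only: m_def sum_product sum_divide_distrib)
      moreover have "a' i * a' j * schur_complement n K i j
          = a' i * a' j * K i j - a' i * K i n * (a' j * K j n) / K n n" for i j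
        by (simp add: schur_complement_def sym[of n j] right_diff_distrib)
      ultimately show ?thesis by (simp only: sum_subtractf)
    qed
    also have "\<dots> = (\<Sum>i<N'. \<Sum>j<N'. (a' i + b i) * (a' j + b j) * K i j)"
    proof -
      have 1: "(\<Sum>i<N'. \<Sum>j<N'. a' i * b j * K i j) = - m * m / K n n"
      proof -
        have "(\<Sum>j<N'. a' i * b j * K i j) = a' i * K i n * (- m / K n n)" for i
          using n by (simp add: b_def if_distrib[of "\<lambda>x. _ * x * _"] cong: if_cong)
        then have "(\<Sum>i<N'. \<Sum>j<N'. a' i * b j * K i j) = m * (- m / K n n)"
          by (simp only: m_def sum_distrib_right)
        then show ?thesis by simp
      qed
      have 2: "(\<Sum>i<N'. \<Sum>j<N'. b i * b j * K i j) = m * m / K n n"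
      proof -
        have "(\<Sum>j<N'. b i * b j * K i j) = b i * K i n * (- m / K n n)" for i
          using n by (simp add: b_def if_distrib[of "\<lambda>x. _ * x * _"] cong: if_cong)
        moreover have "(\<Sum>i<N'. b i * K i n * (- m / K n n)) = m * m / K n n"
          using n False
          by (subst sum.remove[of _ n]) (simp_all add: b_def)
        ultimately show ?thesis by simp
      qed
      show ?thesis unfolding quadratic_form_bilinear[of K, OF sym] 1 2 by simp
    qed
    also have "0 \<le> \<dots>"
      using psd_kernel_nonneg[OF K, of "\<lambda>i. a' i + b i"] by simp
    finally show ?thesis .
  qed
  then show ?thesis by (auto simp: psd_kernel_def schur_complement_def sym mult.commute)
qed

text \<open>The residual kernel once the pivots 0, ..., n - 1 have been eliminated.\<close>

fun cholesky_rest :: "(nat \<Rightarrow> nat \<Rightarrow> real) \<Rightarrow> nat \<Rightarrow> nat \<Rightarrow> nat \<Rightarrow> real" where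
  "cholesky_rest K 0 = K"
| "cholesky_rest K (Suc n) = schur_complement n (cholesky_rest K n)"

text \<open>Each Schur step splits off the rank-one kernel \<open>L i n * L j n\<close>, and the
  residual after \<open>N\<close> steps vanishes in all rows of index below \<open>N\<close>. A
  single \<open>L\<close> serves every \<open>N\<close>, which also forces it to be lower
  triangular.\<close>

lemma cholesky_decomposition:
  assumes K: "psd_kernel K"
  shows "\<exists>L. \<forall>i j N. i < N \<and> j < N \<longrightarrow> K i j = (\<Sum>m<N. L i m * L j m)"
proof -
  define R where "R = cholesky_rest K"
  have psd: "psd_kernel (R n)" for n
    by (induction n) (auto simp: R_def K psd_schur_complement)
  \<comment> \<open>A zero pivot makes the whole column zero, since \<open>sqrt 0\<close> is 0 and
    so is a quotient by 0; the product formula \<open>LL\<close> remains true in that case.\<close>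
  define L where "L i m = R m i m / sqrt (R m m m)" for i m
  have zero: "R n i j = 0" if "i < n" for i j n
    using that
  proof (induction n arbitrary: j)
    case (Suc n)
    have RS: "R (Suc n) i j = R n i j - R n i n * R n n j / R n n n"
      by (simp add: R_def schur_complement_def)
    show ?case
    proof (cases "i < n")
      case True
      then show ?thesis by (simp add: RS Suc.IH)
    next
      case False
      then have "i = n" using Suc.prems by simp
      \<comment> \<open>Row \<open>n\<close> is cleared by its own pivot; if the pivot is zero,
        positive semidefiniteness says that the row was zero already.\<close>
      moreover have "R n n n = 0 \<Longrightarrow> R n n j = 0"
        using psd_kernel_diag_zero[OF psd, of n n j] psd_kernel_sym[OF psd, of n j n] by simp
      ultimately show ?thesis
        unfolding RS by (cases "R n n n = 0") simp_all
    qed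
  qed simp
  have LL: "L i m * L j m = R m i m * R m m j / R m m m" for i j m
    using psd_kernel_diag_nonneg[OF psd, of m m] psd_kernel_sym[OF psd, of m m j]
    by (simp add: L_def)
  have "K i j = (\<Sum>m<N. L i m * L j m) + R N i j" for i j N
    by (induction N) (auto simp: LL R_def schur_complement_def)
  with zero have "K i j = (\<Sum>m<N. L i m * L j m)" if "i < N" for i j N
    using that by (metis add.right_neutral)
  then show ?thesis by blast
qed

section \<open>Independent standard normals and the Gaussian field built from them\<close>

abbreviation iid_normals :: "(nat \<Rightarrow> real) measure" where
  "iid_normals \<equiv> PiM UNIV (\<lambda>_. std_normal_distribution)"

lemma prob_space_std_normal: "prob_space std_normal_distribution"
  by (simp add: prob_space_normal_density)

lemma prob_space_iid_normals: "prob_space iid_normals"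
  by (intro prob_space_PiM prob_space_std_normal)

lemma sets_iid_normals [measurable_cong]: "sets iid_normals = sets (PiM UNIV (\<lambda>_. borel))"
  by (intro sets_PiM_cong) auto

lemma iid_normals_component:
  "distributed iid_normals lborel (\<lambda>x. x m) std_normal_density"
proof -
  have "distr iid_normals lborel (\<lambda>x. x m) = distr iid_normals std_normal_distribution (\<lambda>x. x m)"
    by (intro distr_cong) auto
  also have "\<dots> = std_normal_distribution"
    by (intro distr_PiM_component prob_space_std_normal) auto
  finally show ?thesis by (simp add: distributed_def)
qed

lemma iid_normals_indep:
  "prob_space.indep_vars iid_normals (\<lambda>_. borel) (\<lambda>m x. x m) UNIV"
proof -
  interpret prob_space iid_normals by (rule prob_space_iid_normals)
  have "distr iid_normals borel (\<lambda>x. x m) = std_normal_distribution" for m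
  proof -
    have "distr iid_normals borel (\<lambda>x. x m) = distr iid_normals lborel (\<lambda>x. x m)"
      by (intro distr_cong) auto
    then show ?thesis using iid_normals_component[of m] by (simp add: distributed_def)
  qed
  moreover have "distr iid_normals (PiM UNIV (\<lambda>_. borel)) (\<lambda>x. x) = iid_normals"
    by (intro distr_id2) (simp add: sets_iid_normals)
  ultimately show ?thesis
    by (subst indep_vars_iff_distr_eq_PiM') (auto simp: restrict_def)
qed

lemma iid_normals_moment:
  fixes f :: "real \<Rightarrow> real"
  assumes [measurable]: "f \<in> borel_measurable borel"
  shows "integrable iid_normals (\<lambda>x. f (x m)) \<longleftrightarrow> integrable lborel (\<lambda>t. std_normal_density t * f t)"
    and "(\<integral>x. f (x m) \<partial>iid_normals) = (\<integral>t. std_normal_density t * f t \<partial>lborel)"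
  using distributed_integrable[OF iid_normals_component, of f m] distributed_integral[OF iid_normals_component, of f m]
  by (simp_all add: normal_density_nonneg)

lemma iid_normals_first_second_moments:
  shows integrable_iid_normals: "integrable iid_normals (\<lambda>x. x m)"
    and integral_iid_normals: "(\<integral>x. x m \<partial>iid_normals) = 0"
    and integrable_iid_normals_mult: "integrable iid_normals (\<lambda>x. x m * x n)"
    and integral_iid_normals_mult: "(\<integral>x. x m * x n \<partial>iid_normals) = of_bool (m = n)"
proof -
  interpret prob_space iid_normals by (rule prob_space_iid_normals)
  show 1: "integrable iid_normals (\<lambda>x. x k)" for k
    using iid_normals_moment(1)[of "\<lambda>t. t" k] integrable_std_normal_moment[of 1] by simp
  show 2: "(\<integral>x. x k \<partial>iid_normals) = 0" for k
    using iid_normals_moment(2)[of "\<lambda>t. t" k] integral_std_normal_moment_odd[of 0] by simp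
  have sq: "integrable iid_normals (\<lambda>x. x k ^ 2)" "(\<integral>x. x k ^ 2 \<partial>iid_normals) = 1" for k
    using iid_normals_moment[of "\<lambda>t. t ^ 2" k] integrable_std_normal_moment[of 2]
      integral_std_normal_moment_even[of 1] by simp_all
  note ind = indep_vars_subset[OF iid_normals_indep, of "{m, n}"]
  show "integrable iid_normals (\<lambda>x. x m * x n)"
    using sq(1)[of m] indep_vars_integrable[OF _ ind 1]
    by (cases "m = n") (auto simp: power2_eq_square)
  show "(\<integral>x. x m * x n \<partial>iid_normals) = of_bool (m = n)"
    using sq(2)[of m] indep_vars_lebesgue_integral[OF _ ind 1] 2
    by (cases "m = n") (auto simp: power2_eq_square)
qed

lemma gaussian_rv_iid_normals_sum:
  "gaussian_rv iid_normals (\<lambda>x. \<Sum>m<N. b m * x m) 0 (\<Sum>m<N. (b m)\<^sup>2)"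
proof -
  interpret prob_space iid_normals by (rule prob_space_iid_normals)
  \<comment> \<open>Zero coefficients are dropped because the sum rule for independent normals asks
    for positive standard deviations and a nonempty index set; an empty \<open>I\<close> is the
    degenerate law.\<close>
  define I where "I = {m\<in>{..<N}. b m \<noteq> 0}"
  have fin: "finite I" by (simp add: I_def)
  have eq: "(\<Sum>m<N. b m * x m) = (\<Sum>m\<in>I. b m * x m)" for x
    unfolding I_def by (intro sum.mono_neutral_right) auto
  have eq2: "(\<Sum>m<N. (b m)\<^sup>2) = (\<Sum>m\<in>I. (b m)\<^sup>2)"
    unfolding I_def by (intro sum.mono_neutral_right) auto
  show ?thesis
  proof (cases "I = {}")
    case True
    then show ?thesis unfolding gaussian_rv_def eq eq2 by simp
  next
    case False
    have pos: "0 < (\<Sum>m\<in>I. (b m)\<^sup>2)"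
      using False fin by (intro sum_pos) (auto simp: I_def)
    have "indep_vars (\<lambda>_. borel) (\<lambda>m x. b m * x m) I"
      using indep_vars_compose2[OF indep_vars_subset[OF iid_normals_indep], of I "\<lambda>m t. b m * t" "\<lambda>_. borel"] by simp
    moreover have "distributed iid_normals lborel (\<lambda>x. b m * x m) (normal_density 0 \<bar>b m\<bar>)" if "m \<in> I" for m
      using normal_density_affine[OF iid_normals_component, of "b m" 0 m] that by (simp add: I_def)
    ultimately have "distributed iid_normals lborel (\<lambda>x. \<Sum>m\<in>I. b m * x m)
        (normal_density (\<Sum>m\<in>I. 0) (sqrt (\<Sum>m\<in>I. \<bar>b m\<bar>\<^sup>2)))"
      by (intro sum_indep_normal fin False) (auto simp: I_def)
    then show ?thesis using pos unfolding gaussian_rv_def eq eq2 by simp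
  qed
qed

text \<open>Sites are enumerated by \<open>to_nat\<close>, and the value at a site is the
  combination of i.i.d. normals given by the corresponding row of the Cholesky factor. Triangularity
  makes each combination finite.\<close>

lemma gaussian_field_exists:
  fixes K :: "int \<times> int \<Rightarrow> int \<times> int \<Rightarrow> real"
  assumes cov: "\<And>p q. complex_of_real (K p q) = spec_cov f (fst q - fst p) (snd q - snd p)"
    and sym: "\<And>p q. K p q = K q p"
    and psd: "\<And>N r a. 0 \<le> (\<Sum>i<N. \<Sum>j<N. a i * a j * K (r (i :: nat)) (r j))"
  shows "\<exists>\<mu>. gaussian_field_spec \<mu> f"
proof -
  interpret prob_space iid_normals by (rule prob_space_iid_normals)
  have "psd_kernel (\<lambda>i j. K (from_nat i) (from_nat j))"
    using sym psd by (auto simp: psd_kernel_def)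
  from cholesky_decomposition[OF this] obtain L where
    L: "\<And>i j N. i < N \<Longrightarrow> j < N \<Longrightarrow> K (from_nat i) (from_nat j) = (\<Sum>m<N. L i m * L j m)"
    by blast
  define Z where "Z x p = (\<Sum>m<Suc (to_nat p). L (to_nat p) m * x m)" for x and p :: "int \<times> int"
  \<comment> \<open>Rows are padded with zeros so that finitely many sites can share one range of
    summation.\<close>
  define B where "B p m = (if m \<le> to_nat p then L (to_nat p) m else 0)" for p :: "int \<times> int" and m
  have Z: "Z x p = (\<Sum>m<N. B p m * x m)" if "to_nat p < N" for x p N
    unfolding Z_def B_def using that by (intro sum.mono_neutral_cong_left) auto
  \<comment> \<open>The factorisation of the diagonal entry may be cut off after \<open>i\<close> or
    after \<open>m\<close>; equality of both sums makes the squares in between vanish.\<close>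
  have L0: "L i m = 0" if "i < m" for i m
  proof -
    have "K (from_nat i) (from_nat i) = (\<Sum>m<Suc i. L i m * L i m)"
      "K (from_nat i) (from_nat i) = (\<Sum>m<Suc m. L i m * L i m)"
      using that by (auto intro!: L simp del: sum.lessThan_Suc)
    moreover have "(\<Sum>m<Suc m. L i m * L i m) = (\<Sum>m<Suc i. L i m * L i m) + (\<Sum>m\<in>{Suc i..<Suc m}. L i m * L i m)"
      using that by (simp add: lessThan_atLeast0 sum.atLeastLessThan_concat del: sum.op_ivl_Suc)
    ultimately have "(\<Sum>m\<in>{Suc i..<Suc m}. L i m * L i m) = 0" by simp
    then have "\<forall>m\<in>{Suc i..<Suc m}. L i m * L i m = 0"
      by (subst (asm) sum_nonneg_eq_0_iff) auto
    then show ?thesis using that by auto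
  qed
  have KB: "K p q = (\<Sum>m<N. B p m * B q m)" if "to_nat p < N" "to_nat q < N" for p q N
    using L[OF that] L0 by (auto simp: B_def intro!: sum.cong)
  have Zm [measurable]: "(\<lambda>x. Z x p) \<in> borel_measurable iid_normals" for p
    unfolding Z_def by measurable
  have ZM: "Z \<in> measurable iid_normals (PiM UNIV (\<lambda>_. borel))"
    by (rule measurable_PiM_single') auto
  define \<mu> where "\<mu> = distr iid_normals (PiM UNIV (\<lambda>_. borel)) Z"
  have ZZ: "has_bochner_integral iid_normals (\<lambda>x. Z x p * Z x q) (K p q)" for p q
  proof -
    define N where "N = Suc (max (to_nat p) (to_nat q))"
    have N: "to_nat p < N" "to_nat q < N" by (auto simp: N_def)
    have *: "Z x p * Z x q = (\<Sum>m<N. \<Sum>n<N. B p m * B q n * (x m * x n))" for x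
      by (simp add: Z[OF N(1)] Z[OF N(2)] sum_product mult_ac)
    have "has_bochner_integral iid_normals (\<lambda>x. \<Sum>m<N. \<Sum>n<N. B p m * B q n * (x m * x n))
            (\<Sum>m<N. \<Sum>n<N. B p m * B q n * of_bool (m = n))"
      by (intro has_bochner_integral_sum has_bochner_integral_mult_right)
        (simp add: has_bochner_integral_iff integrable_iid_normals_mult integral_iid_normals_mult)
    moreover have "(\<Sum>m<N. \<Sum>n<N. B p m * B q n * of_bool (m = n)) = K p q"
      by (simp add: KB[OF N])
    ultimately show ?thesis by (simp add: *)
  qed
  have Z0: "(\<integral>x. Z x p \<partial>iid_normals) = 0" for p
    unfolding Z_def by (simp add: integrable_iid_normals integral_iid_normals del: sum.lessThan_Suc)
  have "prob_space \<mu>" unfolding \<mu>_def by (intro prob_space_distr ZM)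
  moreover have "sets \<mu> = sets (PiM UNIV (\<lambda>_. borel))" by (simp add: \<mu>_def)
  moreover have "integrable \<mu> (\<lambda>x. (x p)\<^sup>2)" for p
    using ZZ[of p p] unfolding \<mu>_def
    by (subst integrable_distr_eq[OF ZM]) (auto simp: has_bochner_integral_iff power2_eq_square)
  moreover have "(\<integral>x. x p \<partial>\<mu>) = 0" for p
    unfolding \<mu>_def by (subst integral_distr[OF ZM]) (auto simp: Z0)
  moreover have "\<exists>v. gaussian_rv \<mu> (\<lambda>x. \<Sum>p\<in>S. a p * x p) 0 v" if "finite S" for S a
  proof -
    define N where "N = Suc (Max (insert 0 (to_nat ` S)))"
    have N: "to_nat p < N" if "p \<in> S" for p
      using that \<open>finite S\<close> by (auto simp: N_def less_Suc_eq_le intro: Max_ge)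
    define b where "b m = (\<Sum>p\<in>S. a p * B p m)" for m
    have eq: "(\<Sum>p\<in>S. a p * Z x p) = (\<Sum>m<N. b m * x m)" for x
    proof -
      have "(\<Sum>p\<in>S. a p * Z x p) = (\<Sum>p\<in>S. \<Sum>m<N. a p * B p m * x m)"
        by (intro sum.cong refl) (simp add: Z[OF N] sum_distrib_left mult_ac)
      also have "\<dots> = (\<Sum>m<N. b m * x m)"
        by (subst sum.swap) (simp add: b_def sum_distrib_right)
      finally show ?thesis .
    qed
    have m [measurable]: "(\<lambda>x. \<Sum>p\<in>S. a p * x p) \<in> borel_measurable (PiM UNIV (\<lambda>_. borel :: real measure))"
      by measurable
    have "gaussian_rv iid_normals ((\<lambda>x. \<Sum>p\<in>S. a p * x p) \<circ> Z) 0 (\<Sum>m<N. (b m)\<^sup>2)"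
      unfolding comp_def eq by (rule gaussian_rv_iid_normals_sum)
    then have "gaussian_rv \<mu> (\<lambda>x. \<Sum>p\<in>S. a p * x p) 0 (\<Sum>m<N. (b m)\<^sup>2)"
      unfolding gaussian_rv_def \<mu>_def distributed_def
      using ZM by (auto simp: distr_distr AE_distr_iff comp_def)
    then show ?thesis by blast
  qed
  moreover have "complex_of_real (\<integral>x. x p * x q \<partial>\<mu>) = spec_cov f (fst q - fst p) (snd q - snd p)" for p q
    unfolding \<mu>_def cov[symmetric] using ZZ[of p q]
    by (subst integral_distr[OF ZM]) (auto simp: has_bochner_integral_iff)
  ultimately show ?thesis unfolding gaussian_field_spec_def by blast
qed

section \<open>The multivariate central limit theorem\<close>

inductive trig_poly :: "'i set \<Rightarrow> (('i \<Rightarrow> real) \<Rightarrow> real) \<Rightarrow> bool" for S where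
  trig_cos: "trig_poly S (\<lambda>x. c * cos ((\<Sum>p\<in>S. a p * x p) + b))"
| trig_add: "trig_poly S f \<Longrightarrow> trig_poly S g \<Longrightarrow> trig_poly S (\<lambda>x. f x + g x)"

lemma trig_poly_const: "trig_poly S (\<lambda>_. c)"
  using trig_cos[of S c "\<lambda>_. 0" 0] by simp

text \<open>The free phase \<open>b\<close> makes sines a special case of the generators, so the
  product-to-sum formula for two cosines closes the class under multiplication.\<close>

lemma trig_poly_mult:
  assumes "trig_poly S f" "trig_poly S g"
  shows "trig_poly S (\<lambda>x. f x * g x)"
  using assms
proof (induction f rule: trig_poly.induct)
  case (trig_cos c a b)
  from trig_cos.prems show ?case
  proof (induction g rule: trig_poly.induct)
    case (trig_cos c' a' b')
    let ?t = "\<lambda>x. c * cos ((\<Sum>p\<in>S. a p * x p) + b) * (c' * cos ((\<Sum>p\<in>S. a' p * x p) + b'))"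
    have "?t = (\<lambda>x. c * c' / 2 * cos ((\<Sum>p\<in>S. (a p - a' p) * x p) + (b - b'))
       + c * c' / 2 * cos ((\<Sum>p\<in>S. (a p + a' p) * x p) + (b + b')))"
    proof
      fix x
      have "?t x = c * c' * (cos ((\<Sum>p\<in>S. a p * x p) + b) * cos ((\<Sum>p\<in>S. a' p * x p) + b'))"
        by simp
      also have "\<dots> = c * c' * ((cos (((\<Sum>p\<in>S. a p * x p) + b) - ((\<Sum>p\<in>S. a' p * x p) + b'))
           + cos (((\<Sum>p\<in>S. a p * x p) + b) + ((\<Sum>p\<in>S. a' p * x p) + b'))) / 2)"
        by (simp only: cos_times_cos)
      also have "((\<Sum>p\<in>S. a p * x p) + b) - ((\<Sum>p\<in>S. a' p * x p) + b') = (\<Sum>p\<in>S. (a p - a' p) * x p) + (b - b')"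
        by (simp add: left_diff_distrib sum_subtractf)
      also have "((\<Sum>p\<in>S. a p * x p) + b) + ((\<Sum>p\<in>S. a' p * x p) + b') = (\<Sum>p\<in>S. (a p + a' p) * x p) + (b + b')"
        by (simp add: distrib_right sum.distrib)
      finally show "?t x = c * c' / 2 * cos ((\<Sum>p\<in>S. (a p - a' p) * x p) + (b - b'))
       + c * c' / 2 * cos ((\<Sum>p\<in>S. (a p + a' p) * x p) + (b + b'))"
        by (simp add: field_simps)
    qed
    then show ?case by (simp only: trig_poly.intros)
  next
    case (trig_add f g)
    then show ?case by (simp add: distrib_left trig_poly.trig_add)
  qed
next
  case (trig_add f g)
  then show ?case by (simp add: distrib_right trig_poly.trig_add)
qed

lemma trig_poly_bounded:
  assumes "trig_poly S f" shows "\<exists>C\<ge>0. \<forall>x. \<bar>f x\<bar> \<le> C"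
  using assms
proof induction
  case (trig_cos c a b)
  show ?case by (intro exI[of _ "\<bar>c\<bar>"]) (auto simp: abs_mult mult_left_le)
next
  case (trig_add f g)
  then obtain C D where "C \<ge> 0" "D \<ge> 0" "\<forall>x. \<bar>f x\<bar> \<le> C" "\<forall>x. \<bar>g x\<bar> \<le> D" by blast
  then show ?case
    by (intro exI[of _ "C + D"]) (auto intro!: order_trans[OF abs_triangle_ineq] add_mono)
qed

lemma trig_poly_continuous:
  fixes f :: "('i::countable \<Rightarrow> real) \<Rightarrow> real"
  assumes "trig_poly S f" shows "continuous_on A f"
proof -
  have *: "continuous_on A (\<lambda>x :: 'i \<Rightarrow> real. x p)" for p
    by (rule continuous_on_subset[OF continuous_on_product_coordinates]) simp
  show ?thesis using assms 
    by induction (auto intro!: continuous_on_mult continuous_on_const continuous_on_cos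
        Limits.continuous_on_add continuous_on_sum *)
qed

lemma trig_poly_cong:
  assumes "trig_poly S f" "\<And>p. p \<in> S \<Longrightarrow> x p = y p" shows "f x = f y"
  using assms by induction simp_all

lemma trig_poly_polynomial:
  assumes "real_polynomial_function Q" "trig_poly S f"
  shows "trig_poly S (\<lambda>x. Q (f x))"
  using assms(1)
proof induction
  case (linear h)
  have "h t = h 1 * t" for t
    using linear_simps(5)[OF linear, of t 1] by (simp add: mult.commute)
  then have "(\<lambda>x. h (f x)) = (\<lambda>x. h 1 * f x)" by (intro ext)
  then show ?case
    using trig_poly_mult[OF trig_poly_const assms(2), of "h 1"] by simp
next
  case (const c)
  show ?case by (rule trig_poly_const)
next
  case (add h k)
  then show ?case by (intro trig_poly.trig_add)
next
  case (mult h k)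
  then show ?case by (intro trig_poly_mult)
qed

text \<open>Freezing the coordinates outside \<open>S\<close> at 0 makes the box compact in the
  product topology (Tychonoff), and leaves only points that functions of the
  \<open>S\<close>-coordinates can separate.\<close>

lemma compact_box:
  "compact {x :: 'i::countable \<Rightarrow> real. \<forall>p. x p \<in> (if p \<in> S then {-R..R} else {0})}" (is "compact ?K")
proof -
  have "?K = PiE UNIV (\<lambda>p. if p \<in> S then {-R..R} else {0})"
    by (auto simp: PiE_def Pi_def)
  moreover have "compactin (product_topology (\<lambda>_. euclidean) UNIV) (PiE UNIV (\<lambda>p. if p \<in> S then {-R..R::real} else {0}))"
    by (subst compactin_PiE) auto
  ultimately show ?thesis by (simp add: euclidean_product_topology)
qed

text \<open>Stone--Weierstrass only controls a trigonometric polynomial on the box; composing it with a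
  polynomial close to the truncation at level \<open>B\<close> restores a bound on the whole space.\<close>

lemma trig_poly_approx:
  fixes g :: "('i::countable \<Rightarrow> real) \<Rightarrow> real"
  assumes cont: "continuous_on UNIV g" and B: "\<And>x. \<bar>g x\<bar> \<le> B"
    and dep: "\<And>x y. (\<forall>p\<in>S. x p = y p) \<Longrightarrow> g x = g y" and e: "e > 0"
    and S: "finite S"
  obtains T where "trig_poly S T" "\<And>x. \<bar>T x\<bar> \<le> B + 1"
    "\<And>x. (\<And>p. p \<in> S \<Longrightarrow> \<bar>x p\<bar> \<le> R) \<Longrightarrow> \<bar>g x - T x\<bar> < e"
proof -
  define K where "K = {x :: 'i \<Rightarrow> real. \<forall>p. x p \<in> (if p \<in> S then {-R..R} else {0})}"
  have B0: "0 \<le> B" using B[of undefined] by linarith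
  have "\<exists>T. trig_poly S T \<and> (\<forall>x\<in>K. \<bar>g x - T x\<bar> < e / 2)"
  proof (rule Stone_Weierstrass_HOL)
    show "compact K" unfolding K_def by (rule compact_box)
    show "continuous_on K g" using cont by (rule continuous_on_subset) simp
    show "0 < e / 2" using e by simp
    fix x y :: "'i \<Rightarrow> real"
    assume *: "x \<in> K \<and> y \<in> K \<and> x \<noteq> y"
    then obtain p where p: "x p \<noteq> y p" by auto
    have pS: "p \<in> S"
    proof (rule ccontr)
      assume "p \<notin> S"
      with * have "x p = 0" "y p = 0" by (auto simp: K_def dest!: spec[of _ p])
      with p show False by simp
    qed
    show "\<exists>f. trig_poly S f \<and> f x \<noteq> f y"
    proof -
      define d where "d = x p - y p"
      have d: "d \<noteq> 0" using p by (simp add: d_def)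
      \<comment> \<open>With this frequency the phases at \<open>x\<close> and \<open>y\<close>
        differ by a quarter period; the shift below makes the cosine 0 at \<open>x\<close> and 1 at
        \<open>y\<close>.\<close>
      define a where "a = (\<lambda>q. if q = p then pi / (2 * d) else 0)"
      have sum: "(\<Sum>q\<in>S. a q * z q) = pi / (2 * d) * z p" for z
        using S pS by (simp add: a_def if_distrib[of "\<lambda>u. u * _"] cong: if_cong)
      have "pi / (2 * d) * x p + - (pi / (2 * d) * y p) = pi / 2"
      proof -
        have "x p = y p + d" by (simp add: d_def)
        then show ?thesis using d by (simp only: distrib_left) simp
      qed
      then have "cos ((\<Sum>q\<in>S. a q * x q) + - (pi / (2 * d) * y p)) = 0"
        by (simp only: sum cos_pi_half)
      moreover have "cos ((\<Sum>q\<in>S. a q * y q) + - (pi / (2 * d) * y p)) = 1"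
        by (simp only: sum add.right_inverse cos_zero)
      ultimately have "cos ((\<Sum>q\<in>S. a q * x q) + - (pi / (2 * d) * y p)) \<noteq> cos ((\<Sum>q\<in>S. a q * y q) + - (pi / (2 * d) * y p))"
        by (simp only: zero_neq_one not_False_eq_True)
      then have "1 * cos ((\<Sum>q\<in>S. a q * x q) + - (pi / (2 * d) * y p)) \<noteq> 1 * cos ((\<Sum>q\<in>S. a q * y q) + - (pi / (2 * d) * y p))"
        by (simp only: mult_1_left not_False_eq_True)
      with trig_cos[of S 1 a "- (pi / (2 * d) * y p)"] show ?thesis by (intro exI conjI)
    qed
  next
    show "trig_poly S (\<lambda>x. f x + h x)" if "trig_poly S f \<and> trig_poly S h" for f h
      using that by (intro trig_poly.trig_add) auto
    show "trig_poly S (\<lambda>x. f x * h x)" if "trig_poly S f \<and> trig_poly S h" for f h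
      using that by (intro trig_poly_mult) auto
  qed (rule trig_poly_const, erule trig_poly_continuous)
  then obtain T where T: "trig_poly S T" "\<And>x. x \<in> K \<Longrightarrow> \<bar>g x - T x\<bar> < e / 2" by blast
  obtain C where C: "C \<ge> 0" "\<And>x. \<bar>T x\<bar> \<le> C" using trig_poly_bounded[OF T(1)] by blast
  define clamp where "clamp t = max (-B) (min B t)" for t
  have cc: "continuous_on {-C..C} clamp"
    unfolding clamp_def[abs_def] by (intro continuous_intros)
  \<comment> \<open>\<open>C\<close> bounds \<open>T\<close> everywhere, so an approximation of
    \<open>clamp\<close> on this interval applies at every point, not only on the box.\<close>
  obtain Q where Q: "real_polynomial_function Q"
    "\<And>t. t \<in> {-C..C} \<Longrightarrow> \<bar>clamp t - Q t\<bar> < min (e / 2) 1"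
    by (rule Stone_Weierstrass_real_polynomial_function[of "{-C..C}" clamp "min (e / 2) 1"]) (use e cc in auto)
  show thesis
  proof (rule that[of "\<lambda>x. Q (T x)"])
    show "trig_poly S (\<lambda>x. Q (T x))" by (rule trig_poly_polynomial[OF Q(1) T(1)])
    have TC: "T x \<in> {-C..C}" for x using C(2)[of x] by auto
    show "\<bar>Q (T x)\<bar> \<le> B + 1" for x
      using Q(2)[OF TC, of x] B0 unfolding clamp_def by linarith
    show "\<bar>g x - Q (T x)\<bar> < e" if x: "\<And>p. p \<in> S \<Longrightarrow> \<bar>x p\<bar> \<le> R" for x
    proof -
      \<comment> \<open>Resetting the coordinates outside \<open>S\<close> moves \<open>x\<close>
        into the box and changes neither \<open>g\<close> nor \<open>T\<close>.\<close>
      define y where "y = (\<lambda>p. if p \<in> S then x p else 0)"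
      have "y \<in> K" using x by (simp add: K_def y_def abs_le_iff minus_le_iff)
      moreover have "g x = g y" by (rule dep) (simp add: y_def)
      moreover have "T x = T y" by (rule trig_poly_cong[OF T(1)]) (simp add: y_def)
      ultimately have "\<bar>g x - T x\<bar> < e / 2" using T(2) by simp
      \<comment> \<open>Clamping to [-B, B] is 1-Lipschitz and fixes the values of
        \<open>g\<close>.\<close>
      moreover have "\<bar>g x - clamp (T x)\<bar> \<le> \<bar>g x - T x\<bar>"
        using B[of x] unfolding clamp_def by linarith
      ultimately show ?thesis using Q(2)[OF TC, of x] by linarith
    qed
  qed
qed

section \<open>From trigonometric test functions to weak convergence\<close>

lemma borel_measurable_continuous_PiM:
  fixes g :: "('i::countable \<Rightarrow> real) \<Rightarrow> real"
  assumes "continuous_on UNIV g"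
  shows "g \<in> borel_measurable (PiM UNIV (\<lambda>_. borel))"
  using borel_measurable_continuous_onI[OF assms] measurable_cong_sets[OF sets_PiM_equal_borel refl]
  by blast

lemma integral_diff_le_on_event:
  fixes P :: "'b measure" and g h :: "'b \<Rightarrow> real"
  assumes "prob_space P" and [measurable]: "g \<in> borel_measurable P" "h \<in> borel_measurable P"
    and B: "\<And>x. \<bar>g x\<bar> \<le> B" and C: "\<And>x. \<bar>h x\<bar> \<le> C"
    and A [measurable]: "A \<in> sets P" and e: "\<And>x. x \<in> space P - A \<Longrightarrow> \<bar>g x - h x\<bar> \<le> e" "e \<ge> 0"
  shows "\<bar>(\<integral>x. g x \<partial>P) - (\<integral>x. h x \<partial>P)\<bar> \<le> e + (B + C) * measure P A"
proof -
  interpret prob_space P by fact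
  have ig: "integrable P g" by (rule integrable_const_bound[of _ B]) (auto simp: B)
  have ih: "integrable P h" by (rule integrable_const_bound[of _ C]) (auto simp: C)
  have "\<bar>(\<integral>x. g x \<partial>P) - (\<integral>x. h x \<partial>P)\<bar> = \<bar>\<integral>x. g x - h x \<partial>P\<bar>"
    using ig ih by simp
  also have "\<dots> \<le> (\<integral>x. \<bar>g x - h x\<bar> \<partial>P)" by (rule integral_abs_bound)
  also have "\<dots> \<le> (\<integral>x. e + (B + C) * indicator A x \<partial>P)"
  proof (rule integral_mono)
    show "integrable P (\<lambda>x. e + (B + C) * indicator A x)"
      by (intro Bochner_Integration.integrable_add integrable_const integrable_mult_right integrable_real_indicator)
        (auto simp: emeasure_eq_measure)
    fix x assume "x \<in> space P"
    then show "\<bar>g x - h x\<bar> \<le> e + (B + C) * indicator A x"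
      using e(1)[of x] e(2) B[of x] C[of x] by (cases "x \<in> A") auto
  qed (use ig ih in auto)
  also have "\<dots> = e + (B + C) * measure P A"
    by (simp add: prob_space emeasure_eq_measure)
  finally show ?thesis .
qed

text \<open>Tightness uniform in \<open>N\<close> confines all laws to one box up to small
  probability. There \<open>g\<close> is replaced by a trigonometric polynomial, and the global
  bound \<open>B + 1\<close> of the latter limits the damage outside.\<close>

lemma weak_convergence_from_trig:
  fixes \<mu>s :: "nat \<Rightarrow> ('i::countable \<Rightarrow> real) measure" and g :: "('i \<Rightarrow> real) \<Rightarrow> real"
  assumes prob: "\<And>N. prob_space (\<mu>s N)" "prob_space \<mu>"
    and sets [measurable_cong]: "\<And>N. sets (\<mu>s N) = sets (PiM UNIV (\<lambda>_. borel))"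
      "sets \<mu> = sets (PiM UNIV (\<lambda>_. borel))"
    and S: "finite S"
    and conv: "\<And>a b. (\<lambda>N. \<integral>x. cos ((\<Sum>p\<in>S. a p * x p) + b) \<partial>\<mu>s N)
        \<longlonglongrightarrow> (\<integral>x. cos ((\<Sum>p\<in>S. a p * x p) + b) \<partial>\<mu>)"
    and tight: "\<And>p e. p \<in> S \<Longrightarrow> e > 0 \<Longrightarrow> \<exists>R. measure \<mu> {x. \<bar>x p\<bar> > R} \<le> e \<and> (\<forall>N. measure (\<mu>s N) {x. \<bar>x p\<bar> > R} \<le> e)"
    and g: "continuous_on UNIV g" "bounded (range g)"
    and dep: "\<And>x y. (\<forall>p\<in>S. x p = y p) \<Longrightarrow> g x = g y"
  shows "(\<lambda>N. \<integral>x. g x \<partial>\<mu>s N) \<longlonglongrightarrow> (\<integral>x. g x \<partial>\<mu>)"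
proof -
  obtain B where B: "\<And>x. \<bar>g x\<bar> \<le> B" using g(2) by (auto simp: bounded_iff)
  have B0: "0 \<le> B" using B[of undefined] by linarith
  have [measurable]: "g \<in> borel_measurable (PiM UNIV (\<lambda>_. borel))"
    by (rule borel_measurable_continuous_PiM[OF g(1)])
  have trig_conv: "(\<lambda>N. \<integral>x. T x \<partial>\<mu>s N) \<longlonglongrightarrow> (\<integral>x. T x \<partial>\<mu>)" if "trig_poly S T" for T
    using that
  proof induction
    case (trig_cos c a b)
    then show ?case using tendsto_mult_left[OF conv, of c a b] by simp
  next
    case (trig_add f h)
    have int: "integrable P f" if "prob_space P" "sets P = sets (PiM UNIV (\<lambda>_. borel))" "trig_poly S f" for P and f :: "('i \<Rightarrow> real) \<Rightarrow> real"
    proof -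
      interpret prob_space P by fact
      have [measurable]: "f \<in> borel_measurable P"
        using borel_measurable_continuous_PiM[OF trig_poly_continuous[OF that(3)]] that(2)
          measurable_cong_sets by blast
      obtain C where "\<And>x. \<bar>f x\<bar> \<le> C" using trig_poly_bounded[OF \<open>trig_poly S f\<close>] by blast
      then show ?thesis by (intro integrable_const_bound[of _ C]) auto
    qed
    show ?case
      using tendsto_add[OF trig_add.IH] trig_add.hyps by (simp add: int prob sets)
  qed
  show ?thesis
  proof (rule LIMSEQ_I)
    fix r :: real assume r: "r > 0"
    define e where "e = r / 8"
    \<comment> \<open>Replacing \<open>g\<close> by \<open>T\<close> will cost at most
      \<open>e + (2 * B + 1) * d = r / 4\<close> under each law, and another \<open>r / 4\<close> is
      kept for the convergence of the integrals of \<open>T\<close>.\<close>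
    define d where "d = r / 8 / (2 * B + 1)"
    have e: "e > 0" using r by (simp add: e_def)
    have d: "d > 0" using r B0 by (simp add: d_def)
    have d': "(B + (B + 1)) * d = r / 8"
    proof -
      have "B + (B + 1) = 2 * B + 1" "2 * B + 1 \<noteq> 0" using B0 by auto
      moreover have "u * (v / u) = v" if "u \<noteq> 0" for u v :: real using that by simp
      ultimately show ?thesis unfolding d_def by metis
    qed
    \<comment> \<open>The exceptional event is a union over \<open>S\<close>, so each coordinate
      gets its share of \<open>d\<close>; the added 1 keeps the quotient meaningful for empty
      \<open>S\<close>.\<close>
    have "\<exists>R. \<forall>p\<in>S. measure \<mu> {x. \<bar>x p\<bar> > R p} \<le> d / (card S + 1) \<and> (\<forall>N. measure (\<mu>s N) {x. \<bar>x p\<bar> > R p} \<le> d / (card S + 1))"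
      using tight d by (intro bchoice) auto
    then obtain R where R: "\<And>p. p \<in> S \<Longrightarrow> measure \<mu> {x. \<bar>x p\<bar> > R p} \<le> d / (card S + 1)"
      "\<And>p N. p \<in> S \<Longrightarrow> measure (\<mu>s N) {x. \<bar>x p\<bar> > R p} \<le> d / (card S + 1)" by blast
    define R' where "R' = Max (insert 0 (R ` S))"
    obtain T where T: "trig_poly S T" "\<And>x. \<bar>T x\<bar> \<le> B + 1"
      "\<And>x. (\<And>p. p \<in> S \<Longrightarrow> \<bar>x p\<bar> \<le> R') \<Longrightarrow> \<bar>g x - T x\<bar> < e"
      using trig_poly_approx[OF g(1) B dep e S, of R'] by metis
    have [measurable]: "T \<in> borel_measurable (PiM UNIV (\<lambda>_. borel))"
      by (rule borel_measurable_continuous_PiM[OF trig_poly_continuous[OF T(1)]])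
    have close: "\<bar>(\<integral>x. g x \<partial>P) - (\<integral>x. T x \<partial>P)\<bar> \<le> r / 4"
      if P: "prob_space P" and sP [measurable_cong]: "sets P = sets (PiM UNIV (\<lambda>_. borel))"
        and tail: "\<And>p. p \<in> S \<Longrightarrow> measure P {x. \<bar>x p\<bar> > R p} \<le> d / (card S + 1)" for P
    proof -
      interpret prob_space P by fact
      have sp: "space P = UNIV" using sets_eq_imp_space_eq[OF sP] by (simp add: space_PiM)
      define A where "A = (\<Union>p\<in>S. {x. \<bar>x p\<bar> > R p})"
      have Ap: "{x. \<bar>x p\<bar> > R p} \<in> sets P" for p
      proof -
        have "{x\<in>space P. \<bar>x p\<bar> > R p} \<in> sets P" by measurable
        then show ?thesis by (simp add: sp)
      qed
      have A: "A \<in> sets P" using Ap S by (auto simp: A_def)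
      have "measure P A \<le> (\<Sum>p\<in>S. measure P {x. \<bar>x p\<bar> > R p})"
        unfolding A_def using Ap S by (intro finite_measure_subadditive_finite) auto
      also have "\<dots> \<le> (\<Sum>p\<in>S. d / (card S + 1))" by (intro sum_mono tail)
      also have "\<dots> \<le> d" using d by (simp add: field_simps)
      finally have "measure P A \<le> d" .
      moreover have "\<bar>(\<integral>x. g x \<partial>P) - (\<integral>x. T x \<partial>P)\<bar> \<le> e + (B + (B + 1)) * measure P A"
      proof (rule integral_diff_le_on_event[OF P _ _ B T(2) A])
        show "\<bar>g x - T x\<bar> \<le> e" if "x \<in> space P - A" for x
        proof -
          have "\<bar>x p\<bar> \<le> R'" if "p \<in> S" for p
          proof -
            have "\<bar>x p\<bar> \<le> R p" using \<open>x \<in> space P - A\<close> that by (auto simp: A_def not_less)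
            also have "R p \<le> R'" unfolding R'_def using S that by (intro Max_ge) auto
            finally show ?thesis .
          qed
          then show ?thesis using T(3) by (meson less_imp_le)
        qed
      qed (use e in auto)
      ultimately have "\<bar>(\<integral>x. g x \<partial>P) - (\<integral>x. T x \<partial>P)\<bar> \<le> e + (B + (B + 1)) * d"
        using B0 mult_left_mono[of "measure P A" d "B + (B + 1)"] by linarith
      then show ?thesis using d' by (simp add: e_def)
    qed
    obtain N0 where N0: "\<And>N. N \<ge> N0 \<Longrightarrow> norm ((\<integral>x. T x \<partial>\<mu>s N) - (\<integral>x. T x \<partial>\<mu>)) < r / 4"
      using LIMSEQ_D[OF trig_conv[OF T(1)], of "r / 4"] r by auto
    show "\<exists>no. \<forall>n\<ge>no. norm ((\<integral>x. g x \<partial>\<mu>s n) - (\<integral>x. g x \<partial>\<mu>)) < r"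
    proof (intro exI[of _ N0] allI impI)
      fix n assume "n \<ge> N0"
      have "\<bar>(\<integral>x. g x \<partial>\<mu>s n) - (\<integral>x. T x \<partial>\<mu>s n)\<bar> \<le> r / 4"
        by (rule close[OF prob(1) sets(1)]) (rule R(2))
      moreover have "\<bar>(\<integral>x. g x \<partial>\<mu>) - (\<integral>x. T x \<partial>\<mu>)\<bar> \<le> r / 4"
        by (rule close[OF prob(2) sets(2)]) (rule R(1))
      moreover note N0[OF \<open>n \<ge> N0\<close>] r
      ultimately show "norm ((\<integral>x. g x \<partial>\<mu>s n) - (\<integral>x. g x \<partial>\<mu>)) < r" unfolding real_norm_def by linarith
    qed
  qed
qed

section \<open>Second moments and the central limit theorem\<close>

lemma abs_mult_le_sum_squares: "\<bar>u * v\<bar> \<le> u\<^sup>2 + v\<^sup>2" for u v :: real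
proof -
  have "0 \<le> \<bar>u\<bar> * \<bar>v\<bar>" by simp
  then show ?thesis
    using sum_squares_bound[of "\<bar>u\<bar>" "\<bar>v\<bar>"] unfolding abs_mult power2_abs by linarith
qed

lemma
  fixes f g :: "'a \<Rightarrow> real"
  assumes [measurable]: "f \<in> borel_measurable M" "g \<in> borel_measurable M"
    and f: "integrable M (\<lambda>x. (f x)\<^sup>2)" and g: "integrable M (\<lambda>x. (g x)\<^sup>2)"
  shows integrable_mult_of_squares: "integrable M (\<lambda>x. f x * g x)"
    and integral_abs_mult_le: "(\<integral>x. \<bar>f x * g x\<bar> \<partial>M) \<le> (\<integral>x. (f x)\<^sup>2 \<partial>M) + (\<integral>x. (g x)\<^sup>2 \<partial>M)"
proof -
  have sum: "integrable M (\<lambda>x. (f x)\<^sup>2 + (g x)\<^sup>2)"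
    by (intro Bochner_Integration.integrable_add f g)
  show int: "integrable M (\<lambda>x. f x * g x)"
  proof (rule Bochner_Integration.integrable_bound[OF sum])
    show "AE x in M. norm (f x * g x) \<le> norm ((f x)\<^sup>2 + (g x)\<^sup>2)"
      unfolding real_norm_def
      by (intro AE_I2 order_trans[OF _ abs_ge_self] abs_mult_le_sum_squares)
  qed measurable
  have "(\<integral>x. \<bar>f x * g x\<bar> \<partial>M) \<le> (\<integral>x. (f x)\<^sup>2 + (g x)\<^sup>2 \<partial>M)"
    by (intro integral_mono integrable_abs int sum abs_mult_le_sum_squares)
  then show "(\<integral>x. \<bar>f x * g x\<bar> \<partial>M) \<le> (\<integral>x. (f x)\<^sup>2 \<partial>M) + (\<integral>x. (g x)\<^sup>2 \<partial>M)"
    using f g by simp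
qed

lemma (in prob_space) chebyshev_square:
  fixes Y :: "'a \<Rightarrow> real"
  assumes [measurable]: "Y \<in> borel_measurable M" and int: "integrable M (\<lambda>x. (Y x)\<^sup>2)" and R: "R > 0"
  shows "measure M {x\<in>space M. \<bar>Y x\<bar> > R} \<le> expectation (\<lambda>x. (Y x)\<^sup>2) / R\<^sup>2"
proof -
  have "measure M {x\<in>space M. \<bar>Y x\<bar> > R} \<le> measure M {x\<in>space M. (Y x)\<^sup>2 \<ge> R\<^sup>2}"
    using R by (intro finite_measure_mono) (auto intro: abs_le_square_iff[THEN iffD1, of R, simplified])
  also have "\<dots> \<le> expectation (\<lambda>x. (Y x)\<^sup>2) / R\<^sup>2"
    using R by (intro integral_Markov_inequality_measure[OF int, of "{}"]) auto
  finally show ?thesis .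
qed

lemma integrable_square_sum:
  fixes f :: "'i \<Rightarrow> 'a \<Rightarrow> real"
  assumes [measurable]: "\<And>i. f i \<in> borel_measurable M"
    and "\<And>i. integrable M (\<lambda>x. (f i x)\<^sup>2)"
  shows "integrable M (\<lambda>x. (\<Sum>i\<in>S. a i * f i x)\<^sup>2)"
    and "(\<integral>x. (\<Sum>i\<in>S. a i * f i x)\<^sup>2 \<partial>M) = (\<Sum>i\<in>S. \<Sum>j\<in>S. a i * a j * (\<integral>x. f i x * f j x \<partial>M))"
proof -
  have int: "integrable M (\<lambda>x. f i x * f j x)" for i j
    by (intro integrable_mult_of_squares assms)
  have eq: "(\<Sum>i\<in>S. a i * f i x)\<^sup>2 = (\<Sum>i\<in>S. \<Sum>j\<in>S. a i * a j * (f i x * f j x))" for x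
    by (simp add: power2_eq_square sum_product mult_ac)
  show "integrable M (\<lambda>x. (\<Sum>i\<in>S. a i * f i x)\<^sup>2)" unfolding eq
    by (intro Bochner_Integration.integrable_sum integrable_mult_right int)
  show "(\<integral>x. (\<Sum>i\<in>S. a i * f i x)\<^sup>2 \<partial>M) = (\<Sum>i\<in>S. \<Sum>j\<in>S. a i * a j * (\<integral>x. f i x * f j x \<partial>M))"
    unfolding eq by (simp add: int)
qed

lemma gaussian_rv_second_moment:
  assumes "gaussian_rv M X 0 v"
  shows "(\<integral>x. (X x)\<^sup>2 \<partial>M) = v"
  using assms unfolding gaussian_rv_def
proof (elim disjE conjE)
  assume v: "v > 0" and D: "distributed M lborel X (\<lambda>x. ennreal (normal_density 0 (sqrt v) x))"
  have "(\<integral>x. (X x)\<^sup>2 \<partial>M) = (\<integral>t. normal_density 0 (sqrt v) t * t\<^sup>2 \<partial>lborel)"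
    by (rule distributed_integral[OF D, symmetric]) (auto simp: normal_density_nonneg)
  also have "\<dots> = v"
    using integral_normal_moment_even[of "sqrt v" 0 1] v by simp
  finally show ?thesis .
next
  assume "v = 0" "X \<in> borel_measurable M" "AE x in M. X x = 0"
  then have "(\<integral>x. (X x)\<^sup>2 \<partial>M) = (\<integral>x. 0 \<partial>M)" by (intro integral_cong_AE) auto
  then show ?thesis using \<open>v = 0\<close> by simp
qed

text \<open>Writing the expectation through a standard normal scaled by \<open>sqrt v\<close> treats
  the degenerate law \<open>v = 0\<close> by the same formula, and shows that only the variance
  matters.\<close>

lemma (in prob_space) gaussian_rv_cos:
  assumes "gaussian_rv M X 0 v"
  shows "(\<integral>x. cos (X x + b) \<partial>M) = (\<integral>t. cos (sqrt v * t + b) \<partial>std_normal_distribution)"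
  using assms unfolding gaussian_rv_def
proof (elim disjE conjE)
  assume v: "v > 0" and D: "distributed M lborel X (\<lambda>x. ennreal (normal_density 0 (sqrt v) x))"
  then have D': "distributed M lborel (\<lambda>x. X x / sqrt v) std_normal_density"
    using normal_standard_normal_convert[of "sqrt v" X 0] by simp
  have "(\<integral>x. cos (X x + b) \<partial>M) = (\<integral>x. cos (sqrt v * (X x / sqrt v) + b) \<partial>M)"
    using v by simp
  also have "\<dots> = (\<integral>t. std_normal_density t * cos (sqrt v * t + b) \<partial>lborel)"
    by (rule distributed_integral[OF D', symmetric]) (auto simp: normal_density_nonneg)
  also have "\<dots> = (\<integral>t. cos (sqrt v * t + b) \<partial>std_normal_distribution)"
    by (subst integral_density) (auto simp: normal_density_nonneg)
  finally show ?thesis .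
next
  assume *: "v = 0" "X \<in> borel_measurable M" "AE x in M. X x = 0"
  have "(\<integral>x. cos (X x + b) \<partial>M) = (\<integral>x. cos b \<partial>M)"
    by (rule integral_cong_AE) (use * in auto)
  then show ?thesis
    using \<open>v = 0\<close> prob_space.prob_space[OF prob_space_std_normal] by (simp add: prob_space)
qed

text \<open>The case \<open>v = 0\<close> is separate because the classical theorem normalises by
  the standard deviation; there all summands vanish almost surely.\<close>

lemma (in prob_space) clt_cos:
  fixes Y :: "nat \<Rightarrow> 'a \<Rightarrow> real"
  assumes indep: "indep_vars (\<lambda>_. borel) Y UNIV"
    and Y_mean: "\<And>n. expectation (Y n) = 0"
    and sq: "\<And>n. integrable M (\<lambda>x. (Y n x)\<^sup>2)"
    and var: "\<And>n. expectation (\<lambda>x. (Y n x)\<^sup>2) = v"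
    and distr: "\<And>n. distr M borel (Y n) = distr M borel (Y 0)"
  shows "(\<lambda>N. \<integral>x. cos ((\<Sum>n<N. Y n x) / sqrt (real N) + b) \<partial>M)
    \<longlonglongrightarrow> (\<integral>t. cos (sqrt v * t + b) \<partial>std_normal_distribution)"
proof -
  have meas [measurable]: "Y n \<in> borel_measurable M" for n
    using indep by (auto simp: indep_vars_def)
  have v0: "v \<ge> 0" using var[of 0] by (metis integral_nonneg_AE AE_I2 zero_le_power2)
  show ?thesis
  proof (cases "v = 0")
    case True
    have "AE x in M. Y n x = 0" for n
      using var[of n] True integral_nonneg_eq_0_iff_AE[OF sq[of n]] by auto
    then have "AE x in M. \<forall>n. Y n x = 0" by (simp add: AE_all_countable)
    then have "(\<integral>x. cos ((\<Sum>n<N. Y n x) / sqrt (real N) + b) \<partial>M) = (\<integral>x. cos b \<partial>M)" for N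
      by (intro integral_cong_AE) auto
    then show ?thesis using True prob_space.prob_space[OF prob_space_std_normal] by (simp add: prob_space)
  next
    case False
    with v0 have v: "v > 0" by simp
    have "weak_conv_m (\<lambda>N. distr M borel (\<lambda>x. (\<Sum>n<N. Y n x) / sqrt (real N * (sqrt v)\<^sup>2))) std_normal_distribution"
      by (rule central_limit_theorem_zero_mean[OF indep Y_mean _ sq _ distr]) (use v var Y_mean in simp_all)
    \<comment> \<open>The factor \<open>sqrt v\<close> inside the test function undoes the
      normalisation by the standard deviation.\<close>
    from weak_conv_imp_integral_bdd_continuous_conv[OF _ _ this, of "\<lambda>t. cos (sqrt v * t + b)" 1]
    have "(\<lambda>N. \<integral>t. cos (sqrt v * t + b) \<partial>distr M borel (\<lambda>x. (\<Sum>n<N. Y n x) / sqrt (real N * (sqrt v)\<^sup>2)))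
        \<longlonglongrightarrow> (\<integral>t. cos (sqrt v * t + b) \<partial>std_normal_distribution)"
      by (simp add: real_distribution_distr real_dist_normal_dist)
    moreover have "(\<integral>t. cos (sqrt v * t + b) \<partial>distr M borel (\<lambda>x. (\<Sum>n<N. Y n x) / sqrt (real N * (sqrt v)\<^sup>2)))
        = (\<integral>x. cos ((\<Sum>n<N. Y n x) / sqrt (real N) + b) \<partial>M)" for N
    proof -
      have "sqrt v * (s / sqrt (real N * (sqrt v)\<^sup>2)) = s / sqrt (real N)" for s
        using v by (simp add: real_sqrt_mult)
      note eq = this
      have "(\<lambda>x. (\<Sum>n<N. Y n x) / sqrt (real N * (sqrt v)\<^sup>2)) \<in> borel_measurable M" by measurable
      moreover have "(\<lambda>t. cos (sqrt v * t + b)) \<in> borel_measurable borel" by measurable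
      ultimately show ?thesis by (simp only: integral_distr eq)
    qed
    ultimately show ?thesis by (simp only:)
  qed
qed

text \<open>The Cramer-Wold device with cosines as test functions: every linear combination over
  finitely many sites is an i.i.d. sum whose variance is that of the same combination under
  \<open>\<mu>\<close>. Tightness follows from Chebyshev's inequality, since the second moments of
  the normalised sums are bounded by those of \<open>\<mu>\<close>.\<close>

theorem multivariate_clt_fidi:
  fixes U :: "nat \<Rightarrow> int \<times> int \<Rightarrow> 'a \<Rightarrow> real"
  assumes M: "prob_space M"
    and indep: "prob_space.indep_vars M (\<lambda>_. PiM UNIV (\<lambda>_. borel)) (\<lambda>n \<omega> p. U n p \<omega>) UNIV"
    and ident: "\<And>n. distr M (PiM UNIV (\<lambda>_. borel)) (\<lambda>\<omega> p. U n p \<omega>) = distr M (PiM UNIV (\<lambda>_. borel)) (\<lambda>\<omega> p. U 0 p \<omega>)"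
    and sq: "\<And>n p. integrable M (\<lambda>\<omega>. (U n p \<omega>)\<^sup>2)"
    and mean: "\<And>n p. (\<integral>\<omega>. U n p \<omega> \<partial>M) = 0"
    and cov: "\<And>n p q. (\<integral>\<omega>. U n p \<omega> * U n q \<omega> \<partial>M) = (\<integral>x. x p * x q \<partial>\<mu>)"
    and \<mu>: "gaussian_field_spec \<mu> f"
  shows "fidi_conv M (\<lambda>N p \<omega>. (\<Sum>n<N. U n p \<omega>) / sqrt (real N)) \<mu>"
proof -
  interpret prob_space M by fact
  interpret mu: prob_space \<mu> using \<mu> by (simp add: gaussian_field_spec_def)
  have s\<mu> [measurable_cong]: "sets \<mu> = sets (PiM UNIV (\<lambda>_. borel))" using \<mu> by (simp add: gaussian_field_spec_def)
  have meas: "(\<lambda>\<omega> p. U n p \<omega>) \<in> measurable M (PiM UNIV (\<lambda>_. borel))" for n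
    using indep by (auto simp: indep_vars_def)
  have meas' [measurable]: "U n p \<in> borel_measurable M" for n p
    using measurable_compose[OF meas[of n] measurable_component_singleton[of p UNIV "\<lambda>_. borel"]] by simp
  define Z where "Z N \<omega> = (\<lambda>p. (\<Sum>n<N. U n p \<omega>) / sqrt (real N))" for N \<omega>
  have Z [measurable]: "Z N \<in> measurable M (PiM UNIV (\<lambda>_. borel))" for N
    unfolding Z_def by (rule measurable_PiM_single') auto
  have Zp [measurable]: "(\<lambda>\<omega>. Z N \<omega> p) \<in> borel_measurable M" for N p
    unfolding Z_def by measurable
  have lin [measurable]: "(\<lambda>x. \<Sum>p\<in>S. a p * x p) \<in> borel_measurable (PiM UNIV (\<lambda>_. borel :: real measure))" for S a
    by measurable
  have sq\<mu>: "integrable \<mu> (\<lambda>x. (x p)\<^sup>2)" for p using \<mu> unfolding gaussian_field_spec_def by blast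
  have coord [measurable]: "(\<lambda>x. x p) \<in> borel_measurable \<mu>" for p by measurable
  note Ysq = integrable_square_sum[where f = "U _" and M = M, OF meas' sq]
  have Y_indep: "indep_vars (\<lambda>_. borel) (\<lambda>n \<omega>. \<Sum>p\<in>S. a p * U n p \<omega>) UNIV" for S a
    using indep_vars_compose2[OF indep, of "\<lambda>_ x. \<Sum>p\<in>S. a p * x p" "\<lambda>_. borel"] by simp
  have U_int: "integrable M (U n p)" for n p
    using square_integrable_imp_integrable[OF meas' sq] .
  have Y_mean: "expectation (\<lambda>\<omega>. \<Sum>p\<in>S. a p * U n p \<omega>) = 0" for S a n
    by (simp add: U_int mean)
  have Y_distr: "distr M borel (\<lambda>\<omega>. \<Sum>p\<in>S. a p * U n p \<omega>) = distr M borel (\<lambda>\<omega>. \<Sum>p\<in>S. a p * U 0 p \<omega>)" for S a n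
  proof -
    have "distr M borel (\<lambda>\<omega>. \<Sum>p\<in>S. a p * U n p \<omega>)
       = distr (distr M (PiM UNIV (\<lambda>_. borel)) (\<lambda>\<omega> p. U n p \<omega>)) borel (\<lambda>x. \<Sum>p\<in>S. a p * x p)" for n
      by (subst distr_distr[OF lin meas]) (simp add: comp_def)
    then show ?thesis using ident[of n] by simp
  qed
  have conv: "(\<lambda>N. \<integral>\<omega>. cos ((\<Sum>p\<in>S. a p * Z N \<omega> p) + b) \<partial>M) \<longlonglongrightarrow> (\<integral>x. cos ((\<Sum>p\<in>S. a p * x p) + b) \<partial>\<mu>)"
    if S: "finite S" for S a b
  proof -
    obtain v where v: "gaussian_rv \<mu> (\<lambda>x. \<Sum>p\<in>S. a p * x p) 0 v"
      using \<mu> S unfolding gaussian_field_spec_def by blast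
    \<comment> \<open>The specification of \<open>\<mu>\<close> only asserts that some variance
      exists; it is identified through the second moment and then matched with the covariance of one
      copy.\<close>
    have "v = (\<integral>x. (\<Sum>p\<in>S. a p * x p)\<^sup>2 \<partial>\<mu>)"
      using gaussian_rv_second_moment[OF v] by simp
    also have "\<dots> = (\<Sum>p\<in>S. \<Sum>q\<in>S. a p * a q * (\<integral>x. x p * x q \<partial>\<mu>))"
      by (rule integrable_square_sum(2)[OF coord sq\<mu>])
    finally have var: "expectation (\<lambda>\<omega>. (\<Sum>p\<in>S. a p * U n p \<omega>)\<^sup>2) = v" for n
      by (simp add: Ysq(2) cov)
    have eq: "(\<Sum>p\<in>S. a p * Z N \<omega> p) = (\<Sum>n<N. \<Sum>p\<in>S. a p * U n p \<omega>) / sqrt (real N)" for N \<omega>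
      unfolding Z_def by (subst sum.swap) (simp add: sum_divide_distrib sum_distrib_left)
    show ?thesis
      unfolding mu.gaussian_rv_cos[OF v] eq
      by (rule clt_cos[OF Y_indep Y_mean Ysq(1) var Y_distr])
  qed
  have Z2: "integrable M (\<lambda>\<omega>. (Z N \<omega> p)\<^sup>2)" "expectation (\<lambda>\<omega>. (Z N \<omega> p)\<^sup>2) \<le> (\<integral>x. (x p)\<^sup>2 \<partial>\<mu>)" for N p
  proof -
    have eq: "(Z N \<omega> p)\<^sup>2 = (\<Sum>n<N. (1 / sqrt (real N)) * U n p \<omega>)\<^sup>2" for \<omega>
      by (simp add: Z_def sum_divide_distrib)
    have i: "indep_vars (\<lambda>_. borel) (\<lambda>n. U n p) UNIV"
      using Y_indep[of "\<lambda>_. 1" "{p}"] by simp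
    have 0: "expectation (\<lambda>\<omega>. U n p \<omega> * U m p \<omega>) = 0" if "n \<noteq> m" for n m
      using indep_vars_lebesgue_integral[of "{n, m}" "\<lambda>n. U n p"] that indep_vars_subset[OF i] U_int mean by simp
    show "integrable M (\<lambda>\<omega>. (Z N \<omega> p)\<^sup>2)"
      unfolding eq by (rule integrable_square_sum(1)[OF meas' sq])
    have "expectation (\<lambda>\<omega>. (Z N \<omega> p)\<^sup>2) = (\<Sum>n<N. \<Sum>m<N. 1 / sqrt (real N) * (1 / sqrt (real N)) * expectation (\<lambda>\<omega>. U n p \<omega> * U m p \<omega>))"
      unfolding eq by (rule integrable_square_sum(2)[OF meas' sq])
    also have "\<dots> = (\<Sum>n<N. 1 / real N * (\<integral>x. x p * x p \<partial>\<mu>))"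
    proof (intro sum.cong refl)
      fix n assume "n \<in> {..<N}"
      then have "(\<Sum>m<N. 1 / sqrt (real N) * (1 / sqrt (real N)) * expectation (\<lambda>\<omega>. U n p \<omega> * U m p \<omega>))
          = (\<Sum>m\<in>{n}. 1 / sqrt (real N) * (1 / sqrt (real N)) * expectation (\<lambda>\<omega>. U n p \<omega> * U m p \<omega>))"
        by (intro sum.mono_neutral_right) (auto simp: 0)
      then show "(\<Sum>m<N. 1 / sqrt (real N) * (1 / sqrt (real N)) * expectation (\<lambda>\<omega>. U n p \<omega> * U m p \<omega>)) = 1 / real N * (\<integral>x. x p * x p \<partial>\<mu>)"
        by (simp add: cov)
    qed
    \<comment> \<open>At \<open>N = 0\<close> the left side is an empty sum, hence an inequality
      only.\<close>
    also have "\<dots> \<le> (\<integral>x. x p * x p \<partial>\<mu>)"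
      by (cases "N = 0") auto
    finally show "expectation (\<lambda>\<omega>. (Z N \<omega> p)\<^sup>2) \<le> (\<integral>x. (x p)\<^sup>2 \<partial>\<mu>)" by (simp add: power2_eq_square)
  qed
  have tight: "\<exists>R. measure \<mu> {x. \<bar>x p\<bar> > R} \<le> e \<and> (\<forall>N. measure (distr M (PiM UNIV (\<lambda>_. borel)) (Z N)) {x. \<bar>x p\<bar> > R} \<le> e)"
    if e: "e > 0" for p e
  proof -
    define w where "w = (\<integral>x. (x p)\<^sup>2 \<partial>\<mu>)"
    have w: "w \<ge> 0" unfolding w_def by simp
    \<comment> \<open>This makes \<open>w / R\<^sup>2 \<le> e\<close>; the added 1 keeps
      \<open>R\<close> positive when the second moment is 0.\<close>
    define R where "R = sqrt (w / e) + 1"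
    have R: "R > 0" unfolding R_def using w e by (simp add: add_nonneg_pos)
    have "w / e \<le> R\<^sup>2"
      using w e unfolding R_def power2_sum by simp
    then have wR: "w / R\<^sup>2 \<le> e" using e R by (simp add: field_simps)
    have sp: "space \<mu> = UNIV" using sets_eq_imp_space_eq[OF s\<mu>] by (simp add: space_PiM)
    have "measure \<mu> {x. \<bar>x p\<bar> > R} \<le> e"
      using order_trans[OF mu.chebyshev_square[OF coord[of p] sq\<mu>[of p] R] wR[unfolded w_def]]
      by (simp add: sp)
    moreover have "measure (distr M (PiM UNIV (\<lambda>_. borel)) (Z N)) {x. \<bar>x p\<bar> > R} \<le> e" for N
    proof -
      have "{x. \<bar>x p\<bar> > R} \<in> sets (PiM UNIV (\<lambda>_. borel :: real measure))"
      proof -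
        have "{x \<in> space (PiM UNIV (\<lambda>_. borel)). \<bar>x p\<bar> > R} \<in> sets (PiM UNIV (\<lambda>_. borel :: real measure))" by measurable
        then show ?thesis by (simp add: space_PiM)
      qed
      then have "measure (distr M (PiM UNIV (\<lambda>_. borel)) (Z N)) {x. \<bar>x p\<bar> > R} = measure M {\<omega>\<in>space M. \<bar>Z N \<omega> p\<bar> > R}"
        by (subst measure_distr[OF Z]) (auto intro!: arg_cong[where f = "measure M"])
      also have "\<dots> \<le> expectation (\<lambda>\<omega>. (Z N \<omega> p)\<^sup>2) / R\<^sup>2"
        by (rule chebyshev_square[OF Zp Z2(1) R])
      also have "\<dots> \<le> w / R\<^sup>2" using Z2(2)[of N p] by (intro divide_right_mono) (auto simp: w_def)
      finally show ?thesis using wR by simp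
    qed
    ultimately show ?thesis by blast
  qed
  show ?thesis unfolding fidi_conv_def
  proof (intro allI impI, elim conjE)
    fix S and g :: "(int \<times> int \<Rightarrow> real) \<Rightarrow> real"
    assume S: "finite S" and g: "continuous_on UNIV g" "bounded (range g)"
      and dep: "\<forall>x y. (\<forall>p\<in>S. x p = y p) \<longrightarrow> g x = g y"
    have [measurable]: "g \<in> borel_measurable (PiM UNIV (\<lambda>_. borel))"
      by (rule borel_measurable_continuous_PiM[OF g(1)])
    have "(\<lambda>N. \<integral>x. g x \<partial>distr M (PiM UNIV (\<lambda>_. borel)) (Z N)) \<longlonglongrightarrow> (\<integral>x. g x \<partial>\<mu>)"
    proof (rule weak_convergence_from_trig[OF _ _ _ _ S _ _ g])
      show "prob_space (distr M (PiM UNIV (\<lambda>_. borel)) (Z N))" for N by (rule prob_space_distr[OF Z])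
      show "(\<lambda>N. \<integral>x. cos ((\<Sum>p\<in>S. a p * x p) + b) \<partial>distr M (PiM UNIV (\<lambda>_. borel)) (Z N))
        \<longlonglongrightarrow> (\<integral>x. cos ((\<Sum>p\<in>S. a p * x p) + b) \<partial>\<mu>)" for a b
        using conv[OF S, of a b] by (subst integral_distr[OF Z]) auto
    qed (use dep tight s\<mu> mu.prob_space_axioms in auto)
    then show "(\<lambda>N. \<integral>\<omega>. g (\<lambda>p. (\<Sum>n<N. U n p \<omega>) / sqrt (real N)) \<partial>M) \<longlonglongrightarrow> integral\<^sup>L \<mu> g"
      by (subst (asm) integral_distr[OF Z]) (auto simp: Z_def)
  qed
qed

section \<open>Laurent coefficients and lattice walks\<close>

abbreviation counting :: "'a measure" where
  "counting \<equiv> count_space UNIV"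

text \<open>Fubini for counting measure times \<open>M\<close>. Lattice sums are written as
  integrals over counting measure, so exchanging sum and sum, or sum and integral, is one and the
  same statement.\<close>

lemma sum_integral_interchange:
  fixes f :: "'c::countable \<Rightarrow> 'b \<Rightarrow> 'd::{banach, second_countable_topology}"
  assumes M: "sigma_finite_measure M"
    and int: "\<And>q. integrable M (f q)"
    and sum: "integrable counting (\<lambda>q. \<integral>x. norm (f q x) \<partial>M)"
  shows AE_sum_integrable: "AE x in M. integrable counting (\<lambda>q. f q x)"
    and integrable_sum_integral: "integrable M (\<lambda>x. \<integral>q. f q x \<partial>counting)"
    and integral_sum_integral: "(\<integral>x. \<integral>q. f q x \<partial>counting \<partial>M) = (\<integral>q. \<integral>x. f q x \<partial>M \<partial>counting)"
proof -
  interpret M: sigma_finite_measure M by fact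
  interpret C: sigma_finite_measure "counting :: 'c measure"
    by (rule sigma_finite_measure_count_space)
  interpret P: pair_sigma_finite "counting :: 'c measure" M ..
  have "(\<lambda>(q, x). f q x) \<in> borel_measurable (counting \<Otimes>\<^sub>M M)"
    by (rule measurable_pair_measure_countable1) (use int in auto)
  then have "integrable (counting \<Otimes>\<^sub>M M) (\<lambda>(q, x). f q x)"
    by (rule P.Fubini_integrable) (use sum int in auto)
  from P.AE_integrable_snd[OF this] P.integrable_snd[OF this] P.Fubini_integral[OF this]
  show "AE x in M. integrable counting (\<lambda>q. f q x)" "integrable M (\<lambda>x. \<integral>q. f q x \<partial>counting)"
    "(\<integral>x. \<integral>q. f q x \<partial>counting \<partial>M) = (\<integral>q. \<integral>x. f q x \<partial>M \<partial>counting)" by auto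
qed

section \<open>Fourier series of the walk counts and of the Green function\<close>

definition phase :: "real \<times> real \<Rightarrow> int \<times> int \<Rightarrow> real" where
  "phase t q = real_of_int (fst q) * fst t + real_of_int (snd q) * snd t"

text \<open>The value of z1 + 1/z1 + z2 + 1/z2 at z1 = e^(i t1), z2 = e^(i t2).\<close>

definition walk_symbol :: "real \<times> real \<Rightarrow> real" where
  "walk_symbol t = 2 * (cos (fst t) + cos (snd t))"

text \<open>These are the Laurent coefficients of \<open>(z1 + 1/z1 + z2 + 1/z2) ^ n\<close>.\<close>

fun walks :: "nat \<Rightarrow> int \<times> int \<Rightarrow> real" where
  "walks 0 q = of_bool (q = (0, 0))"
| "walks (Suc n) (k, l) = walks n (k - 1, l) + walks n (k + 1, l) + walks n (k, l - 1) + walks n (k, l + 1)"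

lemma walks_nonneg: "0 \<le> walks n q"
  by (induction n q rule: walks.induct) auto

lemma has_bochner_integral_counting_shift:
  fixes f :: "int \<times> int \<Rightarrow> complex"
  assumes "has_bochner_integral counting f v"
  shows "has_bochner_integral counting (\<lambda>q. f (fst q + a, snd q + b)) v"
proof -
  have bij: "bij_betw (\<lambda>q :: int \<times> int. (fst q + a, snd q + b)) UNIV UNIV"
    by (rule bij_betwI[where g = "\<lambda>q. (fst q - a, snd q - b)"]) auto
  show ?thesis
    using assms integrable_bij_count_space[OF bij, of f] integral_bij_count_space[OF bij, of f]
    by (simp add: has_bochner_integral_iff)
qed

text \<open>The recursion is a convolution with the four unit steps. Shifting the lattice multiplies
  a Fourier series by a character, and the four characters add up to the symbol.\<close>

lemma walks_fourier:
  "has_bochner_integral counting (\<lambda>q. complex_of_real (walks n q) * cis (phase t q)) (complex_of_real (walk_symbol t ^ n))"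
proof (induction n)
  case 0
  have "has_bochner_integral counting (indicator {(0,0)} :: int \<times> int \<Rightarrow> real) (measure counting {(0::int,0::int)})"
    by (rule has_bochner_integral_real_indicator) auto
  from has_bochner_integral_scaleR_left[OF this, of "1 :: complex"]
  have "has_bochner_integral counting (\<lambda>q :: int \<times> int. indicator {(0,0)} q *\<^sub>R (1 :: complex)) 1"
    by simp
  moreover have "complex_of_real (walks 0 q) * cis (phase t q) = indicator {(0,0)} q *\<^sub>R 1" for q
    by (auto simp: phase_def indicator_def)
  ultimately show ?case by (simp only: power_0 of_real_1)
next
  case (Suc n)
  define F where "F q = complex_of_real (walks n q) * cis (phase t q)" for q
  have step: "has_bochner_integral counting (\<lambda>q. F (fst q + a, snd q + b) * cis (- phase t (a, b)))
     (complex_of_real (walk_symbol t ^ n) * cis (- phase t (a, b)))" for a b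
    by (intro has_bochner_integral_mult_left has_bochner_integral_counting_shift)
      (use Suc.IH in \<open>simp add: F_def\<close>)
  have eq: "complex_of_real (walks (Suc n) q) * cis (phase t q)
      = F (fst q + (-1), snd q + 0) * cis (- phase t (-1, 0)) + F (fst q + 1, snd q + 0) * cis (- phase t (1, 0))
      + F (fst q + 0, snd q + (-1)) * cis (- phase t (0, -1)) + F (fst q + 0, snd q + 1) * cis (- phase t (0, 1))" for q
  proof -
    have "F (fst q + a, snd q + b) * cis (- phase t (a, b))
        = complex_of_real (walks n (fst q + a, snd q + b)) * cis (phase t q)" for a b
      by (simp add: F_def phase_def mult.assoc cis_mult distrib_right)
    from this[of "-1" 0] this[of 1 0] this[of 0 "-1"] this[of 0 1]
    show ?thesis by (cases q) (simp add: distrib_right)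
  qed
  have "cis (- phase t (-1, 0)) + cis (- phase t (1, 0)) + cis (- phase t (0, -1)) + cis (- phase t (0, 1))
      = complex_of_real (walk_symbol t)"
    by (simp add: phase_def walk_symbol_def complex_eq_iff)
  then have val: "complex_of_real (walk_symbol t ^ Suc n)
      = complex_of_real (walk_symbol t ^ n) * cis (- phase t (-1, 0)) + complex_of_real (walk_symbol t ^ n) * cis (- phase t (1, 0))
      + complex_of_real (walk_symbol t ^ n) * cis (- phase t (0, -1)) + complex_of_real (walk_symbol t ^ n) * cis (- phase t (0, 1))"
    by (simp add: distrib_left[symmetric] mult.commute)
  show ?case unfolding eq val by (intro has_bochner_integral_add step)
qed

text \<open>Frequency zero turns the Fourier series into the total mass.\<close>

lemma walks_total: "has_bochner_integral counting (walks n) (4 ^ n)"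
proof -
  have *: "has_bochner_integral counting (\<lambda>q. complex_of_real (walks n q)) (complex_of_real (4 ^ n))"
    using walks_fourier[of n "(0, 0)"] by (simp add: phase_def walk_symbol_def)
  have "has_bochner_integral counting (\<lambda>q. Re (complex_of_real (walks n q))) (Re (complex_of_real (4 ^ n)))"
    using has_bochner_integral_bounded_linear[OF bounded_linear_Re *] .
  then show ?thesis by simp
qed

definition green :: "real \<Rightarrow> int \<times> int \<Rightarrow> real" where
  "green x q = (\<integral>n. x ^ n * walks n q \<partial>counting)"

lemma abs_walk_symbol_le: "\<bar>walk_symbol t\<bar> \<le> 4"
proof -
  have "\<bar>2 * (c + d)\<bar> \<le> 4" if "\<bar>c\<bar> \<le> 1" "\<bar>d\<bar> \<le> 1" for c d :: real
    using that unfolding distrib_left by linarith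
  then show ?thesis unfolding walk_symbol_def by simp
qed

lemma has_bochner_integral_geometric:
  fixes r :: complex
  assumes "norm r < 1"
  shows "has_bochner_integral counting (\<lambda>n. r ^ n) (1 / (1 - r))"
proof -
  have "integrable counting (\<lambda>n. r ^ n)"
    using assms by (simp add: integrable_count_space_nat_iff norm_power)
  then show ?thesis
    using integral_count_space_nat[of "\<lambda>n. r ^ n"] suminf_geometric[OF assms]
    by (simp add: has_bochner_integral_iff)
qed

text \<open>The double series over lengths and sites converges absolutely: summing over sites first
  leaves the geometric series of \<open>(4 * x) ^ n\<close>, which is where \<open>x < 1/4\<close>
  enters. Exchanging the sums gives the geometric series of
  \<open>x * walk_symbol t\<close>.\<close>

lemma green_fourier:
  assumes x: "0 \<le> x" "x < 1/4"
  shows "has_bochner_integral counting (\<lambda>q. complex_of_real (green x q) * cis (phase t q))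
           (complex_of_real (1 / (1 - x * walk_symbol t)))"
proof -
  define f where "f n q = complex_of_real (x ^ n * walks n q) * cis (phase t q)" for n q
  have int: "has_bochner_integral counting (f n) (complex_of_real ((x * walk_symbol t) ^ n))" for n
    using has_bochner_integral_mult_right[OF walks_fourier[of n t], of "complex_of_real (x ^ n)"]
    by (simp add: f_def[abs_def] mult.assoc power_mult_distrib)
  have norm: "(\<integral>q. norm (f n q) \<partial>counting) = (4 * x) ^ n" for n
    using has_bochner_integral_mult_right[OF walks_total[of n], of "x ^ n"] x(1)
    by (simp add: f_def norm_mult abs_mult walks_nonneg has_bochner_integral_iff power_mult_distrib mult.commute norm_power)
  have sum: "integrable counting (\<lambda>n. \<integral>q. norm (f n q) \<partial>counting)"
    unfolding norm integrable_count_space_nat_iff norm_power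
    by (rule summable_geometric) (use x in simp)
  have sf: "sigma_finite_measure (counting :: (int \<times> int) measure)"
    by (rule sigma_finite_measure_count_space)
  have intf: "integrable counting (f n)" for n using int by (rule integrable.intros)
  have "(\<integral>n. f n q \<partial>counting) = complex_of_real (green x q) * cis (phase t q)" for q
    unfolding f_def green_def integral_mult_left_zero integral_complex_of_real ..
  moreover have "(\<integral>n. \<integral>q. f n q \<partial>counting \<partial>counting) = complex_of_real (1 / (1 - x * walk_symbol t))"
  proof -
    have "norm (complex_of_real (x * walk_symbol t)) < 1"
    proof -
      have "\<bar>x * walk_symbol t\<bar> \<le> x * 4"
        using abs_walk_symbol_le[of t] x(1) by (simp add: abs_mult mult_left_mono)
      then show ?thesis using x by (simp del: of_real_mult)
    qed
    from has_bochner_integral_geometric[OF this] show ?thesis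
      using has_bochner_integral_integral_eq[OF int] by (simp add: has_bochner_integral_iff)
  qed
  ultimately show ?thesis
    using integrable_sum_integral[OF sf intf sum] integral_sum_integral[OF sf intf sum]
    by (simp add: has_bochner_integral_iff)
qed

lemma green_nonneg: "0 \<le> x \<Longrightarrow> 0 \<le> green x q"
  unfolding green_def by (intro integral_nonneg_AE AE_I2) (simp add: walks_nonneg)

text \<open>At frequency zero all characters are 1, so the summability of the Fourier series is that
  of \<open>green x\<close> itself.\<close>

lemma integrable_green:
  assumes x: "0 \<le> x" "x < 1/4"
  shows "integrable counting (green x)"
proof -
  have "integrable counting (\<lambda>q. Re (complex_of_real (green x q) * cis (phase (0, 0) q)))"
    using green_fourier[OF x, of "(0, 0)"] by (intro integrable_Re) (rule integrable.intros)
  then show ?thesis by (simp add: phase_def)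
qed

section \<open>Fourier inversion on the torus and Parseval's identity\<close>

definition torus :: "(real \<times> real) measure" where
  "torus = restrict_space lborel ({-pi..pi} \<times> {-pi..pi})"

lemma square_sets: "{-pi..pi} \<times> {-pi..pi} \<in> sets (lborel :: (real \<times> real) measure)"
  by (simp add: borel_closed closed_Times)

lemma torus_integral:
  fixes f :: "real \<times> real \<Rightarrow> 'b::{banach, second_countable_topology}"
  shows "set_lebesgue_integral lborel ({-pi..pi} \<times> {-pi..pi}) f = integral\<^sup>L torus f"
  unfolding torus_def set_lebesgue_integral_def
  by (subst integral_restrict_space) (use square_sets in auto)

lemma finite_measure_torus: "finite_measure torus"
proof
  have "emeasure lborel ({-pi..pi} \<times> {-pi..pi}) < (\<infinity> :: ennreal)"
    by (intro emeasure_bounded_finite bounded_Times) auto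
  then show "emeasure torus (space torus) \<noteq> \<infinity>"
    unfolding torus_def using square_sets
    by (subst emeasure_restrict_space) (auto simp: space_restrict_space)
qed

lemma borel_measurable_torusI:
  assumes "f \<in> borel_measurable borel" shows "f \<in> borel_measurable torus"
  unfolding torus_def using assms by (intro measurable_restrict_space1) simp

lemma integral_cis:
  "(\<integral>t. indicator {-pi..pi} t *\<^sub>R cis (real_of_int k * t) \<partial>lborel) = 2 * complex_of_real pi * of_bool (k = 0)"
proof (cases "k = 0")
  case True
  then show ?thesis by (simp add: scaleR_conv_of_real)
next
  case False
  define F where "F t = cis (real_of_int k * t) / (\<i> * complex_of_real (real_of_int k))" for t
  have "(\<integral>t. indicator {-pi..pi} t *\<^sub>R cis (real_of_int k * t) \<partial>lborel) = F pi - F (-pi)"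
  proof (rule integral_FTC_atLeastAtMost)
    fix t assume "-pi \<le> t" "t \<le> pi"
    have "((\<lambda>t. exp (\<i> * complex_of_real (real_of_int k) * complex_of_real t) / (\<i> * complex_of_real (real_of_int k)))
      has_vector_derivative (exp (\<i> * complex_of_real (real_of_int k) * complex_of_real t))) (at t within {-pi..pi})"
      by (rule has_vector_derivative_real_field)
         (auto intro!: derivative_eq_intros simp: False)
    then show "(F has_vector_derivative cis (real_of_int k * t)) (at t within {-pi..pi})"
      by (simp add: F_def[abs_def] cis_conv_exp mult.assoc)
  qed (auto intro!: continuous_intros)
  also have "\<dots> = 0"
    by (simp add: F_def complex_eq_iff cis.ctr mult.commute[of _ pi] diff_divide_distrib[symmetric])
  finally show ?thesis using False by simp
qed

lemma torus_orthogonality: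
  "(\<integral>t. cis (phase t q) \<partial>torus) = 4 * complex_of_real (pi\<^sup>2) * of_bool (q = (0, 0))"
proof -
  define g where "g k t = indicator {-pi..pi} t *\<^sub>R cis (real_of_int k * t)" for k t
  have gm [measurable]: "g k \<in> borel_measurable borel" for k
    unfolding g_def by (intro borel_measurable_scaleR borel_measurable_indicator borel_measurable_continuous_onI continuous_intros) auto
  have gi: "integrable lborel (g k)" for k
    unfolding g_def by (rule borel_integrable_compact) (auto intro!: continuous_intros)
  have eq: "indicator ({-pi..pi} \<times> {-pi..pi}) t *\<^sub>R cis (phase t q) = g (fst q) (fst t) * g (snd q) (snd t)" for t
    by (cases t) (auto simp: g_def phase_def cis_mult indicator_def)
  have "(\<integral>t. cis (phase t q) \<partial>torus) = (\<integral>t. g (fst q) (fst t) * g (snd q) (snd t) \<partial>lborel)"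
    unfolding torus_integral[symmetric] set_lebesgue_integral_def eq ..
  also have "\<dots> = (\<integral>t. g (fst q) (fst t) * g (snd q) (snd t) \<partial>(lborel \<Otimes>\<^sub>M lborel))"
    by (simp add: lborel_prod)
  also have "\<dots> = (\<integral>s. \<integral>t. g (fst q) s * g (snd q) t \<partial>lborel \<partial>lborel)"
  proof (subst lborel_pair.integral_fst'[symmetric])
    show "integrable (lborel \<Otimes>\<^sub>M lborel) (\<lambda>t. g (fst q) (fst t) * g (snd q) (snd t))"
      by (rule lborel_pair.Fubini_integrable) (use gi in \<open>auto simp: norm_mult\<close>)
  qed simp
  also have "\<dots> = (\<integral>s. g (fst q) s \<partial>lborel) * (\<integral>t. g (snd q) t \<partial>lborel)" by simp
  also have "\<dots> = 4 * complex_of_real (pi\<^sup>2) * of_bool (q = (0, 0))"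
    unfolding g_def integral_cis by (cases q) (auto simp: power2_eq_square)
  finally show ?thesis .
qed

lemma phase_measurable [measurable]: "(\<lambda>t. cis (phase t q)) \<in> borel_measurable borel"
  unfolding phase_def by (intro borel_measurable_continuous_onI continuous_intros)

lemma phase_diff: "phase t (a - c, b - d) = phase t (a, b) - phase t (c, d)"
  by (simp add: phase_def left_diff_distrib)

text \<open>Insert the Fourier series and integrate term by term, which is allowed since
  \<open>green x\<close> is summable and the torus has finite mass; orthogonality keeps only the
  term \<open>r = q\<close>.\<close>

lemma green_fourier_inverse:
  assumes x: "0 \<le> x" "x < 1/4"
  shows "(\<integral>t. complex_of_real (1 / (1 - x * walk_symbol t)) * cis (- phase t q) \<partial>torus)
    = 4 * complex_of_real (pi\<^sup>2) * complex_of_real (green x q)"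
proof -
  interpret T: finite_measure torus by (rule finite_measure_torus)
  define f where "f r t = complex_of_real (green x r) * cis (phase t (fst r - fst q, snd r - snd q))" for r t
  have f: "f r t = complex_of_real (green x r) * cis (phase t r) * cis (- phase t q)" for r t
    by (cases r; cases q) (simp add: f_def phase_diff mult.assoc cis_mult)
  have meas [measurable]: "f r \<in> borel_measurable torus" for r
    unfolding f_def by (intro borel_measurable_times borel_measurable_const borel_measurable_torusI phase_measurable)
  have int: "integrable torus (f r)" for r
    by (rule T.integrable_const_bound[of _ "green x r"]) (auto simp: f_def norm_mult green_nonneg x)
  have "(\<integral>t. norm (f r t) \<partial>torus) = measure torus (space torus) * green x r" for r
    by (simp add: f_def norm_mult green_nonneg x)
  then have sum: "integrable counting (\<lambda>r. \<integral>t. norm (f r t) \<partial>torus)"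
    using integrable_green[OF x] by simp
  have "complex_of_real (1 / (1 - x * walk_symbol t)) * cis (- phase t q) = (\<integral>r. f r t \<partial>counting)" for t
    using has_bochner_integral_mult_left[OF green_fourier[OF x, of t], of "cis (- phase t q)"]
    by (simp add: f has_bochner_integral_iff)
  then have "(\<integral>t. complex_of_real (1 / (1 - x * walk_symbol t)) * cis (- phase t q) \<partial>torus)
      = (\<integral>t. \<integral>r. f r t \<partial>counting \<partial>torus)" by simp
  also have "\<dots> = (\<integral>r. \<integral>t. f r t \<partial>torus \<partial>counting)"
    by (rule integral_sum_integral[OF T.sigma_finite_measure_axioms int sum])
  also have "\<dots> = (\<integral>r. indicator {q} r *\<^sub>R (4 * complex_of_real (pi\<^sup>2) * complex_of_real (green x q)) \<partial>counting)"
    by (intro Bochner_Integration.integral_cong refl)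
      (auto simp: f_def torus_orthogonality indicator_def prod_eq_iff)
  also have "\<dots> = 4 * complex_of_real (pi\<^sup>2) * complex_of_real (green x q)" by simp
  finally show ?thesis .
qed

lemma laurent_integrand:
  "(let z1 = exp (\<i> * complex_of_real l1); z2 = exp (\<i> * complex_of_real l2)
     in inverse (1 - complex_of_real x * (z1 + inverse z1 + z2 + inverse z2)))
   * exp (- \<i> * complex_of_real (real_of_int k * l1 + real_of_int l * l2))
  = complex_of_real (1 / (1 - x * walk_symbol (l1, l2))) * cis (- phase (l1, l2) (k, l))"
proof -
  have 1: "exp (\<i> * complex_of_real s) + inverse (exp (\<i> * complex_of_real s)) = complex_of_real (2 * cos s)" for s
    by (simp add: cis_conv_exp[symmetric] complex_eq_iff)
  have "exp (\<i> * complex_of_real l1) + inverse (exp (\<i> * complex_of_real l1))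
      + exp (\<i> * complex_of_real l2) + inverse (exp (\<i> * complex_of_real l2)) = complex_of_real (walk_symbol (l1, l2))"
    using 1[of l1] 1[of l2] by (simp add: walk_symbol_def add.assoc)
  then have "1 - complex_of_real x * (exp (\<i> * complex_of_real l1) + inverse (exp (\<i> * complex_of_real l1))
      + exp (\<i> * complex_of_real l2) + inverse (exp (\<i> * complex_of_real l2))) = complex_of_real (1 - x * walk_symbol (l1, l2))"
    by (simp only:) simp
  moreover have "exp (- \<i> * complex_of_real (real_of_int k * l1 + real_of_int l * l2)) = cis (- phase (l1, l2) (k, l))"
    by (simp add: cis_conv_exp phase_def algebra_simps)
  ultimately show ?thesis
    unfolding Let_def by (simp only: inverse_eq_divide of_real_divide of_real_1)
qed

lemma laurent_coeff_eq:
  "laurent_coeff k l x = (1 / (4 * complex_of_real (pi\<^sup>2))) *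
     (\<integral>t. complex_of_real (1 / (1 - x * walk_symbol t)) * cis (- phase t (k, l)) \<partial>torus)"
  unfolding laurent_coeff_def laurent_integrand torus_integral case_prod_beta' by simp

text \<open>The coefficient is itself real, so passing to the real part in the definition of the
  field changes nothing.\<close>

lemma laurent_coeff_green:
  assumes x: "0 \<le> x" "x < 1/4"
  shows "Re (laurent_coeff k l x) = green x (k, l)"
  unfolding laurent_coeff_eq green_fourier_inverse[OF x] by simp

lemma walk_symbol_pos:
  assumes x: "0 \<le> x" "x < 1/4" shows "0 < 1 - x * walk_symbol t"
proof -
  have "x * walk_symbol t \<le> x * 4" using abs_walk_symbol_le[of t] x by (intro mult_left_mono) auto
  then show ?thesis using x by simp
qed

lemma walk_symbol_measurable [measurable]: "walk_symbol \<in> borel_measurable borel"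
  unfolding walk_symbol_def[abs_def] by (intro borel_measurable_continuous_onI continuous_intros)

text \<open>Parseval's identity for an autocorrelation: only the second Green factor is replaced by
  its torus integral, and after the exchange the sum over \<open>w\<close> reassembles the Fourier
  series of the first.\<close>

lemma green_convolution:
  assumes x: "0 \<le> x" "x < 1/4"
  shows "complex_of_real (\<integral>w. green x w * green x (fst w - fst h, snd w - snd h) \<partial>counting)
    = (1 / (4 * complex_of_real (pi\<^sup>2))) *
      (\<integral>t. cis (phase t h) * complex_of_real (1 / (1 - x * walk_symbol t)\<^sup>2) \<partial>torus)"
proof -
  interpret T: finite_measure torus by (rule finite_measure_torus)
  define G where "G t = 1 / (1 - x * walk_symbol t)" for t
  define f where "f w t = complex_of_real (green x w) * (complex_of_real (G t) * cis (- phase t (fst w - fst h, snd w - snd h)))" for w t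
  have G0: "0 \<le> G t" for t using walk_symbol_pos[OF x, of t] by (simp add: G_def)
  have GB: "G t \<le> 1 / (1 - 4 * x)" for t
  proof -
    have "x * walk_symbol t \<le> x * 4" using abs_walk_symbol_le[of t] x by (intro mult_left_mono) auto
    then show ?thesis unfolding G_def using x by (intro divide_left_mono) auto
  qed
  have [measurable]: "G \<in> borel_measurable torus"
    unfolding G_def[abs_def] by (intro borel_measurable_torusI) measurable
  have cm [measurable]: "(\<lambda>t. cis (- phase t q)) \<in> borel_measurable torus" for q
    using borel_measurable_torusI[OF phase_measurable[of "(- fst q, - snd q)"]] by (simp add: phase_def)
  have nf: "norm (f w t) = green x w * G t" for w t
    using G0 green_nonneg[OF x(1)] by (simp add: f_def norm_mult)
  have Gint: "integrable torus G"
    by (rule T.integrable_const_bound[of _ "1 / (1 - 4 * x)"]) (use G0 GB in auto)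
  have int: "integrable torus (f w)" for w
    by (rule Bochner_Integration.integrable_bound[of _ "\<lambda>t. green x w * G t"])
      (use Gint nf G0 green_nonneg[OF x(1)] in \<open>auto simp: f_def[abs_def]\<close>)
  have sum: "integrable counting (\<lambda>w. \<integral>t. norm (f w t) \<partial>torus)"
    using integrable_green[OF x] by (simp add: nf)
  have "complex_of_real (\<integral>w. green x w * green x (fst w - fst h, snd w - snd h) \<partial>counting)
      = (\<integral>w. (1 / (4 * complex_of_real (pi\<^sup>2))) * (\<integral>t. f w t \<partial>torus) \<partial>counting)"
  proof -
    have "(\<integral>t. f w t \<partial>torus) = complex_of_real (green x w) *
        (4 * complex_of_real (pi\<^sup>2) * complex_of_real (green x (fst w - fst h, snd w - snd h)))" for w
      unfolding f_def G_def integral_mult_right_zero green_fourier_inverse[OF x] ..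
    then have "complex_of_real (green x w * green x (fst w - fst h, snd w - snd h))
        = (1 / (4 * complex_of_real (pi\<^sup>2))) * (\<integral>t. f w t \<partial>torus)" for w
      by simp
    then show ?thesis unfolding integral_complex_of_real[symmetric] by (simp only:)
  qed
  also have "\<dots> = (1 / (4 * complex_of_real (pi\<^sup>2))) * (\<integral>w. \<integral>t. f w t \<partial>torus \<partial>counting)"
    by (rule integral_mult_right_zero)
  also have "(\<integral>w. \<integral>t. f w t \<partial>torus \<partial>counting) = (\<integral>t. \<integral>w. f w t \<partial>counting \<partial>torus)"
    by (rule integral_sum_integral[OF T.sigma_finite_measure_axioms int sum, symmetric])
  also have "\<dots> = (\<integral>t. cis (phase t h) * complex_of_real (1 / (1 - x * walk_symbol t)\<^sup>2) \<partial>torus)"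
  proof (intro Bochner_Integration.integral_cong refl)
    fix t
    \<comment> \<open>The sum over \<open>w\<close> is a Fourier series at frequency
      \<open>- t\<close>; the symbol is even, so both factors coincide and give the square.\<close>
    have "f w t = complex_of_real (green x w) * cis (phase (- t) w) * (complex_of_real (G t) * cis (phase t h))" for w
      by (simp add: f_def cis_mult mult_ac phase_def algebra_simps)
    then have "(\<integral>w. f w t \<partial>counting) = complex_of_real (1 / (1 - x * walk_symbol (- t))) * (complex_of_real (G t) * cis (phase t h))"
      using has_bochner_integral_mult_left[OF green_fourier[OF x, of "- t"], of "complex_of_real (G t) * cis (phase t h)"]
      by (simp add: has_bochner_integral_iff)
    also have "\<dots> = cis (phase t h) * complex_of_real (1 / (1 - x * walk_symbol t)\<^sup>2)"
      by (simp add: G_def walk_symbol_def power2_eq_square)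
    finally show "(\<integral>w. f w t \<partial>counting) = cis (phase t h) * complex_of_real (1 / (1 - x * walk_symbol t)\<^sup>2)" .
  qed
  finally show ?thesis .
qed

section \<open>Integrability of the spectral density\<close>

text \<open>Taylor's formula with fourth-order remainder. It yields both the lower bound for 1 - cos
  on the whole interval and the limit at the origin.\<close>

lemma cos_quartic_bound: "\<bar>cos x - (1 - x\<^sup>2 / 2)\<bar> \<le> x ^ 4 / 24" for x :: real
proof -
  obtain t where "cos x = (\<Sum>m<4. cos_coeff m * x ^ m) + (cos (t + 1/2 * real 4 * pi) / fact 4) * x ^ 4"
    using Maclaurin_cos_expansion[of x 4] by blast
  moreover have "(\<Sum>m<4. cos_coeff m * x ^ m) = 1 - x\<^sup>2 / 2"
  proof -
    have "{..<4} = {0, 1, 2, 3 :: nat}" by auto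
    then show ?thesis by (simp add: cos_coeff_def)
  qed
  moreover have "fact 4 = (24 :: real)" by (simp add: eval_nat_numeral)
  ultimately have "\<bar>cos x - (1 - x\<^sup>2 / 2)\<bar> = \<bar>cos (t + 1/2 * real 4 * pi)\<bar> * (x ^ 4 / 24)"
    by (simp add: abs_mult)
  also have "\<dots> \<le> 1 * (x ^ 4 / 24)" by (intro mult_right_mono) auto
  finally show ?thesis by simp
qed

text \<open>Since pi < 16/5, the quartic term is at most (256/600) x^2, and 1/2 - 256/600 = 11/150
  exceeds 1/20.\<close>

lemma one_minus_cos_ge:
  fixes x :: real
  assumes "\<bar>x\<bar> \<le> pi" shows "x\<^sup>2 / 20 \<le> 1 - cos x"
proof -
  have "x\<^sup>2 \<le> (16/5)\<^sup>2"
    using assms pi_approx by (intro power2_le_iff_abs_le[THEN iffD2]) auto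
  then have "x\<^sup>2 \<le> 256/25" by (simp add: power2_eq_square)
  then have "x\<^sup>2 * x\<^sup>2 \<le> x\<^sup>2 * (256/25)" by (intro mult_left_mono) auto
  then have "x ^ 4 \<le> x\<^sup>2 * (256/25)" by (simp add: power4_eq_xxxx power2_eq_square mult.assoc)
  moreover have "cos x \<le> 1 - x\<^sup>2 / 2 + x ^ 4 / 24" using cos_quartic_bound[of x] by linarith
  ultimately show ?thesis using zero_le_power2[of x] by linarith
qed

text \<open>With s = 4 (1/4 - x) and v half the sum of the two terms 1 - cos, the symbol is 1 - (1 -
  s)(1 - v) = (1 - s) v + s. For s up to 1/2 the first summand retains v/2; beyond that, s alone
  exceeds 1/2 while s + v is at most 3. The constant 320 is this 8 times the 40 from the bound on
  v.\<close>

lemma symbol_lower_bound: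
  assumes x: "0 \<le> x" "x \<le> 1/4" and t: "\<bar>fst t\<bar> \<le> pi" "\<bar>snd t\<bar> \<le> pi"
  shows "(1/4 - x + (fst t)\<^sup>2 + (snd t)\<^sup>2) / 320 \<le> 1 - x * walk_symbol t"
proof -
  define v where "v = ((1 - cos (fst t)) + (1 - cos (snd t))) / 2"
  define s where "s = 1 - 4 * x"
  have s: "0 \<le> s" "s \<le> 1" using x by (auto simp: s_def)
  have "2 * v = 2 - cos (fst t) - cos (snd t)" by (simp add: v_def)
  then have v: "0 \<le> v" "v \<le> 2"
    using cos_ge_minus_one[of "fst t"] cos_ge_minus_one[of "snd t"] cos_le_one[of "fst t"] cos_le_one[of "snd t"]
    by linarith+
  have D: "1 - x * walk_symbol t = (1 - s) * v + s"
    by (simp add: s_def v_def walk_symbol_def field_simps)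
  have "(s + v) / 8 \<le> (1 - s) * v + s"
  proof (cases "s \<le> 1/2")
    case True
    then have "(1/2) * v \<le> (1 - s) * v" using v by (intro mult_right_mono) auto
    then show ?thesis using s v unfolding add_divide_distrib by linarith
  next
    case False
    have "0 \<le> (1 - s) * v" using s v by simp
    then show ?thesis using False v unfolding add_divide_distrib by linarith
  qed
  moreover have "((fst t)\<^sup>2 + (snd t)\<^sup>2) / 40 \<le> v"
    using one_minus_cos_ge[OF t(1)] one_minus_cos_ge[OF t(2)] by (simp add: v_def field_simps)
  ultimately show ?thesis unfolding D using s zero_le_power2[of "fst t"] zero_le_power2[of "snd t"]
    by (simp add: s_def)
qed

text \<open>A crude form of weighted AM-GM: each base is at most the sum, and the exponents add up
  to 1.\<close>

lemma weighted_product_le_sum: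
  fixes a b c :: real
  assumes "0 \<le> a" "0 \<le> b" "0 \<le> c" "0 \<le> p" "0 \<le> q" "0 \<le> r" "p + q + r = 1"
  shows "a powr p * b powr q * c powr r \<le> a + b + c"
proof -
  have "a powr p * b powr q * c powr r \<le> (a + b + c) powr p * (a + b + c) powr q * (a + b + c) powr r"
    using assms by (intro mult_mono powr_mono2) auto
  also have "\<dots> = (a + b + c) powr (p + q + r)" by (simp add: powr_add)
  also have "\<dots> = a + b + c" using assms by simp
  finally show ?thesis .
qed

text \<open>The parameter \<open>\<tau>\<close> shares out the singularity: weight 1 - \<tau> on 1/4
  - x and \<tau>/2 on each squared frequency, which separates the three variables. Zero frequencies
  are excluded because \<open>powr\<close> returns 0 at base 0, which would make the right side
  vanish.\<close>

lemma symbol_inverse_square_bound: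
  assumes x: "0 \<le> x" "x < 1/4" and t: "\<bar>fst t\<bar> \<le> pi" "\<bar>snd t\<bar> \<le> pi" "fst t \<noteq> 0" "snd t \<noteq> 0"
    and \<tau>: "0 \<le> \<tau>" "\<tau> \<le> 1"
  shows "1 / (1 - x * walk_symbol t)\<^sup>2
    \<le> 320\<^sup>2 * ((1/4 - x) powr (2 * \<tau> - 2) * (\<bar>fst t\<bar> powr (- 2 * \<tau>) * \<bar>snd t\<bar> powr (- 2 * \<tau>)))"
proof -
  define y where "y = 1/4 - x"
  define P where "P = y powr (1 - \<tau>) * (\<bar>fst t\<bar> powr \<tau> * \<bar>snd t\<bar> powr \<tau>)"
  have y: "y > 0" using x by (simp add: y_def)
  have "y powr (1 - \<tau>) * ((fst t)\<^sup>2) powr (\<tau>/2) * ((snd t)\<^sup>2) powr (\<tau>/2) \<le> y + (fst t)\<^sup>2 + (snd t)\<^sup>2"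
    using y \<tau> by (intro weighted_product_le_sum) auto
  moreover have sq: "(u\<^sup>2) powr (\<tau>/2) = \<bar>u\<bar> powr \<tau>" if "u \<noteq> 0" for u :: real
  proof -
    have "u\<^sup>2 = \<bar>u\<bar> powr 2" using that by simp
    then show ?thesis by (simp only: powr_powr) simp
  qed
  ultimately have "P \<le> y + (fst t)\<^sup>2 + (snd t)\<^sup>2"
    using t by (simp add: P_def sq mult.assoc)
  then have le: "P / 320 \<le> 1 - x * walk_symbol t"
    using symbol_lower_bound[of x t] x t by (simp add: y_def)
  have P: "P > 0" using y t by (simp add: P_def)
  have "1 / (1 - x * walk_symbol t)\<^sup>2 \<le> 1 / (P / 320)\<^sup>2"
    using le P walk_symbol_pos[OF x, of t] by (intro divide_left_mono power_mono) auto
  also have "\<dots> = 320\<^sup>2 * (1 / P\<^sup>2)" by (simp add: power_divide)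
  also have "1 / P\<^sup>2 = y powr (2 * \<tau> - 2) * (\<bar>fst t\<bar> powr (- 2 * \<tau>) * \<bar>snd t\<bar> powr (- 2 * \<tau>))"
  proof -
    have *: "1 / (u powr r)\<^sup>2 = u powr (- 2 * r)" if "u > 0" for u r :: real
      using that by (simp add: powr_minus powr_realpow[symmetric] powr_powr mult.commute inverse_eq_divide)
    have "1 / P\<^sup>2 = (1 / (y powr (1 - \<tau>))\<^sup>2) * ((1 / (\<bar>fst t\<bar> powr \<tau>)\<^sup>2) * (1 / (\<bar>snd t\<bar> powr \<tau>)\<^sup>2))"
      by (simp add: P_def power_mult_distrib)
    then show ?thesis using y t by (simp add: * algebra_simps)
  qed
  finally show ?thesis by (simp add: y_def)
qed

section \<open>Integrals of powers and the coefficient density\<close>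

lemma nn_integral_powr_from_0:
  assumes "a > -1" "c \<ge> 0"
  shows "(\<integral>\<^sup>+x. ennreal (x powr a) * indicator {0..c} x \<partial>lborel) = ennreal (c powr (a + 1) / (a + 1))"
  by (rule nn_integral_has_integral_lebesgue'[OF _ has_integral_powr_from_0[OF assms]]) auto

lemma nn_integral_abs_powr:
  assumes a: "a > -1"
  shows "(\<integral>\<^sup>+x. ennreal (\<bar>x\<bar> powr a) * indicator {-pi..pi} x \<partial>lborel) < \<infinity>"
proof -
  define f where "f x = ennreal (x powr a) * indicator {0..pi} x" for x
  have [measurable]: "f \<in> borel_measurable borel" by (simp add: f_def[abs_def])
  have fin: "(\<integral>\<^sup>+x. f x \<partial>lborel) < \<infinity>"
    unfolding f_def by (subst nn_integral_powr_from_0[OF a]) auto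
  have "(\<integral>\<^sup>+x. ennreal (\<bar>x\<bar> powr a) * indicator {-pi..pi} x \<partial>lborel) \<le> (\<integral>\<^sup>+x. f x + f (0 + (-1) * x) \<partial>lborel)"
    by (intro nn_integral_mono) (auto simp: f_def abs_real_def split: split_indicator)
  also have "\<dots> = (\<integral>\<^sup>+x. f x \<partial>lborel) + (\<integral>\<^sup>+x. f (0 + (-1) * x) \<partial>lborel)"
    by (rule nn_integral_add) measurable
  also have "(\<integral>\<^sup>+x. f (0 + (-1) * x) \<partial>lborel) = (\<integral>\<^sup>+x. f x \<partial>lborel)"
    by (subst nn_integral_real_affine[of f "-1" 0]) (auto simp: one_ennreal_def[symmetric])
  finally show ?thesis by (rule le_less_trans) (use fin in simp)
qed

lemma nn_integral_powr_to_quarter: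
  assumes a: "a > -1"
  shows "(\<integral>\<^sup>+x. ennreal ((1/4 - x) powr a) * indicator {0..1/4} x \<partial>lborel) < \<infinity>"
proof -
  define f where "f x = ennreal (x powr a) * indicator {0..1/4} x" for x
  have [measurable]: "f \<in> borel_measurable borel" by (simp add: f_def[abs_def])
  have "(\<integral>\<^sup>+x. ennreal ((1/4 - x) powr a) * indicator {0..1/4} x \<partial>lborel) = (\<integral>\<^sup>+x. f (1/4 + (-1) * x) \<partial>lborel)"
    by (intro nn_integral_cong) (auto simp: f_def split: split_indicator)
  also have "\<dots> = (\<integral>\<^sup>+x. f x \<partial>lborel)"
    by (subst nn_integral_real_affine[of f "-1" "1/4"]) (auto simp: one_ennreal_def[symmetric])
  also have "\<dots> < \<infinity>" unfolding f_def by (subst nn_integral_powr_from_0[OF a]) auto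
  finally show ?thesis .
qed

locale coefficient_density =
  fixes \<alpha> :: real and \<Phi> :: "real \<Rightarrow> real" and B :: real
  assumes alpha_pos: "\<alpha> > 0"
    and Phi_meas: "set_borel_measurable borel {0..1/4} \<Phi>"
    and Phi_nonneg: "\<And>x. x \<in> {0..1/4} \<Longrightarrow> 0 \<le> \<Phi> x"
    and Phi_le: "\<And>x. x \<in> {0..1/4} \<Longrightarrow> \<Phi> x \<le> B"
begin

definition weight :: "real \<Rightarrow> real" where
  "weight x = indicator {0..1/4} x * \<Phi> x * (1/4 - x) powr \<alpha>"

lemma weight_measurable [measurable]: "weight \<in> borel_measurable borel"
proof -
  have [measurable]: "(\<lambda>x. indicator {0..1/4} x * \<Phi> x) \<in> borel_measurable borel"
    using Phi_meas by (simp add: set_borel_measurable_def)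
  show ?thesis unfolding weight_def[abs_def] by measurable
qed

lemma weight_nonneg: "0 \<le> weight x"
  using Phi_nonneg[of x] by (auto simp: weight_def split: split_indicator)

text \<open>The endpoint 1/4 is included because \<open>0 powr \<alpha>\<close> is 0; hence the one
  coefficient at which the symbol degenerates carries no weight.\<close>

lemma weight_eq_0: "x \<notin> {0..<1/4} \<Longrightarrow> weight x = 0"
  by (auto simp: weight_def split: split_indicator)

lemma B_nonneg: "0 \<le> B"
  using Phi_nonneg[of 0] Phi_le[of 0] by simp

text \<open>The base is at most 1/4, so lowering the exponent only enlarges the power.\<close>

lemma weight_le: "\<gamma> \<le> \<alpha> \<Longrightarrow> weight x \<le> indicator {0..<1/4} x * (B * (1/4 - x) powr \<gamma>)"
proof (cases "x \<in> {0..<1/4}")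
  case True
  assume "\<gamma> \<le> \<alpha>"
  then have "(1/4 - x) powr \<alpha> \<le> (1/4 - x) powr \<gamma>"
    using True by (intro powr_mono') auto
  then show ?thesis using True Phi_le[of x] Phi_nonneg[of x] B_nonneg
    by (auto simp: weight_def intro!: mult_mono)
qed (simp add: weight_eq_0)

text \<open>The central integrability fact. In this iterated form it bounds the energy of the random
  coefficients and also justifies Fubini in the covariance.\<close>

lemma spectral_nn_integral_finite:
  "(\<integral>\<^sup>+x. \<integral>\<^sup>+t. ennreal (weight x / (1 - x * walk_symbol t)\<^sup>2) \<partial>torus \<partial>lborel) < \<infinity>"
proof -
  define \<gamma> where "\<gamma> = min \<alpha> 1"
  \<comment> \<open>The integrability conditions in the frequencies and in 1/4 - x read (1 -
    \<gamma>)/2 < \<tau> < 1/2, and this is the midpoint. Capping \<alpha> at 1 keeps \<tau>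
    nonnegative.\<close>
  define \<tau> where "\<tau> = 1/2 - \<gamma>/4"
  have \<gamma>: "0 < \<gamma>" "\<gamma> \<le> 1" "\<gamma> \<le> \<alpha>" using alpha_pos by (auto simp: \<gamma>_def)
  have \<tau>: "0 \<le> \<tau>" "\<tau> \<le> 1" "- 2 * \<tau> > -1" "\<gamma> + (2 * \<tau> - 2) > -1" using \<gamma> by (auto simp: \<tau>_def)
  define h where "h u = ennreal (\<bar>u\<bar> powr (- 2 * \<tau>)) * indicator {-pi..pi} u" for u :: real
  define k where "k x = ennreal (320\<^sup>2 * B) * (ennreal ((1/4 - x) powr (\<gamma> + (2 * \<tau> - 2))) * indicator {0..1/4} x)" for x :: real
  have [measurable]: "h \<in> borel_measurable borel" "k \<in> borel_measurable borel"
    by (simp_all add: h_def[abs_def] k_def[abs_def])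
  have inner: "(\<integral>\<^sup>+t. ennreal (weight x / (1 - x * walk_symbol t)\<^sup>2) \<partial>torus) \<le> k x * ((\<integral>\<^sup>+u. h u \<partial>lborel) * (\<integral>\<^sup>+u. h u \<partial>lborel))" for x
  proof -
    \<comment> \<open>The coordinate axes are null, which removes the frequencies excluded in the
      pointwise bound.\<close>
    have ae: "AE u in lborel. u \<noteq> (0 :: real)" by (rule AE_lborel_singleton)
    have bnd: "ennreal (weight x / (1 - x * walk_symbol (u, w))\<^sup>2) * indicator ({-pi..pi} \<times> {-pi..pi}) (u, w) \<le> k x * (h u * h w)"
      if "u \<noteq> 0" "w \<noteq> 0" for u w
    proof (cases "x \<in> {0..<1/4} \<and> u \<in> {-pi..pi} \<and> w \<in> {-pi..pi}")
      case True
      have "weight x / (1 - x * walk_symbol (u, w))\<^sup>2 = weight x * (1 / (1 - x * walk_symbol (u, w))\<^sup>2)" by simp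
      also have "\<dots> \<le> (B * (1/4 - x) powr \<gamma>) * (320\<^sup>2 * ((1/4 - x) powr (2 * \<tau> - 2) * (\<bar>u\<bar> powr (- 2 * \<tau>) * \<bar>w\<bar> powr (- 2 * \<tau>))))"
        using symbol_inverse_square_bound[of x "(u, w)" \<tau>] weight_le[OF \<gamma>(3), of x] True that \<tau> B_nonneg
        by (intro mult_mono) auto
      also have "\<dots> = (320\<^sup>2 * B) * ((1/4 - x) powr (\<gamma> + (2 * \<tau> - 2)) * (\<bar>u\<bar> powr (- 2 * \<tau>) * \<bar>w\<bar> powr (- 2 * \<tau>)))"
        unfolding powr_add by (simp only: mult_ac)
      finally have "ennreal (weight x / (1 - x * walk_symbol (u, w))\<^sup>2)
         \<le> ennreal ((320\<^sup>2 * B) * ((1/4 - x) powr (\<gamma> + (2 * \<tau> - 2)) * (\<bar>u\<bar> powr (- 2 * \<tau>) * \<bar>w\<bar> powr (- 2 * \<tau>))))"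
        by (rule ennreal_leI)
      also have "\<dots> = k x * (h u * h w)"
        using True B_nonneg unfolding k_def h_def by (simp add: ennreal_mult mult.assoc del: ennreal_numeral)
      finally show ?thesis using True by simp
    next
      case False
      then show ?thesis using weight_eq_0[of x] by (auto simp: indicator_def)
    qed
    have "(\<integral>\<^sup>+t. ennreal (weight x / (1 - x * walk_symbol t)\<^sup>2) \<partial>torus)
        = (\<integral>\<^sup>+t. ennreal (weight x / (1 - x * walk_symbol t)\<^sup>2) * indicator ({-pi..pi} \<times> {-pi..pi}) t \<partial>lborel)"
      unfolding torus_def by (subst nn_integral_restrict_space) (use square_sets in auto)
    also have "\<dots> = (\<integral>\<^sup>+u. \<integral>\<^sup>+w. ennreal (weight x / (1 - x * walk_symbol (u, w))\<^sup>2) * indicator ({-pi..pi} \<times> {-pi..pi}) (u, w) \<partial>lborel \<partial>lborel)"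
      unfolding lborel_prod[symmetric] by (subst lborel.nn_integral_fst[symmetric]) (use square_sets in \<open>auto simp: lborel_prod\<close>)
    also have "\<dots> \<le> (\<integral>\<^sup>+u. \<integral>\<^sup>+w. k x * (h u * h w) \<partial>lborel \<partial>lborel)"
      using ae
      by (intro nn_integral_mono_AE, elim eventually_mono, intro nn_integral_mono_AE)
        (use ae bnd in \<open>auto elim: eventually_mono\<close>)
    also have "\<dots> = k x * ((\<integral>\<^sup>+u. h u \<partial>lborel) * (\<integral>\<^sup>+u. h u \<partial>lborel))"
      by (simp add: nn_integral_cmult nn_integral_multc)
    finally show ?thesis .
  qed
  have hfin: "(\<integral>\<^sup>+u. h u \<partial>lborel) < \<infinity>"
    unfolding h_def by (rule nn_integral_abs_powr[OF \<tau>(3)])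
  have kfin: "(\<integral>\<^sup>+x. k x \<partial>lborel) < \<infinity>"
    unfolding k_def using nn_integral_powr_to_quarter[OF \<tau>(4)]
    by (subst nn_integral_cmult) (auto simp: ennreal_mult_less_top)
  have "(\<integral>\<^sup>+x. \<integral>\<^sup>+t. ennreal (weight x / (1 - x * walk_symbol t)\<^sup>2) \<partial>torus \<partial>lborel)
      \<le> (\<integral>\<^sup>+x. k x * ((\<integral>\<^sup>+u. h u \<partial>lborel) * (\<integral>\<^sup>+u. h u \<partial>lborel)) \<partial>lborel)"
    by (intro nn_integral_mono inner)
  also have "\<dots> = (\<integral>\<^sup>+x. k x \<partial>lborel) * ((\<integral>\<^sup>+u. h u \<partial>lborel) * (\<integral>\<^sup>+u. h u \<partial>lborel))"
    by (simp add: nn_integral_multc)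
  also have "\<dots> < \<infinity>" using hfin kfin by (simp add: ennreal_mult_less_top)
  finally show ?thesis .
qed

lemma spec_dens_weight:
  "spec_dens \<sigma>2 \<Phi> \<alpha> t = \<sigma>2 / (4 * pi\<^sup>2) * (\<integral>x. weight x / (1 - x * walk_symbol t)\<^sup>2 \<partial>lborel)"
  by (cases t) (auto simp: spec_dens_def set_lebesgue_integral_def weight_def walk_symbol_def mult_ac
      intro!: Bochner_Integration.integral_cong arg_cong[where f = "\<lambda>x. _ * x"])

end

section \<open>The spectral density near the origin\<close>

text \<open>Compare with u^\<alpha> up to 1 and with u^(\<alpha> - 2) beyond; the latter is
  integrable at infinity because \<alpha> < 1.\<close>

lemma integrable_beta_kernel:
  assumes \<alpha>: "0 < \<alpha>" "\<alpha> < 1"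
  shows "integrable lborel (\<lambda>u::real. indicator {0<..} u * (u powr \<alpha> / (1 + u)\<^sup>2))"
proof (rule integrableI_bounded)
  have "ennreal (norm (indicator {0<..} u * (u powr \<alpha> / (1 + u)\<^sup>2)))
     \<le> ennreal (u powr \<alpha>) * indicator {0..1} u + ennreal (u powr (\<alpha> - 2)) * indicator {1..} u" for u :: real
  proof (cases "0 < u")
    case True
    show ?thesis
    proof (cases "u \<le> 1")
      case u1: True
      have "u powr \<alpha> / (1 + u)\<^sup>2 \<le> u powr \<alpha> / 1"
        using True by (intro divide_left_mono one_le_power) auto
      then have "ennreal (norm (indicator {0<..} u * (u powr \<alpha> / (1 + u)\<^sup>2))) \<le> ennreal (u powr \<alpha>) * indicator {0..1} u"
        using True u1 by (simp add: ennreal_leI)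
      then show ?thesis by (rule order_trans) (rule add_increasing2, simp_all)
    next
      case False
      have "u powr \<alpha> / (1 + u)\<^sup>2 \<le> u powr \<alpha> / u\<^sup>2"
        using True by (intro divide_left_mono power_mono) auto
      also have "\<dots> = u powr (\<alpha> - 2)" using True by (simp add: powr_diff)
      finally have "ennreal (norm (indicator {0<..} u * (u powr \<alpha> / (1 + u)\<^sup>2))) \<le> ennreal (u powr (\<alpha> - 2)) * indicator {1..} u"
        using True False by (simp add: ennreal_leI)
      then show ?thesis by (rule order_trans) (rule add_increasing, simp_all)
    qed
  qed simp
  then have "(\<integral>\<^sup>+u. ennreal (norm (indicator {0<..} u * (u powr \<alpha> / (1 + u)\<^sup>2))) \<partial>lborel)
    \<le> (\<integral>\<^sup>+u. ennreal (u powr \<alpha>) * indicator {0..1} u + ennreal (u powr (\<alpha> - 2)) * indicator {1..} u \<partial>lborel)"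
    by (intro nn_integral_mono)
  also have "\<dots> = (\<integral>\<^sup>+u. ennreal (u powr \<alpha>) * indicator {0..1} u \<partial>lborel) + (\<integral>\<^sup>+u. ennreal (u powr (\<alpha> - 2)) * indicator {1..} u \<partial>lborel)"
    by (rule nn_integral_add) auto
  also have "(\<integral>\<^sup>+u. ennreal (u powr \<alpha>) * indicator {0..1} u \<partial>lborel) = ennreal (1 powr (\<alpha> + 1) / (\<alpha> + 1))"
    using \<alpha> by (intro nn_integral_powr_from_0) auto
  also have "(\<integral>\<^sup>+u. ennreal (u powr (\<alpha> - 2)) * indicator {1..} u \<partial>lborel) = ennreal (- (1 powr (\<alpha> - 2 + 1) / (\<alpha> - 2 + 1)))"
    using \<alpha> has_integral_powr_to_inf[of "\<alpha> - 2" 1] by (intro nn_integral_has_integral_lebesgue') auto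
  finally show "(\<integral>\<^sup>+u. ennreal (norm (indicator {0<..} u * (u powr \<alpha> / (1 + u)\<^sup>2))) \<partial>lborel) < \<infinity>"
    by (rule le_less_trans) simp
qed measurable

text \<open>First countability reduces a limit at a point to sequences. The parameter is a pair of
  frequencies in one application and a real scale tending to 0 from the right in another.\<close>

lemma dominated_convergence_at:
  fixes f :: "'c::first_countable_topology \<Rightarrow> 'a \<Rightarrow> real"
  assumes meas: "\<And>y. f y \<in> borel_measurable M" "g \<in> borel_measurable M"
    and w: "integrable M w"
    and lim: "AE x in M. ((\<lambda>y. f y x) \<longlongrightarrow> g x) (at a within S)"
    and bound: "\<And>y. y \<in> S \<Longrightarrow> AE x in M. \<bar>f y x\<bar> \<le> w x"
  shows "((\<lambda>y. \<integral>x. f y x \<partial>M) \<longlongrightarrow> (\<integral>x. g x \<partial>M)) (at a within S)"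
proof (subst tendsto_at_iff_sequentially, intro allI impI)
  fix X assume X: "\<forall>i. X i \<in> S - {a}" "X \<longlonglongrightarrow> a"
  have "(\<lambda>n. \<integral>x. f (X n) x \<partial>M) \<longlonglongrightarrow> (\<integral>x. g x \<partial>M)"
  proof (rule integral_dominated_convergence[where w = w])
    show "AE x in M. (\<lambda>n. f (X n) x) \<longlonglongrightarrow> g x"
      using lim by eventually_elim (use X in \<open>auto simp: tendsto_at_iff_sequentially comp_def\<close>)
  qed (use meas w bound X in auto)
  then show "((\<lambda>y. \<integral>x. f y x \<partial>M) \<circ> X) \<longlonglongrightarrow> (\<integral>x. g x \<partial>M)" by (simp add: comp_def)
qed

section \<open>Quadratic behaviour of the symbol at the origin\<close>

definition sq_norm :: "real \<times> real \<Rightarrow> real" where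
  "sq_norm t = (fst t)\<^sup>2 + (snd t)\<^sup>2"

definition cos_gap :: "real \<times> real \<Rightarrow> real" where
  "cos_gap t = 2 - cos (fst t) - cos (snd t)"

lemma walk_symbol_cos_gap: "walk_symbol t = 4 - 2 * cos_gap t"
  by (simp add: walk_symbol_def cos_gap_def)

lemma sq_norm_pos: "t \<noteq> (0, 0) \<Longrightarrow> 0 < sq_norm t"
  by (cases t) (auto simp: sq_norm_def sum_power2_gt_zero_iff)

lemma sq_norm_tendsto: "(sq_norm \<longlongrightarrow> 0) (at (0, 0))"
proof -
  have "isCont sq_norm (0, 0)" unfolding sq_norm_def[abs_def] by (intro continuous_intros)
  then show ?thesis by (simp add: isCont_def sq_norm_def)
qed

lemma cos_gap_tendsto: "(cos_gap \<longlongrightarrow> 0) (at (0, 0))"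
proof -
  have "isCont cos_gap (0, 0)" unfolding cos_gap_def[abs_def] by (intro continuous_intros)
  then show ?thesis by (simp add: isCont_def cos_gap_def)
qed

lemma eventually_nonzero: "eventually (\<lambda>t. t \<noteq> (0, 0)) (at (0, 0) :: (real \<times> real) filter)"
  by (rule eventually_neq_at_within)

text \<open>The quartic remainders add up to at most \<open>sq_norm t * sq_norm t / 24\<close>, so
  the quotient is within \<open>sq_norm t / 24\<close> of 1/2.\<close>

lemma cos_gap_ratio: "((\<lambda>t. cos_gap t / sq_norm t) \<longlongrightarrow> 1/2) (at (0, 0))"
proof -
  have *: "\<bar>cos_gap t / sq_norm t - 1/2\<bar> \<le> sq_norm t / 24" if "t \<noteq> (0, 0)" for t
  proof -
    note p = sq_norm_pos[OF that]
    have "\<bar>cos_gap t - sq_norm t / 2\<bar> \<le> ((fst t) ^ 4 + (snd t) ^ 4) / 24"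
    proof -
      have "cos_gap t - sq_norm t / 2 = (1 - (fst t)\<^sup>2 / 2 - cos (fst t)) + (1 - (snd t)\<^sup>2 / 2 - cos (snd t))"
        by (simp add: cos_gap_def sq_norm_def add_divide_distrib)
      moreover have "((fst t) ^ 4 + (snd t) ^ 4) / 24 = (fst t) ^ 4 / 24 + (snd t) ^ 4 / 24"
        by (rule add_divide_distrib)
      ultimately show ?thesis
        using cos_quartic_bound[of "fst t"] cos_quartic_bound[of "snd t"] by linarith
    qed
    also have "(fst t) ^ 4 + (snd t) ^ 4 \<le> sq_norm t * sq_norm t"
      using mult_nonneg_nonneg[OF zero_le_power2[of "fst t"] zero_le_power2[of "snd t"]]
      by (simp add: sq_norm_def power4_eq_xxxx power2_eq_square algebra_simps)
    finally have "\<bar>cos_gap t - sq_norm t / 2\<bar> / sq_norm t \<le> (sq_norm t * sq_norm t / 24) / sq_norm t"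
      using p by (intro divide_right_mono) auto
    moreover have "\<bar>cos_gap t - sq_norm t / 2\<bar> / sq_norm t = \<bar>cos_gap t / sq_norm t - 1/2\<bar>"
    proof -
      have "(cos_gap t - sq_norm t / 2) / sq_norm t = cos_gap t / sq_norm t - 1/2"
        using p by (simp add: diff_divide_distrib)
      then show ?thesis by (simp only: abs_div_pos[OF p])
    qed
    ultimately show ?thesis using p by simp
  qed
  have "eventually (\<lambda>t. norm (cos_gap t / sq_norm t - 1/2) \<le> sq_norm t / 24) (at (0, 0))"
    using eventually_nonzero by eventually_elim (use * in auto)
  then have "((\<lambda>t. cos_gap t / sq_norm t - 1/2) \<longlongrightarrow> 0) (at (0, 0))"
  proof (rule Lim_null_comparison)
    have "((\<lambda>t. sq_norm t / 24) \<longlongrightarrow> 0 / 24) (at (0, 0))"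
      by (intro tendsto_divide sq_norm_tendsto tendsto_const) simp
    then show "((\<lambda>t. sq_norm t / 24) \<longlongrightarrow> 0) (at (0, 0))" by simp
  qed
  then show ?thesis by (simp add: LIM_zero_iff)
qed

lemma cos_gap_eventually: "eventually (\<lambda>t. 0 < cos_gap t \<and> cos_gap t < 1) (at (0, 0))"
proof -
  have "eventually (\<lambda>t. cos_gap t / sq_norm t > 0) (at (0, 0))"
    by (rule order_tendstoD[OF cos_gap_ratio]) simp
  moreover have "eventually (\<lambda>t. cos_gap t < 1) (at (0, 0))"
    by (rule order_tendstoD[OF cos_gap_tendsto]) simp
  ultimately show ?thesis using eventually_nonzero
  proof eventually_elim
    case (elim t)
    with sq_norm_pos[of t] show ?case by (auto simp: zero_less_divide_iff)
  qed
qed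

text \<open>With \<open>y = 1/4 - x\<close> the symbol is \<open>1 - x * walk_symbol t = w/2 + (4 - 2 w) y\<close>, where
  \<open>w = cos_gap t\<close>; the substitution \<open>y = gap_scale t * u\<close> turns it into \<open>(w/2) (1 + u)\<close>.\<close>

definition gap_scale :: "real \<times> real \<Rightarrow> real" where
  "gap_scale t = (cos_gap t / 2) / (4 - 2 * cos_gap t)"

text \<open>Half the gap is about \<open>sq_norm t / 4\<close>, and the denominator tends to 4; this
  is the origin of the constant 16.\<close>

lemma gap_scale_ratio: "((\<lambda>t. gap_scale t / sq_norm t) \<longlongrightarrow> 1/16) (at (0, 0))"
proof -
  have "a / s / 2 / b = a / 2 / b / s" for a b s :: real by (simp add: mult_ac)
  then have eq: "(\<lambda>t. (cos_gap t / sq_norm t) / 2 / (4 - 2 * cos_gap t)) = (\<lambda>t. gap_scale t / sq_norm t)"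
    unfolding gap_scale_def by (intro ext)
  have "((\<lambda>t. (cos_gap t / sq_norm t) / 2 / (4 - 2 * cos_gap t)) \<longlongrightarrow> (1/2) / 2 / (4 - 2 * 0)) (at (0, 0))"
    by (intro tendsto_divide tendsto_diff tendsto_mult tendsto_const cos_gap_ratio cos_gap_tendsto) auto
  then show ?thesis unfolding eq by (rule tendsto_eq_rhs) simp
qed

lemma gap_scale_at_right: "filterlim gap_scale (at_right 0) (at (0, 0))"
proof -
  have "((\<lambda>t. (cos_gap t / 2) / (4 - 2 * cos_gap t)) \<longlongrightarrow> (0 / 2) / (4 - 2 * 0)) (at (0, 0))"
    by (intro tendsto_divide tendsto_diff tendsto_mult tendsto_const cos_gap_tendsto) auto
  then have lim: "(gap_scale \<longlongrightarrow> 0) (at (0, 0))"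
    unfolding gap_scale_def[abs_def] by (rule tendsto_eq_rhs) simp
  have "eventually (\<lambda>t. gap_scale t \<in> {0<..} \<and> gap_scale t \<noteq> 0) (at (0, 0))"
    using cos_gap_eventually
  proof eventually_elim
    case (elim t)
    then have "0 < cos_gap t / 2" "0 < 4 - 2 * cos_gap t" by auto
    then have "0 < gap_scale t" unfolding gap_scale_def by (rule divide_pos_pos)
    then show ?case by simp
  qed
  with lim show ?thesis unfolding filterlim_at by blast
qed

section \<open>The rescaled spectral integral\<close>

locale coefficient_density_limit = coefficient_density +
  assumes Phi_cont: "(\<Phi> \<longlongrightarrow> \<Phi> (1/4)) (at (1/4) within {0..1/4})"
    and Phi_quarter: "\<Phi> (1/4) \<noteq> 0"
begin

lemma Phi_quarter_pos: "\<Phi> (1/4) > 0"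
  using Phi_nonneg[of "1/4"] Phi_quarter by simp

text \<open>After the substitution the argument \<open>1/4 - r * u\<close> leaves the interval once
  \<open>u > 1 / (4 * r)\<close>; the zero extension encodes this upper limit and lets the integral
  run over a fixed half-line.\<close>

definition cut_Phi :: "real \<Rightarrow> real" where
  "cut_Phi x = indicator {0..1/4} x * \<Phi> x"

lemma cut_Phi_measurable [measurable]: "cut_Phi \<in> borel_measurable borel"
  using Phi_meas by (simp add: set_borel_measurable_def cut_Phi_def[abs_def])

lemma cut_Phi_bounds: "0 \<le> cut_Phi x" "cut_Phi x \<le> B" "\<bar>cut_Phi x\<bar> \<le> B"
  using Phi_nonneg[of x] Phi_le[of x] B_nonneg by (auto simp: cut_Phi_def split: split_indicator)

lemma cut_Phi_tendsto: "(cut_Phi \<longlongrightarrow> \<Phi> (1/4)) (at_left (1/4))"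
proof -
  have "at_left (1/4 :: real) = at (1/4) within {0..1/4}"
    using at_within_Icc_at_left[of 0 "1/4 :: real"] by simp
  moreover have "(cut_Phi \<longlongrightarrow> \<Phi> (1/4)) (at (1/4) within {0..1/4})"
  proof (rule Lim_transform_eventually[OF Phi_cont])
    show "eventually (\<lambda>x. \<Phi> x = cut_Phi x) (at (1/4) within {0..1/4})"
      by (auto simp: eventually_at_filter cut_Phi_def)
  qed
  ultimately show ?thesis by (simp only:)
qed

definition scaled_integral :: "real \<Rightarrow> real" where
  "scaled_integral r = (\<integral>u. indicator {0<..} u * (cut_Phi (1/4 - r * u) * (u powr \<alpha> / (1 + u)\<^sup>2)) \<partial>lborel)"

text \<open>With A = cos_gap/2, b = 4 - 2 cos_gap and r = A/b, the substitution contributes r, the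
  weight r^\<alpha> u^\<alpha>, and the squared symbol A^2 (1 + u)^2; the powers collect to
  A^(\<alpha> - 1) b^(-\<alpha> - 1).\<close>

lemma weight_integral_scaled:
  assumes w: "0 < cos_gap t" "cos_gap t < 1"
  shows "(\<integral>x. weight x / (1 - x * walk_symbol t)\<^sup>2 \<partial>lborel)
    = (cos_gap t / 2) powr (\<alpha> - 1) * (4 - 2 * cos_gap t) powr (- \<alpha> - 1) * scaled_integral (gap_scale t)"
proof -
  define A where "A = cos_gap t / 2"
  define b where "b = 4 - 2 * cos_gap t"
  define r where "r = A / b"
  have A: "A > 0" and b: "b > 0" using w by (auto simp: A_def b_def)
  then have r: "r > 0" by (simp add: r_def)
  have rg: "gap_scale t = r" by (simp add: gap_scale_def r_def A_def b_def)
  have pt: "weight (1/4 + (- r) * u) / (1 - (1/4 + (- r) * u) * walk_symbol t)\<^sup>2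
      = r powr \<alpha> / A\<^sup>2 * (indicator {0<..} u * (cut_Phi (1/4 - r * u) * (u powr \<alpha> / (1 + u)\<^sup>2)))" for u
  proof (cases "u > 0")
    case True
    have br: "b * r = A" using b by (simp add: r_def)
    have "1 - (1/4 + (- r) * u) * walk_symbol t = A + (b * r) * u"
      by (simp add: walk_symbol_cos_gap A_def b_def algebra_simps)
    also have "\<dots> = A * (1 + u)" unfolding br by (simp add: algebra_simps)
    finally have D: "(1 - (1/4 + (- r) * u) * walk_symbol t)\<^sup>2 = A\<^sup>2 * (1 + u)\<^sup>2"
      by (simp add: power_mult_distrib)
    have "weight (1/4 + (- r) * u) = cut_Phi (1/4 - r * u) * (r powr \<alpha> * u powr \<alpha>)"
      using True r by (simp add: weight_def cut_Phi_def powr_mult)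
    then show ?thesis unfolding D using True by simp
  next
    case False
    \<comment> \<open>Nonpositive \<open>u\<close> corresponds to coefficients from 1/4 on, where
      the weight vanishes.\<close>
    then have "r * u \<le> 0" using r by (simp add: mult_le_0_iff)
    then have "weight (1/4 + (- r) * u) = 0"
      by (intro weight_eq_0) auto
    then show ?thesis using False by simp
  qed
  have "(\<integral>x. weight x / (1 - x * walk_symbol t)\<^sup>2 \<partial>lborel) = \<bar>- r\<bar> *\<^sub>R (r powr \<alpha> / A\<^sup>2 * scaled_integral r)"
  proof -
    have c: "- r \<noteq> 0" using r by simp
    show ?thesis
      by (simp only: lborel_integral_real_affine[OF c, of "\<lambda>x. weight x / (1 - x * walk_symbol t)\<^sup>2" "1/4"]
          pt scaled_integral_def integral_mult_right_zero)
  qed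
  also have "\<dots> = (r * r powr \<alpha> / A\<^sup>2) * scaled_integral r" using r by simp
  also have "r * r powr \<alpha> / A\<^sup>2 = A powr (\<alpha> - 1) * b powr (- \<alpha> - 1)"
  proof -
    have "r * r powr \<alpha> = r powr (\<alpha> + 1)" using r by (simp add: powr_add)
    also have "\<dots> = A powr (\<alpha> + 1) / b powr (\<alpha> + 1)" using A b by (simp add: r_def powr_divide)
    finally have "r * r powr \<alpha> / A\<^sup>2 = (A powr (\<alpha> + 1) / A powr 2) * (1 / b powr (\<alpha> + 1))"
      using A by simp
    also have "A powr (\<alpha> + 1) / A powr 2 = A powr (\<alpha> + 1 - 2)" by (rule powr_diff[symmetric])
    also have "\<alpha> + 1 - 2 = \<alpha> - 1" by simp
    also have "1 / b powr (\<alpha> + 1) = b powr (- (\<alpha> + 1))" by (rule powr_minus_divide[symmetric])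
    also have "- (\<alpha> + 1) = - \<alpha> - 1" by simp
    finally show ?thesis .
  qed
  finally show ?thesis by (simp add: rg A_def b_def)
qed

lemma scaled_Phi_tendsto:
  assumes "u > 0" shows "((\<lambda>r. cut_Phi (1/4 - r * u)) \<longlongrightarrow> \<Phi> (1/4)) (at_right 0)"
proof (rule filterlim_compose[OF cut_Phi_tendsto])
  have "((\<lambda>r. 1/4 - r * u) \<longlongrightarrow> 1/4 - 0 * u) (at_right 0)" by (intro tendsto_intros)
  moreover have "eventually (\<lambda>r::real. r > 0) (at_right 0)" by (simp add: eventually_at_right_less)
  then have "eventually (\<lambda>r. 1/4 - r * u < 1/4) (at_right 0)"
    by eventually_elim (use assms in auto)
  ultimately show "filterlim (\<lambda>r. 1/4 - r * u) (at_left (1/4)) (at_right 0)"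
    by (auto simp: filterlim_at elim: eventually_mono)
qed

text \<open>Pointwise the argument of \<open>cut_Phi\<close> tends to 1/4 from the left, and
  \<open>B\<close> times the beta kernel dominates; \<alpha> < 1 makes this kernel
  integrable.\<close>

lemma scaled_integral_tendsto:
  assumes "\<alpha> < 1"
  shows "(scaled_integral \<longlongrightarrow> \<Phi> (1/4) * (\<integral>u. indicator {0<..} u * (u powr \<alpha> / (1 + u)\<^sup>2) \<partial>lborel)) (at_right 0)"
proof -
  have "((\<lambda>r. \<integral>u. indicator {0<..} u * (cut_Phi (1/4 - r * u) * (u powr \<alpha> / (1 + u)\<^sup>2)) \<partial>lborel)
      \<longlongrightarrow> (\<integral>u. indicator {0<..} u * (\<Phi> (1/4) * (u powr \<alpha> / (1 + u)\<^sup>2)) \<partial>lborel)) (at_right 0)"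
  proof (rule dominated_convergence_at[where w = "\<lambda>u. B * (indicator {0<..} u * (u powr \<alpha> / (1 + u)\<^sup>2))"])
    show "integrable lborel (\<lambda>u. B * (indicator {0<..} u * (u powr \<alpha> / (1 + u)\<^sup>2)))"
      by (intro integrable_mult_right integrable_beta_kernel alpha_pos assms)
  next
    show "AE u in lborel. ((\<lambda>r. indicator {0<..} u * (cut_Phi (1/4 - r * u) * (u powr \<alpha> / (1 + u)\<^sup>2)))
        \<longlongrightarrow> indicator {0<..} u * (\<Phi> (1/4) * (u powr \<alpha> / (1 + u)\<^sup>2))) (at_right 0)"
    proof (rule AE_I2)
      fix u :: real
      show "((\<lambda>r. indicator {0<..} u * (cut_Phi (1/4 - r * u) * (u powr \<alpha> / (1 + u)\<^sup>2)))
        \<longlongrightarrow> indicator {0<..} u * (\<Phi> (1/4) * (u powr \<alpha> / (1 + u)\<^sup>2))) (at_right 0)"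
        by (cases "u > 0") (auto intro!: tendsto_intros scaled_Phi_tendsto)
    qed
    show "AE u in lborel. \<bar>indicator {0<..} u * (cut_Phi (1/4 - r * u) * (u powr \<alpha> / (1 + u)\<^sup>2))\<bar>
        \<le> B * (indicator {0<..} u * (u powr \<alpha> / (1 + u)\<^sup>2))" for r
      using cut_Phi_bounds by (intro AE_I2) (auto simp: abs_mult intro!: mult_right_mono divide_right_mono split: split_indicator)
  qed measurable
  moreover have "(\<integral>u. indicator {0<..} u * (\<Phi> (1/4) * (u powr \<alpha> / (1 + u)\<^sup>2)) \<partial>lborel)
      = \<Phi> (1/4) * (\<integral>u. indicator {0<..} u * (u powr \<alpha> / (1 + u)\<^sup>2) \<partial>lborel)"
    unfolding integral_mult_right_zero[symmetric] by (simp only: mult_ac)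
  ultimately show ?thesis unfolding scaled_integral_def[abs_def] by (simp only:)
qed

end

text \<open>At every frequency the symbol is at least 4 (1/4 - x), so B/16 times (1/4 - x)^(\<alpha>
  - 2) dominates the integrands uniformly in the frequency; for \<alpha> > 1 this is
  integrable.\<close>

lemma (in coefficient_density) spec_dens_continuous:
  assumes "\<alpha> > 1"
  shows "continuous_on A (spec_dens \<sigma>2 \<Phi> \<alpha>)"
proof -
  define w where "w x = B / 16 * (indicator {0..1/4} x * (1/4 - x) powr (\<alpha> - 2))" for x
  have int: "integrable lborel (\<lambda>x. indicator {0..1/4} x * (1/4 - x) powr (\<alpha> - 2) :: real)"
  proof (rule integrableI_bounded)
    have "(\<integral>\<^sup>+x. ennreal (norm (indicator {0..1/4} x * (1/4 - x) powr (\<alpha> - 2) :: real)) \<partial>lborel)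
        = (\<integral>\<^sup>+x. ennreal ((1/4 - x) powr (\<alpha> - 2)) * indicator {0..1/4} x \<partial>lborel)"
      by (intro nn_integral_cong) (auto split: split_indicator)
    also have "\<dots> < \<infinity>" using assms by (intro nn_integral_powr_to_quarter) simp
    finally show "(\<integral>\<^sup>+x. ennreal (norm (indicator {0..1/4} x * (1/4 - x) powr (\<alpha> - 2) :: real)) \<partial>lborel) < \<infinity>" .
  qed measurable
  have bound: "\<bar>weight x / (1 - x * walk_symbol t)\<^sup>2\<bar> \<le> w x" for x t
  proof (cases "x \<in> {0..<1/4}")
    case True
    have "x * walk_symbol t \<le> x * 4" using True abs_walk_symbol_le[of t] by (intro mult_left_mono) auto
    then have "4 * (1/4 - x) \<le> 1 - x * walk_symbol t" by simp
    then have "(4 * (1/4 - x))\<^sup>2 \<le> (1 - x * walk_symbol t)\<^sup>2" using True by (intro power_mono) auto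
    then have "weight x / (1 - x * walk_symbol t)\<^sup>2 \<le> (B * (1/4 - x) powr \<alpha>) / (4 * (1/4 - x))\<^sup>2"
      using weight_le[of \<alpha> x] True B_nonneg by (intro frac_le) auto
    also have "\<dots> = B / 16 * ((1/4 - x) powr \<alpha> / (1/4 - x) powr 2)"
    proof -
      have "(4 * y)\<^sup>2 = 16 * y powr 2" if "y > 0" for y :: real
        using that by (simp add: power_mult_distrib)
      moreover have "1/4 - x > 0" using True by simp
      ultimately have "(4 * (1/4 - x))\<^sup>2 = 16 * (1/4 - x) powr 2" .
      then show ?thesis by (simp only: times_divide_times_eq)
    qed
    also have "(1/4 - x) powr \<alpha> / (1/4 - x) powr 2 = (1/4 - x) powr (\<alpha> - 2)" by (rule powr_diff[symmetric])
    finally show ?thesis using True weight_nonneg[of x] by (simp add: w_def)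
  next
    case False
    then show ?thesis using weight_eq_0[of x] B_nonneg by (simp add: w_def)
  qed
  have "((\<lambda>t. \<integral>x. weight x / (1 - x * walk_symbol t)\<^sup>2 \<partial>lborel) \<longlongrightarrow> (\<integral>x. weight x / (1 - x * walk_symbol a)\<^sup>2 \<partial>lborel)) (at a within A)" for a
  proof (rule dominated_convergence_at[where w = w])
    show "integrable lborel w" unfolding w_def[abs_def] using int by (intro integrable_mult_right)
    show "AE x in lborel. ((\<lambda>t. weight x / (1 - x * walk_symbol t)\<^sup>2) \<longlongrightarrow> weight x / (1 - x * walk_symbol a)\<^sup>2) (at a within A)"
    proof (rule AE_I2)
      fix x
      have "isCont walk_symbol a" unfolding walk_symbol_def[abs_def] by (intro continuous_intros)
      then have lim: "(walk_symbol \<longlongrightarrow> walk_symbol a) (at a within A)"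
        unfolding isCont_def by (rule tendsto_mono[rotated]) (simp add: at_le)
      show "((\<lambda>t. weight x / (1 - x * walk_symbol t)\<^sup>2) \<longlongrightarrow> weight x / (1 - x * walk_symbol a)\<^sup>2) (at a within A)"
      proof (cases "x \<in> {0..<1/4}")
        case True
        then have "(1 - x * walk_symbol a)\<^sup>2 \<noteq> 0" using walk_symbol_pos[of x a] by auto
        then show ?thesis by (intro tendsto_divide tendsto_const tendsto_power tendsto_diff tendsto_mult lim)
      qed (simp add: weight_eq_0)
    qed
    show "AE x in lborel. \<bar>weight x / (1 - x * walk_symbol t)\<^sup>2\<bar> \<le> w x" for t
      by (intro AE_I2 bound)
  qed measurable
  then show ?thesis unfolding continuous_on_def spec_dens_weight by (intro ballI tendsto_mult tendsto_const)
qed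

section \<open>The power law and the logarithmic law\<close>

lemma unbounded_near_origin:
  fixes f g :: "real \<times> real \<Rightarrow> real"
  assumes ratio: "((\<lambda>t. f t / g t) \<longlongrightarrow> c) (at (0, 0))" "c > 0" and g: "filterlim g at_top (at (0, 0))"
    and \<delta>: "\<delta> > 0"
  shows "\<exists>t. t \<in> ball (0, 0) \<delta> \<and> t \<noteq> (0, 0) \<and> f t > b"
proof -
  have "filterlim (\<lambda>t. f t / g t * g t) at_top (at (0, 0))"
    by (rule filterlim_tendsto_pos_mult_at_top[OF ratio g])
  then have "eventually (\<lambda>t. f t / g t * g t > b) (at (0, 0))"
    by (simp add: filterlim_at_top_dense)
  moreover have "eventually (\<lambda>t. g t > 0) (at (0, 0))"
    using g by (simp add: filterlim_at_top_dense)
  moreover have "eventually (\<lambda>t. t \<in> ball (0, 0) \<delta>) (at (0, 0))"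
    using \<delta> by (intro eventually_at_in_open') auto
  ultimately have "eventually (\<lambda>t. t \<in> ball (0, 0) \<delta> \<and> t \<noteq> (0, 0) \<and> f t > b) (at (0, 0))"
    using eventually_nonzero by eventually_elim auto
  then show ?thesis by (rule eventually_happens'[rotated]) simp
qed

lemma sq_norm_at_right: "filterlim sq_norm (at_right 0) (at (0, 0))"
proof -
  have "eventually (\<lambda>t. sq_norm t \<in> {0<..} \<and> sq_norm t \<noteq> 0) (at (0, 0))"
    using eventually_nonzero
  proof eventually_elim
    case (elim t)
    then show ?case using sq_norm_pos[of t] by simp
  qed
  with sq_norm_tendsto show ?thesis unfolding filterlim_at by blast
qed

text \<open>On [1, 2] the numerator is at least 1 and the denominator at most 9.\<close>

lemma beta_integral_pos:
  fixes \<alpha> :: real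
  assumes \<alpha>: "0 < \<alpha>" "\<alpha> < 1"
  shows "0 < (\<integral>u. indicator {0<..} u * (u powr \<alpha> / (1 + u)\<^sup>2) \<partial>lborel)"
proof -
  have "(\<integral>u. indicator {1..2 :: real} u * (1/9 :: real) \<partial>lborel) \<le> (\<integral>u. indicator {0<..} u * (u powr \<alpha> / (1 + u)\<^sup>2) \<partial>lborel)"
  proof (rule integral_mono[OF _ integrable_beta_kernel[OF \<alpha>]])
    show "integrable lborel (\<lambda>u. indicator {1..2 :: real} u * (1/9 :: real))" by simp
    fix u :: real
    show "indicator {1..2} u * (1/9) \<le> indicator {0<..} u * (u powr \<alpha> / (1 + u)\<^sup>2)"
    proof (cases "u \<in> {1..2}")
      case True
      have "(1 + u)\<^sup>2 \<le> 3\<^sup>2" using True by (intro power_mono) auto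
      moreover have "1 \<le> u powr \<alpha>" using True \<alpha> by (intro ge_one_powr_ge_zero) auto
      ultimately have "1 / 9 \<le> u powr \<alpha> / (1 + u)\<^sup>2" using True by (intro frac_le) auto
      then show ?thesis using True by simp
    qed simp
  qed
  then show ?thesis by simp
qed

lemma log_kernel_integral:
  fixes c :: real
  assumes "0 \<le> c"
  shows "(\<integral>u. indicator {0..c} u *\<^sub>R (u / (1 + u)\<^sup>2) \<partial>lborel) = ln (1 + c) + 1 / (1 + c) - 1"
proof -
  have "(\<integral>u. indicator {0..c} u *\<^sub>R (u / (1 + u)\<^sup>2) \<partial>lborel) = (ln (1 + c) + 1 / (1 + c)) - (ln (1 + 0) + 1 / (1 + 0))"
  proof (rule integral_FTC_atLeastAtMost[OF assms])
    fix u :: real assume u: "0 \<le> u" "u \<le> c"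
    then have "((\<lambda>u. ln (1 + u) + 1 / (1 + u)) has_real_derivative (1 / (1 + u) + (- 1 / (1 + u)\<^sup>2))) (at u within {0..c})"
      by (auto intro!: derivative_eq_intros simp: power2_eq_square)
    moreover have "1 / (1 + u) + (- 1 / (1 + u)\<^sup>2) = u / (1 + u)\<^sup>2"
      using u by (simp add: power2_eq_square divide_simps)
    ultimately show "((\<lambda>u. ln (1 + u) + 1 / (1 + u)) has_vector_derivative u / (1 + u)\<^sup>2) (at u within {0..c})"
      by (simp add: has_real_derivative_iff_has_vector_derivative)
  qed (auto intro!: continuous_intros)
  then show ?thesis by simp
qed

context coefficient_density_limit
begin

text \<open>Half the gap divided by \<open>sq_norm\<close> tends to 1/4 and the other factor to 4,
  so the powers combine to 4^(1 - \<alpha>) 4^(-\<alpha> - 1) = 16^(-\<alpha>).\<close>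

lemma power_law_ratio:
  assumes "\<alpha> < 1"
  shows "((\<lambda>t. spec_dens \<sigma>2 \<Phi> \<alpha> t / sq_norm t powr (\<alpha> - 1)) \<longlongrightarrow>
    \<sigma>2 / (4 * pi\<^sup>2) * 16 powr (- \<alpha>) * \<Phi> (1/4) * (\<integral>u. indicator {0<..} u * (u powr \<alpha> / (1 + u)\<^sup>2) \<partial>lborel)) (at (0, 0))"
proof -
  define I where "I = (\<integral>u. indicator {0<..} u * (u powr \<alpha> / (1 + u)\<^sup>2) \<partial>lborel)"
  have lim: "((\<lambda>t. \<sigma>2 / (4 * pi\<^sup>2) * (((cos_gap t / sq_norm t) / 2) powr (\<alpha> - 1) * (4 - 2 * cos_gap t) powr (- \<alpha> - 1)
      * scaled_integral (gap_scale t))) \<longlongrightarrow>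
      \<sigma>2 / (4 * pi\<^sup>2) * (((1/2) / 2) powr (\<alpha> - 1) * (4 - 2 * 0) powr (- \<alpha> - 1) * (\<Phi> (1/4) * I))) (at (0, 0))"
    unfolding I_def
    by (intro tendsto_mult tendsto_const tendsto_powr tendsto_divide tendsto_diff cos_gap_ratio cos_gap_tendsto
        filterlim_compose[OF scaled_integral_tendsto[OF assms] gap_scale_at_right]) auto
  have val: "\<sigma>2 / (4 * pi\<^sup>2) * (((1/2) / 2) powr (\<alpha> - 1) * (4 - 2 * 0) powr (- \<alpha> - 1) * (\<Phi> (1/4) * I))
      = \<sigma>2 / (4 * pi\<^sup>2) * 16 powr (- \<alpha>) * \<Phi> (1/4) * I"
  proof -
    have "((1/2) / 2 :: real) powr (\<alpha> - 1) = 4 powr (1 - \<alpha>)"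
      using powr_minus_divide[of 4 "\<alpha> - 1"] by (simp add: powr_divide)
    moreover have "(16 :: real) powr (- \<alpha>) = 4 powr (1 - \<alpha>) * 4 powr (- \<alpha> - 1)"
    proof -
      have "(16 :: real) = 4 powr 2" by simp
      then have "(16 :: real) powr (- \<alpha>) = 4 powr (2 * (- \<alpha>))" by (simp only: powr_powr)
      also have "2 * (- \<alpha>) = (1 - \<alpha>) + (- \<alpha> - 1)" by simp
      finally show ?thesis by (simp only: powr_add)
    qed
    ultimately show ?thesis by simp
  qed
  have ev: "eventually (\<lambda>t. \<sigma>2 / (4 * pi\<^sup>2) * (((cos_gap t / sq_norm t) / 2) powr (\<alpha> - 1) * (4 - 2 * cos_gap t) powr (- \<alpha> - 1)
      * scaled_integral (gap_scale t)) = spec_dens \<sigma>2 \<Phi> \<alpha> t / sq_norm t powr (\<alpha> - 1)) (at (0, 0))"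
    using cos_gap_eventually
  proof eventually_elim
    case (elim t)
    then have w: "0 < cos_gap t" "cos_gap t < 1" by auto
    have "((cos_gap t / sq_norm t) / 2) powr (\<alpha> - 1) = ((cos_gap t / 2) / sq_norm t) powr (\<alpha> - 1)"
      by (simp add: mult.commute)
    also have "\<dots> = (cos_gap t / 2) powr (\<alpha> - 1) / sq_norm t powr (\<alpha> - 1)"
      by (rule powr_divide)
    finally show ?case
      unfolding spec_dens_weight weight_integral_scaled[OF w] by simp
  qed
  show ?thesis using Lim_transform_eventually[OF lim ev] unfolding I_def[symmetric] val .
qed

text \<open>The full kernel u/(1 + u)^2 is not integrable, so the integral is compared with its
  truncated version \<open>J\<close>, which diverges like ln (1/r). The discrepancy is a small
  multiple of \<open>J\<close> plus a constant, and dividing by ln (1/r) removes the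
  constant.\<close>

lemma scaled_integral_log:
  assumes \<alpha>1: "\<alpha> = 1"
  shows "((\<lambda>r. scaled_integral r / ln (1 / r)) \<longlongrightarrow> \<Phi> (1/4)) (at_right 0)"
proof -
  \<comment> \<open>The closed form of the truncated integral with \<open>\<Phi>\<close> replaced by
    1.\<close>
  define J where "J r = ln (1 + 1 / (4 * r)) + 1 / (1 + 1 / (4 * r)) - 1" for r :: real
  define h where "h r u = indicator {0..1 / (4 * r)} u *\<^sub>R (u / (1 + u)\<^sup>2)" for r u :: real
  have Jh: "J r = (\<integral>u. h r u \<partial>lborel)" if "r > 0" for r
    using log_kernel_integral[of "1 / (4 * r)"] that by (simp add: J_def h_def)
  have hint: "integrable lborel (h r)" for r
    unfolding h_def[abs_def] by (rule borel_integrable_compact) (auto intro!: continuous_intros)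
  have h0: "0 \<le> h r u" for r u by (auto simp: h_def split: split_indicator)
  have close: "\<exists>C. \<forall>r>0. \<bar>scaled_integral r - \<Phi> (1/4) * J r\<bar> \<le> e * J r + C" if e: "e > 0" for e
  proof -
    have "eventually (\<lambda>x. dist (cut_Phi x) (\<Phi> (1/4)) < e) (at_left (1/4))"
      by (rule tendstoD[OF cut_Phi_tendsto e])
    then obtain a where a: "a < 1/4" "\<And>x. a < x \<Longrightarrow> x < 1/4 \<Longrightarrow> dist (cut_Phi x) (\<Phi> (1/4)) < e"
      by (auto simp: eventually_at_left_field)
    define d where "d = 1/4 - a"
    have d: "d > 0" using a by (simp add: d_def)
    have near: "\<bar>cut_Phi (1/4 - s) - \<Phi> (1/4)\<bar> \<le> e" if "0 < s" "s < d" for s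
      using a(2)[of "1/4 - s"] that by (auto simp: d_def dist_real_def)
    have "\<bar>scaled_integral r - \<Phi> (1/4) * J r\<bar> \<le> e * J r + B / (4 * d)" if r: "r > 0" for r
    proof -
      define k where "k u = indicator {0<..} u * (cut_Phi (1/4 - r * u) * (u powr \<alpha> / (1 + u)\<^sup>2))" for u :: real
      have k: "k u = cut_Phi (1/4 - r * u) * h r u" for u
      proof (cases "0 < u \<and> u \<le> 1 / (4 * r)")
        case True then show ?thesis using \<alpha>1 by (simp add: k_def h_def)
      next
        case False
        have "cut_Phi (1/4 - r * u) = 0" if "u > 1 / (4 * r)"
          using that r by (auto simp: cut_Phi_def indicator_def field_simps)
        with False show ?thesis by (auto simp: k_def h_def indicator_def)
      qed
      have km [measurable]: "k \<in> borel_measurable borel" unfolding k_def[abs_def] by measurable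
      have kint: "integrable lborel k"
        by (rule Bochner_Integration.integrable_bound[of _ "\<lambda>u. B * h r u"])
          (use hint h0 cut_Phi_bounds B_nonneg in \<open>auto simp: k abs_mult intro!: mult_right_mono\<close>)
      \<comment> \<open>For \<open>r * u < d\<close> continuity at 1/4 bounds the difference of the
        \<open>\<Phi>\<close>-values by \<open>e\<close>. Otherwise the kernel is at most 1/u, hence
        at most r/d, and integrating this over a range of length 1/(4 r) leaves a constant
        independent of \<open>r\<close>.\<close>
      have pt: "\<bar>k u - \<Phi> (1/4) * h r u\<bar> \<le> e * h r u + B * (r / d) * indicator {0..1 / (4 * r)} u" for u
      proof (cases "u \<in> {0<..1 / (4 * r)}")
        case True
        have "\<bar>k u - \<Phi> (1/4) * h r u\<bar> = \<bar>cut_Phi (1/4 - r * u) - \<Phi> (1/4)\<bar> * h r u"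
          unfolding k left_diff_distrib[symmetric] abs_mult using h0 by simp
        also have "\<dots> \<le> e * h r u + B * (r / d)"
        proof (cases "r * u < d")
          case near': True
          have "\<bar>cut_Phi (1/4 - r * u) - \<Phi> (1/4)\<bar> * h r u \<le> e * h r u"
            using near[of "r * u"] near' True r h0 by (intro mult_right_mono) auto
          moreover have "0 \<le> B * (r / d)" using B_nonneg r d by simp
          ultimately show ?thesis by linarith
        next
          case False
          have "h r u \<le> u / u\<^sup>2" unfolding h_def using True
            by (auto intro!: divide_left_mono power_mono)
          also have "\<dots> = 1 / u" using True by (simp add: power2_eq_square)
          also have "\<dots> \<le> r / d" using False True r d by (simp add: field_simps)
          finally have "\<bar>cut_Phi (1/4 - r * u) - \<Phi> (1/4)\<bar> * h r u \<le> B * (r / d)"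
            using cut_Phi_bounds[of "1/4 - r * u"] Phi_quarter_pos Phi_le[of "1/4"] h0
            by (intro mult_mono) auto
          moreover have "0 \<le> e * h r u" using e h0 by simp
          ultimately show ?thesis by linarith
        qed
        finally show ?thesis using True by simp
      next
        case False
        then have "h r u = 0" by (auto simp: h_def indicator_def)
        then show ?thesis using B_nonneg r d by (simp add: k indicator_def)
      qed
      have "\<bar>scaled_integral r - \<Phi> (1/4) * J r\<bar> = \<bar>\<integral>u. k u - \<Phi> (1/4) * h r u \<partial>lborel\<bar>"
      proof -
        have "scaled_integral r = integral\<^sup>L lborel k" unfolding scaled_integral_def k_def ..
        then show ?thesis using kint hint by (simp add: Jh[OF r])
      qed
      also have "\<dots> \<le> (\<integral>u. \<bar>k u - \<Phi> (1/4) * h r u\<bar> \<partial>lborel)" by (rule integral_abs_bound)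
      also have "\<dots> \<le> (\<integral>u. e * h r u + B * (r / d) * indicator {0..1 / (4 * r)} u \<partial>lborel)"
        by (intro integral_mono pt Bochner_Integration.integrable_add integrable_mult_right integrable_abs
            Bochner_Integration.integrable_diff integrable_real_indicator hint kint) (auto simp: emeasure_lborel_Icc_eq)
      also have "\<dots> = e * J r + B * (r / d) * (1 / (4 * r))"
        using hint r by (simp add: Jh[OF r])
      also have "B * (r / d) * (1 / (4 * r)) = B / (4 * d)" using r d by simp
      finally show ?thesis .
    qed
    then show ?thesis by blast
  qed
  have JL: "((\<lambda>r. J r / ln (1 / r)) \<longlongrightarrow> 1) (at_right 0)" unfolding J_def by real_asymp
  have L: "filterlim (\<lambda>r::real. ln (1 / r)) at_top (at_right 0)" by real_asymp
  show ?thesis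
  proof (rule tendstoI)
    fix e :: real assume "e > 0"
    then have e4: "e / 4 > 0" by simp
    \<comment> \<open>With tolerance e/4 the error bound below tends to e/4, because J / ln (1/r)
      tends to 1; eventually it is therefore below e.\<close>
    obtain C where C: "\<And>r. r > 0 \<Longrightarrow> \<bar>scaled_integral r - \<Phi> (1/4) * J r\<bar> \<le> e / 4 * J r + C"
      using close[OF e4] by blast
    have "((\<lambda>r. \<Phi> (1/4) * \<bar>J r / ln (1 / r) - 1\<bar> + C / ln (1 / r) + e / 4 * (J r / ln (1 / r))) \<longlongrightarrow> \<Phi> (1/4) * \<bar>1 - 1\<bar> + 0 + e / 4 * 1) (at_right 0)"
      by (intro tendsto_add tendsto_mult tendsto_const tendsto_rabs tendsto_diff JL tendsto_divide_0[OF tendsto_const] filterlim_at_top_imp_at_infinity[OF L])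
    then have "eventually (\<lambda>r. \<Phi> (1/4) * \<bar>J r / ln (1 / r) - 1\<bar> + C / ln (1 / r) + e / 4 * (J r / ln (1 / r)) < e) (at_right 0)"
      by (rule order_tendstoD) (use \<open>e > 0\<close> in simp)
    moreover have "eventually (\<lambda>r::real. r > 0) (at_right 0)" by (simp add: eventually_at_right_less)
    moreover have "eventually (\<lambda>r::real. ln (1 / r) > 0) (at_right 0)" using L by (simp add: filterlim_at_top_dense)
    ultimately show "eventually (\<lambda>r. dist (scaled_integral r / ln (1 / r)) (\<Phi> (1/4)) < e) (at_right 0)"
    proof eventually_elim
      case (elim r)
      define l where "l = ln (1 / r)"
      have l: "l > 0" using elim by (simp add: l_def)
      have "scaled_integral r / l - \<Phi> (1/4) = (scaled_integral r - \<Phi> (1/4) * J r) / l + \<Phi> (1/4) * (J r / l - 1)"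
        using l by (simp add: diff_divide_distrib right_diff_distrib)
      then have "\<bar>scaled_integral r / l - \<Phi> (1/4)\<bar> \<le> \<bar>(scaled_integral r - \<Phi> (1/4) * J r) / l\<bar> + \<bar>\<Phi> (1/4) * (J r / l - 1)\<bar>"
        by (simp only: abs_triangle_ineq)
      also have "\<bar>(scaled_integral r - \<Phi> (1/4) * J r) / l\<bar> \<le> (e / 4 * J r + C) / l"
        using C[of r] elim l by (simp add: abs_divide divide_right_mono)
      also have "(e / 4 * J r + C) / l = e / 4 * (J r / l) + C / l" by (simp add: add_divide_distrib)
      also have "\<bar>\<Phi> (1/4) * (J r / l - 1)\<bar> = \<Phi> (1/4) * \<bar>J r / l - 1\<bar>"
        using Phi_quarter_pos by (simp add: abs_mult)
      finally show ?case using elim(1) unfolding dist_real_def l_def by linarith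
    qed
  qed
qed

text \<open>For \<alpha> = 1 the prefactor tends to 4^(-2) = 1/16. The logarithms of
  \<open>gap_scale t\<close> and \<open>sq_norm t\<close> differ by a convergent quantity while both
  diverge, so they are asymptotically equal.\<close>

lemma log_law_ratio:
  assumes \<alpha>1: "\<alpha> = 1"
  shows "((\<lambda>t. spec_dens \<sigma>2 \<Phi> \<alpha> t / \<bar>ln (sq_norm t)\<bar>) \<longlongrightarrow> \<sigma>2 / (4 * pi\<^sup>2) * 16 powr (- 1) * \<Phi> (1/4)) (at (0, 0))"
proof -
  have lnq: "filterlim (\<lambda>t. ln (sq_norm t)) at_bot (at (0, 0))"
    by (rule filterlim_compose[OF ln_at_0 sq_norm_at_right])
  have neg: "eventually (\<lambda>t. ln (sq_norm t) < 0) (at (0, 0))"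
    using lnq by (simp add: filterlim_at_bot_dense)
  have "((\<lambda>t. 1 + ln (gap_scale t / sq_norm t) / ln (sq_norm t)) \<longlongrightarrow> 1 + 0) (at (0, 0))"
    by (intro tendsto_add tendsto_const tendsto_divide_0[OF tendsto_ln[OF gap_scale_ratio]] filterlim_at_bot_imp_at_infinity[OF lnq]) simp
  note lim_ln = this
  have lim_J: "((\<lambda>t. scaled_integral (gap_scale t) / ln (1 / gap_scale t)) \<longlongrightarrow> \<Phi> (1/4)) (at (0, 0))"
    by (rule filterlim_compose[OF scaled_integral_log[OF \<alpha>1] gap_scale_at_right])
  have lim: "((\<lambda>t. \<sigma>2 / (4 * pi\<^sup>2) * ((4 - 2 * cos_gap t) powr (- 2) * (scaled_integral (gap_scale t) / ln (1 / gap_scale t) *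
      (1 + ln (gap_scale t / sq_norm t) / ln (sq_norm t))))) \<longlongrightarrow>
      \<sigma>2 / (4 * pi\<^sup>2) * ((4 - 2 * 0) powr (- 2) * (\<Phi> (1/4) * (1 + 0)))) (at (0, 0))"
    by (intro tendsto_mult[OF tendsto_const] tendsto_mult[OF tendsto_powr] tendsto_mult[OF lim_J lim_ln]
        tendsto_const tendsto_diff cos_gap_tendsto) simp
  have "eventually (\<lambda>t. gap_scale t \<in> {0<..} \<and> gap_scale t \<noteq> 0) (at (0, 0))"
    and gap0: "(gap_scale \<longlongrightarrow> 0) (at (0, 0))"
    using gap_scale_at_right unfolding filterlim_at by blast+
  then have gpos: "eventually (\<lambda>t. 0 < gap_scale t) (at (0, 0))"
    by (elim eventually_mono) auto
  have val: "\<sigma>2 / (4 * pi\<^sup>2) * ((4 - 2 * 0) powr (- 2) * (\<Phi> (1/4) * (1 + 0))) = \<sigma>2 / (4 * pi\<^sup>2) * 16 powr (- 1) * \<Phi> (1/4)"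
    by (simp add: powr_minus_divide)
  \<comment> \<open>Makes \<open>ln (gap_scale t)\<close> negative, so that it can be
    cancelled.\<close>
  have glt: "eventually (\<lambda>t. gap_scale t < 1) (at (0, 0))"
    using gap0 by (rule order_tendstoD) simp
  have "eventually (\<lambda>t. \<sigma>2 / (4 * pi\<^sup>2) * ((4 - 2 * cos_gap t) powr (- 2) * (scaled_integral (gap_scale t) / ln (1 / gap_scale t) *
      (1 + ln (gap_scale t / sq_norm t) / ln (sq_norm t)))) = spec_dens \<sigma>2 \<Phi> \<alpha> t / \<bar>ln (sq_norm t)\<bar>) (at (0, 0))"
    using cos_gap_eventually eventually_nonzero neg gpos glt
  proof eventually_elim
    case (elim t)
    then have w: "0 < cos_gap t" "cos_gap t < 1" and p: "0 < sq_norm t" using sq_norm_pos by auto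
    define a where "a = ln (gap_scale t)"
    define b where "b = ln (sq_norm t)"
    have a: "a < 0" using elim by (simp add: a_def)
    have b: "b < 0" using elim by (simp add: b_def)
    have "ln (1 / gap_scale t) = - a" using elim by (simp add: a_def ln_div)
    moreover have "ln (gap_scale t / sq_norm t) = a - b" using elim p by (simp add: a_def b_def ln_div)
    moreover have "1 + (a - b) / b = a / b" using b by (simp add: diff_divide_distrib)
    moreover have "x / (- a) * (a / b) = x / \<bar>b\<bar>" for x using a b by simp
    ultimately have "scaled_integral (gap_scale t) / ln (1 / gap_scale t) * (1 + ln (gap_scale t / sq_norm t) / ln (sq_norm t))
        = scaled_integral (gap_scale t) / \<bar>ln (sq_norm t)\<bar>"
      unfolding b_def[symmetric] by (simp only:)
    then show ?case
      unfolding spec_dens_weight weight_integral_scaled[OF w] using w \<alpha>1 by simp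
  qed
  from Lim_transform_eventually[OF lim this] show ?thesis unfolding val .
qed

end

section \<open>Random-coefficient linear fields\<close>

text \<open>Absolute summability yields convergence of finite sums along one increasing sequence of
  sets. All of them contain \<open>F\<close>, so that a fixed partial sum can be subtracted
  termwise.\<close>

lemma counting_exhaustion:
  fixes a :: "'c::countable \<Rightarrow> real"
  assumes "integrable counting a" and F: "finite F"
  shows "(\<lambda>n. \<Sum>q\<in>from_nat ` {..<n} \<union> F. a q) \<longlonglongrightarrow> (\<integral>q. a q \<partial>counting)"
proof -
  define A where "A n = from_nat ` {..<n} \<union> F" for n
  have "(\<lambda>n. \<integral>q. indicator (A n) q * a q \<partial>counting) \<longlonglongrightarrow> (\<integral>q. a q \<partial>counting)"
  proof (rule integral_dominated_convergence[where w = "\<lambda>q. \<bar>a q\<bar>"])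
    show "AE q in counting. (\<lambda>n. indicator (A n) q * a q) \<longlonglongrightarrow> a q"
    proof (rule AE_I2)
      fix q
      have "eventually (\<lambda>n. indicator (A n) q * a q = a q) sequentially"
        using eventually_gt_at_top[of "to_nat q"]
      proof eventually_elim
        case (elim n)
        then have "q \<in> A n" unfolding A_def by (intro UnI1 image_eqI[of _ _ "to_nat q"]) auto
        then show ?case by simp
      qed
      then show "(\<lambda>n. indicator (A n) q * a q) \<longlonglongrightarrow> a q" by (rule tendsto_eventually)
    qed
  qed (use assms in \<open>auto simp: abs_mult indicator_def\<close>)
  moreover have "(\<integral>q. indicator (A n) q * a q \<partial>counting) = (\<Sum>q\<in>A n. a q)" for n
  proof -
    have fin: "finite (A n)" using F by (simp add: A_def)
    have "(\<integral>q. indicator (A n) q * a q \<partial>counting) = (\<integral>q. a q \<partial>count_space (A n))"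
      using integral_restrict_space[of "A n" counting a] by (simp add: restrict_count_space mult.commute)
    also have "\<dots> = (\<Sum>q\<in>A n. a q)" using fin by (simp add: lebesgue_integral_count_space_finite)
    finally show ?thesis .
  qed
  ultimately show ?thesis by (simp add: A_def)
qed

text \<open>The threshold is a finite set rather than an index, matching the unordered convergence
  demanded by \<open>L2_series_conv\<close>.\<close>

lemma counting_tail_small:
  fixes H :: "'c::countable \<Rightarrow> ennreal"
  assumes fin: "(\<integral>\<^sup>+q. H q \<partial>counting) < \<infinity>" and e: "e > 0"
  shows "\<exists>F0. finite F0 \<and> (\<forall>F. F0 \<subseteq> F \<longrightarrow> (\<integral>\<^sup>+q. H q * indicator (- F) q \<partial>counting) < e)"
proof -
  define A :: "nat \<Rightarrow> 'c set" where "A n = from_nat ` {..<n}" for n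
  have "(\<lambda>n. \<integral>\<^sup>+q. H q * indicator (- A n) q \<partial>counting) \<longlonglongrightarrow> (\<integral>\<^sup>+q. 0 \<partial>(counting :: 'c measure))"
  proof (rule nn_integral_dominated_convergence[where w = H and u' = "\<lambda>_. 0"])
    show "AE q in counting. (\<lambda>n. H q * indicator (- A n) q) \<longlonglongrightarrow> 0"
    proof (rule AE_I2)
      fix q
      have "eventually (\<lambda>n. H q * indicator (- A n) q = 0) sequentially"
        using eventually_gt_at_top[of "to_nat q"]
      proof eventually_elim
        case (elim n)
        then have "q \<in> A n" unfolding A_def by (intro image_eqI[of _ _ "to_nat q"]) auto
        then show ?case by simp
      qed
      then show "(\<lambda>n. H q * indicator (- A n) q) \<longlonglongrightarrow> 0" by (rule tendsto_eventually)
    qed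
  qed (use fin in \<open>auto simp: indicator_def\<close>)
  then have "eventually (\<lambda>n. (\<integral>\<^sup>+q. H q * indicator (- A n) q \<partial>counting) < e) sequentially"
    using e by (intro order_tendstoD(2)) auto
  then obtain n where n: "(\<integral>\<^sup>+q. H q * indicator (- A n) q \<partial>counting) < e"
    by (auto simp: eventually_sequentially)
  have "(\<integral>\<^sup>+q. H q * indicator (- F) q \<partial>counting) < e" if "A n \<subseteq> F" for F
    by (rule le_less_trans[OF _ n], intro nn_integral_mono) (use that in \<open>auto simp: indicator_def\<close>)
  then show ?thesis by (intro exI[of _ "A n"]) (auto simp: A_def)
qed

text \<open>Each term of a nonnegative summable family is at most the total, so the squares are
  dominated by a multiple of the family.\<close>

lemma integrable_counting_square:
  fixes g :: "'c::countable \<Rightarrow> real"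
  assumes g: "\<And>q. 0 \<le> g q" "integrable counting g"
  shows "integrable counting (\<lambda>q. (g q)\<^sup>2)"
proof (rule Bochner_Integration.integrable_bound[of _ "\<lambda>q. (\<integral>r. g r \<partial>counting) * g q"])
  have "g q \<le> (\<integral>r. g r \<partial>counting)" for q
  proof -
    have "(\<integral>r. indicator {q} r * g q \<partial>counting) \<le> (\<integral>r. g r \<partial>counting)"
      by (intro integral_mono integrable_mult_left g(2) integrable_real_indicator) (auto simp: indicator_def g(1))
    then show ?thesis by simp
  qed
  then show "AE q in counting. norm ((g q)\<^sup>2) \<le> norm ((\<integral>r. g r \<partial>counting) * g q)"
    using g by (intro AE_I2) (auto simp: power2_eq_square abs_mult intro!: mult_right_mono)
qed (use g in auto)

lemma integrable_counting_mult_bounded: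
  fixes g m :: "'c::countable \<Rightarrow> real"
  assumes g: "\<And>q. 0 \<le> g q" "integrable counting g" and m: "\<And>q. 0 \<le> m q" "\<And>q. m q \<le> C"
  shows "integrable counting (\<lambda>q. g q * m q)"
proof (rule Bochner_Integration.integrable_bound[of _ "\<lambda>q. g q * C"])
  have "0 \<le> g q * m q" "g q * m q \<le> g q * C" for q
    using g(1) m by (auto intro: mult_left_mono)
  then show "AE q in counting. norm (g q * m q) \<le> norm (g q * C)"
    by (intro AE_I2) (metis abs_of_nonneg order_trans real_norm_def)
qed (use g in auto)

section \<open>Linear filters of white noise with fixed coefficients\<close>

locale white_noise_law =
  fixes Q :: "(int \<times> int \<Rightarrow> real) measure" and \<sigma>2 :: real
  assumes prob_Q: "prob_space Q"
    and sets_Q [measurable_cong]: "sets Q = sets (PiM UNIV (\<lambda>_. borel))"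
    and sigma_pos: "\<sigma>2 > 0"
    and noise_sq: "\<And>p. integrable Q (\<lambda>e. (e p)\<^sup>2)"
    and noise_mean: "\<And>p. (\<integral>e. e p \<partial>Q) = 0"
    and noise_var: "\<And>p. (\<integral>e. (e p)\<^sup>2 \<partial>Q) = \<sigma>2"
    and noise_uncorr: "\<And>p q. p \<noteq> q \<Longrightarrow> (\<integral>e. e p * e q \<partial>Q) = 0"
begin

sublocale Q: prob_space Q by (rule prob_Q)

lemma noise_measurable [measurable]: "(\<lambda>e. e p) \<in> borel_measurable Q"
  by measurable

lemma noise_integrable: "integrable Q (\<lambda>e. e p)"
  by (rule Q.square_integrable_imp_integrable[OF noise_measurable noise_sq])

lemma noise_cov: "(\<integral>e. e p * e q \<partial>Q) = \<sigma>2 * of_bool (p = q)"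
  using noise_var[of p] noise_uncorr[of p q] by (cases "p = q") (auto simp: power2_eq_square)

text \<open>Uniformity in the site is the point: it keeps the series of first absolute moments
  summable.\<close>

lemma abs_noise_le: "(\<integral>e. \<bar>e p\<bar> \<partial>Q) \<le> 1 + \<sigma>2"
proof -
  have "\<bar>u\<bar> \<le> 1 + u\<^sup>2" for u :: real
  proof (cases "\<bar>u\<bar> \<le> 1")
    case True
    then show ?thesis using zero_le_power2[of u] by linarith
  next
    case False
    then have "\<bar>u\<bar> * 1 \<le> \<bar>u\<bar> * \<bar>u\<bar>" by (intro mult_left_mono) auto
    also have "\<bar>u\<bar> * \<bar>u\<bar> = u\<^sup>2" by (simp add: power2_eq_square)
    finally show ?thesis by simp
  qed
  then have "(\<integral>e. \<bar>e p\<bar> \<partial>Q) \<le> (\<integral>e. 1 + (e p)\<^sup>2 \<partial>Q)"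
    by (intro integral_mono integrable_abs Bochner_Integration.integrable_add noise_sq noise_integrable) auto
  then show ?thesis using noise_sq noise_var[of p] by (simp add: Q.prob_space)
qed

text \<open>The value is 0 at configurations for which the series is not absolutely summable; under
  the hypotheses below these form a null set.\<close>

definition linear_filter :: "(int \<times> int \<Rightarrow> real) \<Rightarrow> int \<times> int \<Rightarrow> (int \<times> int \<Rightarrow> real) \<Rightarrow> real" where
  "linear_filter g p e = (\<integral>q. g q * e (p - q) \<partial>counting)"

context
  fixes g :: "int \<times> int \<Rightarrow> real"
  assumes g_nonneg: "\<And>q. 0 \<le> g q" and g_int: "integrable counting g"
begin

lemma filter_summands:
  shows "\<And>q. integrable Q (\<lambda>e. g q * e (p - q))"
    and "integrable counting (\<lambda>q. \<integral>e. norm (g q * e (p - q)) \<partial>Q)"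
proof -
  show "integrable Q (\<lambda>e. g q * e (p - q))" for q by (intro integrable_mult_right noise_integrable)
  have "(\<integral>e. norm (g q * e (p - q)) \<partial>Q) = g q * (\<integral>e. \<bar>e (p - q)\<bar> \<partial>Q)" for q
    using g_nonneg[of q] by (simp add: abs_mult)
  then show "integrable counting (\<lambda>q. \<integral>e. norm (g q * e (p - q)) \<partial>Q)"
    using integrable_counting_mult_bounded[OF g_nonneg g_int, of "\<lambda>q. \<integral>e. \<bar>e (p - q)\<bar> \<partial>Q", OF _ abs_noise_le] by simp
qed

lemmas filter_interchange = Q.sigma_finite_measure_axioms filter_summands(1) filter_summands(2)

lemma filter_AE_summable: "AE e in Q. integrable counting (\<lambda>q. g q * e (p - q))"
  by (rule AE_sum_integrable[OF filter_interchange])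

lemma filter_integrable: "integrable Q (linear_filter g p)"
  unfolding linear_filter_def[abs_def] by (rule integrable_sum_integral[OF filter_interchange])

lemma filter_measurable [measurable]: "linear_filter g p \<in> borel_measurable Q"
  using filter_integrable by simp

lemma filter_mean: "(\<integral>e. linear_filter g p e \<partial>Q) = 0"
  unfolding linear_filter_def integral_sum_integral[OF filter_interchange] by (simp add: noise_mean)

lemma finite_filter_variance:
  assumes "finite H"
  shows "(\<integral>\<^sup>+e. ennreal ((\<Sum>q\<in>H. g q * e (p - q))\<^sup>2) \<partial>Q) = ennreal (\<sigma>2 * (\<Sum>q\<in>H. (g q)\<^sup>2))"
proof -
  note sq = integrable_square_sum[where f = "\<lambda>q e. e (p - q)" and M = Q and S = H and a = g, OF noise_measurable noise_sq]
  have "p - q = p - r \<longleftrightarrow> q = r" for q r by auto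
  then have "(\<integral>e. (\<Sum>q\<in>H. g q * e (p - q))\<^sup>2 \<partial>Q) = (\<Sum>q\<in>H. \<Sum>r\<in>H. g q * g r * (\<sigma>2 * of_bool (q = r)))"
    unfolding sq(2) noise_cov by (simp only:)
  also have "\<dots> = (\<Sum>q\<in>H. \<sigma>2 * (g q)\<^sup>2)"
  proof (intro sum.cong refl)
    fix q assume "q \<in> H"
    then have "(\<Sum>r\<in>H. g q * g r * (\<sigma>2 * of_bool (q = r))) = (\<Sum>r\<in>{q}. g q * g r * (\<sigma>2 * of_bool (q = r)))"
      using assms by (intro sum.mono_neutral_right) auto
    then show "(\<Sum>r\<in>H. g q * g r * (\<sigma>2 * of_bool (q = r))) = \<sigma>2 * (g q)\<^sup>2"
      by (simp add: power2_eq_square)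
  qed
  also have "\<dots> = \<sigma>2 * (\<Sum>q\<in>H. (g q)\<^sup>2)" by (rule sum_distrib_left[symmetric])
  finally have eq: "(\<integral>e. (\<Sum>q\<in>H. g q * e (p - q))\<^sup>2 \<partial>Q) = \<sigma>2 * (\<Sum>q\<in>H. (g q)\<^sup>2)" .
  show ?thesis unfolding eq[symmetric] by (rule nn_integral_eq_integral[OF sq(1)]) simp
qed

text \<open>Fatou's lemma along finite sets of sites exhausting the lattice.\<close>

lemma filter_tail_bound:
  assumes F: "finite F"
  shows "(\<integral>\<^sup>+e. ennreal ((linear_filter g p e - (\<Sum>q\<in>F. g q * e (p - q)))\<^sup>2) \<partial>Q)
    \<le> ennreal \<sigma>2 * (\<integral>\<^sup>+q. ennreal ((g q)\<^sup>2) * indicator (- F) q \<partial>counting)"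
proof -
  define A where "A n = from_nat ` {..<n} \<union> F" for n
  have finA: "finite (A n)" for n using F by (simp add: A_def)
  define u where "u n e = ennreal ((\<Sum>q\<in>A n - F. g q * e (p - q))\<^sup>2)" for n e
  have um [measurable]: "u n \<in> borel_measurable Q" for n unfolding u_def[abs_def] by measurable
  have AE_lim: "AE e in Q. ennreal ((linear_filter g p e - (\<Sum>q\<in>F. g q * e (p - q)))\<^sup>2) = liminf (\<lambda>n. u n e)"
    using filter_AE_summable[of p]
  proof eventually_elim
    case (elim e)
    have "(\<lambda>n. \<Sum>q\<in>A n. g q * e (p - q)) \<longlonglongrightarrow> linear_filter g p e"
      unfolding A_def linear_filter_def by (rule counting_exhaustion[OF elim F])
    then have "(\<lambda>n. ennreal (((\<Sum>q\<in>A n. g q * e (p - q)) - (\<Sum>q\<in>F. g q * e (p - q)))\<^sup>2))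
        \<longlonglongrightarrow> ennreal ((linear_filter g p e - (\<Sum>q\<in>F. g q * e (p - q)))\<^sup>2)"
      by (intro tendsto_ennrealI tendsto_power tendsto_diff tendsto_const)
    moreover have "(\<Sum>q\<in>A n. g q * e (p - q)) - (\<Sum>q\<in>F. g q * e (p - q)) = (\<Sum>q\<in>A n - F. g q * e (p - q))" for n
      using finA[of n] by (subst sum_diff) (auto simp: A_def)
    ultimately have "(\<lambda>n. u n e) \<longlonglongrightarrow> ennreal ((linear_filter g p e - (\<Sum>q\<in>F. g q * e (p - q)))\<^sup>2)"
      by (simp add: u_def)
    then show ?case by (intro lim_imp_Liminf[symmetric]) auto
  qed
  have le: "(\<integral>\<^sup>+e. u n e \<partial>Q) \<le> ennreal \<sigma>2 * (\<integral>\<^sup>+q. ennreal ((g q)\<^sup>2) * indicator (- F) q \<partial>counting)" for n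
  proof -
    have "(\<integral>\<^sup>+e. u n e \<partial>Q) = ennreal \<sigma>2 * (\<Sum>q\<in>A n - F. ennreal ((g q)\<^sup>2))"
      unfolding u_def using finite_filter_variance[of "A n - F" p] finA[of n] sigma_pos
      by (simp add: ennreal_mult sum_nonneg sum_ennreal)
    also have "(\<Sum>q\<in>A n - F. ennreal ((g q)\<^sup>2)) = (\<integral>\<^sup>+q. ennreal ((g q)\<^sup>2) * indicator (A n - F) q \<partial>counting)"
      using finA[of n] by (subst nn_integral_indicator_finite) auto
    also have "\<dots> \<le> (\<integral>\<^sup>+q. ennreal ((g q)\<^sup>2) * indicator (- F) q \<partial>counting)"
      by (intro nn_integral_mono) (auto simp: indicator_def)
    finally show ?thesis by (simp add: mult_left_mono)
  qed
  have "(\<integral>\<^sup>+e. ennreal ((linear_filter g p e - (\<Sum>q\<in>F. g q * e (p - q)))\<^sup>2) \<partial>Q) = (\<integral>\<^sup>+e. liminf (\<lambda>n. u n e) \<partial>Q)"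
    by (rule nn_integral_cong_AE[OF AE_lim])
  also have "\<dots> \<le> liminf (\<lambda>n. \<integral>\<^sup>+e. u n e \<partial>Q)" by (rule nn_integral_liminf) simp
  also have "\<dots> \<le> ennreal \<sigma>2 * (\<integral>\<^sup>+q. ennreal ((g q)\<^sup>2) * indicator (- F) q \<partial>counting)"
    by (rule order_trans[OF Liminf_le_Limsup Limsup_bounded]) (simp_all add: le)
  finally show ?thesis .
qed

lemma filter_square_integrable: "integrable Q (\<lambda>e. (linear_filter g p e)\<^sup>2)"
proof (rule integrableI_bounded)
  have "(\<integral>\<^sup>+e. ennreal ((linear_filter g p e)\<^sup>2) \<partial>Q) \<le> ennreal \<sigma>2 * (\<integral>\<^sup>+q. ennreal ((g q)\<^sup>2) \<partial>counting)"
    using filter_tail_bound[of "{}" p] by simp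
  also have "(\<integral>\<^sup>+q. ennreal ((g q)\<^sup>2) \<partial>counting) < \<infinity>"
    using integrable_counting_square[OF g_nonneg g_int] by (subst nn_integral_eq_integral) auto
  then have "ennreal \<sigma>2 * (\<integral>\<^sup>+q. ennreal ((g q)\<^sup>2) \<partial>counting) < \<infinity>" by (simp add: ennreal_mult_less_top)
  finally show "(\<integral>\<^sup>+e. ennreal (norm ((linear_filter g p e)\<^sup>2)) \<partial>Q) < \<infinity>" by simp
qed measurable

text \<open>Correlating with one noise variable singles out one term of the series.\<close>

lemma filter_noise_cov: "(\<integral>e. e s * linear_filter g p e \<partial>Q) = \<sigma>2 * g (p - s)"
proof -
  define f where "f r e = g r * (e s * e (p - r))" for r and e :: "int \<times> int \<Rightarrow> real"
  have int: "integrable Q (f r)" for r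
    unfolding f_def[abs_def] by (intro integrable_mult_right integrable_mult_of_squares noise_sq) measurable
  have bound: "(\<integral>e. \<bar>e s * e t\<bar> \<partial>Q) \<le> \<sigma>2 + \<sigma>2" for t
    using integral_abs_mult_le[OF noise_measurable[of s] noise_measurable[of t] noise_sq noise_sq]
    by (simp add: noise_var)
  have sum: "integrable counting (\<lambda>r. \<integral>e. norm (f r e) \<partial>Q)"
  proof -
    have "(\<integral>e. norm (f r e) \<partial>Q) = g r * (\<integral>e. \<bar>e s * e (p - r)\<bar> \<partial>Q)" for r
      using g_nonneg[of r] by (simp add: f_def abs_mult[of "g r"])
    then show ?thesis
      using integrable_counting_mult_bounded[OF g_nonneg g_int, of "\<lambda>r. \<integral>e. \<bar>e s * e (p - r)\<bar> \<partial>Q", OF _ bound] by simp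
  qed
  have "e s * linear_filter g p e = (\<integral>r. f r e \<partial>counting)" for e
    unfolding f_def linear_filter_def by (subst integral_mult_right_zero[symmetric]) (simp only: mult.left_commute)
  then have "(\<integral>e. e s * linear_filter g p e \<partial>Q) = (\<integral>r. \<integral>e. f r e \<partial>Q \<partial>counting)"
    using integral_sum_integral[OF Q.sigma_finite_measure_axioms int sum] by simp
  also have "\<dots> = (\<integral>r. indicator {p - s} r * (\<sigma>2 * g (p - s)) \<partial>counting)"
    by (intro Bochner_Integration.integral_cong refl) (auto simp: f_def noise_cov indicator_def)
  also have "\<dots> = \<sigma>2 * g (p - s)" by simp
  finally show ?thesis .
qed

text \<open>Only the first filter is expanded; its terms are covered by
  \<open>filter_noise_cov\<close>, so two single exchanges replace one of a double series. A shift
  of the lattice by p' - p then brings the sum to autocorrelation form.\<close>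

lemma filter_cov:
  "(\<integral>e. linear_filter g p e * linear_filter g p' e \<partial>Q) = \<sigma>2 * (\<integral>w. g w * g (w - (p' - p)) \<partial>counting)"
proof -
  define f where "f q e = g q * (e (p - q) * linear_filter g p' e)" for q and e :: "int \<times> int \<Rightarrow> real"
  have prod: "integrable Q (\<lambda>e. e t * linear_filter g p' e)" for t
    by (intro integrable_mult_of_squares noise_sq filter_square_integrable) measurable
  have int: "integrable Q (f q)" for q
    unfolding f_def[abs_def] by (intro integrable_mult_right prod)
  have bound: "(\<integral>e. \<bar>e t * linear_filter g p' e\<bar> \<partial>Q) \<le> \<sigma>2 + (\<integral>e. (linear_filter g p' e)\<^sup>2 \<partial>Q)" for t
    using integral_abs_mult_le[OF noise_measurable[of t] filter_measurable noise_sq filter_square_integrable]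
    by (simp add: noise_var)
  have sum: "integrable counting (\<lambda>q. \<integral>e. norm (f q e) \<partial>Q)"
  proof -
    have "(\<integral>e. norm (f q e) \<partial>Q) = g q * (\<integral>e. \<bar>e (p - q) * linear_filter g p' e\<bar> \<partial>Q)" for q
      using g_nonneg[of q] by (simp add: f_def abs_mult[of "g q"])
    then show ?thesis
      using integrable_counting_mult_bounded[OF g_nonneg g_int, of "\<lambda>q. \<integral>e. \<bar>e (p - q) * linear_filter g p' e\<bar> \<partial>Q", OF _ bound] by simp
  qed
  have "linear_filter g p e * linear_filter g p' e = (\<integral>q. f q e \<partial>counting)" for e
    unfolding f_def linear_filter_def[of g p] by (subst integral_mult_left_zero[symmetric]) (simp only: mult.assoc)
  then have "(\<integral>e. linear_filter g p e * linear_filter g p' e \<partial>Q) = (\<integral>q. \<integral>e. f q e \<partial>Q \<partial>counting)"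
    using integral_sum_integral[OF Q.sigma_finite_measure_axioms int sum] by simp
  also have "\<dots> = (\<integral>q. \<sigma>2 * (g (q + (p' - p)) * g ((q + (p' - p)) - (p' - p))) \<partial>counting)"
  proof (intro Bochner_Integration.integral_cong refl)
    fix q
    have eq1: "p' - (p - q) = q + (p' - p)" and eq2: "q + (p' - p) - (p' - p) = q" by simp_all
    show "(\<integral>e. f q e \<partial>Q) = \<sigma>2 * (g (q + (p' - p)) * g ((q + (p' - p)) - (p' - p)))"
      unfolding f_def integral_mult_right_zero filter_noise_cov eq1 eq2 by (simp only: mult_ac)
  qed
  also have "\<dots> = \<sigma>2 * (\<integral>w. g w * g (w - (p' - p)) \<partial>counting)"
  proof -
    have bij: "bij_betw (\<lambda>q. q + (p' - p)) UNIV UNIV"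
      by (rule bij_betwI[where g = "\<lambda>q. q - (p' - p)"]) auto
    show ?thesis
      unfolding integral_mult_right_zero
      using integral_bij_count_space[OF bij, of "\<lambda>w. g w * g (w - (p' - p))"] by simp
  qed
  finally show ?thesis .
qed

end

end

section \<open>Averaging over the random coefficient\<close>

definition re_laurent :: "int \<times> int \<Rightarrow> real \<Rightarrow> real" where
  "re_laurent q x = Re (laurent_coeff (fst q) (snd q) x)"

lemma re_laurent_green: "0 \<le> x \<Longrightarrow> x < 1/4 \<Longrightarrow> re_laurent q x = green x q"
  by (simp add: re_laurent_def laurent_coeff_green)

lemma sigma_finite_torus: "sigma_finite_measure torus"
  using finite_measure_torus by (rule finite_measure.axioms(1))

lemma walk_symbol_torus_measurable [measurable]: "walk_symbol \<in> borel_measurable torus"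
  by (rule borel_measurable_torusI) measurable

lemma cis_phase_torus_measurable [measurable]: "(\<lambda>t. cis (phase t q)) \<in> borel_measurable torus"
  by (rule borel_measurable_torusI) measurable

text \<open>Measurability is read off the torus integral, which is defined for all real
  \<open>x\<close>, whereas the Green series represents the coefficient only on [0, 1/4).\<close>

lemma re_laurent_measurable [measurable]: "re_laurent q \<in> borel_measurable borel"
proof -
  interpret T: sigma_finite_measure torus by (rule sigma_finite_torus)
  have m [measurable]: "(\<lambda>t. cis (- phase t q)) \<in> borel_measurable torus"
    using cis_phase_torus_measurable[of "- q"] by (simp add: phase_def)
  have "(\<lambda>x. \<integral>t. complex_of_real (1 / (1 - x * walk_symbol t)) * cis (- phase t q) \<partial>torus) \<in> borel_measurable borel"
    by measurable
  then show ?thesis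
    unfolding re_laurent_def[abs_def] laurent_coeff_eq by simp
qed

lemma borel_measurable_nn_integral_counting:
  fixes f :: "'c::countable \<Rightarrow> 'b \<Rightarrow> ennreal"
  assumes [measurable]: "\<And>q. f q \<in> borel_measurable M"
  shows "(\<lambda>x. \<integral>\<^sup>+q. f q x \<partial>counting) \<in> borel_measurable M"
proof -
  interpret C: sigma_finite_measure "counting :: 'c measure"
    by (rule sigma_finite_measure_count_space)
  have "(\<lambda>(x, q). f q x) \<in> borel_measurable (M \<Otimes>\<^sub>M (counting :: 'c measure))"
    unfolding split_beta'
    by (rule measurable_compose_countable[where f = "\<lambda>q w. f q (fst w)" and g = snd]) measurable
  then show ?thesis by (rule C.borel_measurable_nn_integral)
qed

lemma integrable_symbol_inverse_square:
  assumes x: "0 \<le> x" "x < 1/4"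
  shows "integrable torus (\<lambda>t. 1 / (1 - x * walk_symbol t)\<^sup>2)"
proof -
  interpret T: finite_measure torus by (rule finite_measure_torus)
  have "\<bar>1 / (1 - x * walk_symbol t)\<^sup>2\<bar> \<le> 1 / (1 - x * 4)\<^sup>2" for t
  proof -
    have "x * walk_symbol t \<le> x * 4" using abs_walk_symbol_le[of t] x by (intro mult_left_mono) auto
    then have "(1 - x * 4)\<^sup>2 \<le> (1 - x * walk_symbol t)\<^sup>2" using x by (intro power_mono) auto
    then have "1 / (1 - x * walk_symbol t)\<^sup>2 \<le> 1 / (1 - x * 4)\<^sup>2"
      using x walk_symbol_pos[OF x, of t] by (intro divide_left_mono mult_pos_pos zero_less_power) auto
    then show ?thesis by simp
  qed
  then show ?thesis by (intro T.integrable_const_bound[of _ "1 / (1 - x * 4)\<^sup>2"] AE_I2) auto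
qed

text \<open>Parseval's identity at lag zero, in extended nonnegative form so that Tonelli applies
  when it is averaged over \<open>x\<close>.\<close>

lemma nn_integral_green_square:
  assumes x: "0 \<le> x" "x < 1/4"
  shows "(\<integral>\<^sup>+q. ennreal ((green x q)\<^sup>2) \<partial>counting)
    = ennreal (1 / (4 * pi\<^sup>2)) * (\<integral>\<^sup>+t. ennreal (1 / (1 - x * walk_symbol t)\<^sup>2) \<partial>torus)"
proof -
  have "complex_of_real (\<integral>w. (green x w)\<^sup>2 \<partial>counting)
      = (1 / (4 * complex_of_real (pi\<^sup>2))) * (\<integral>t. complex_of_real (1 / (1 - x * walk_symbol t)\<^sup>2) \<partial>torus)"
    using green_convolution[OF x, of "(0, 0)"] by (simp add: phase_def power2_eq_square)
  also have "\<dots> = complex_of_real (1 / (4 * pi\<^sup>2) * (\<integral>t. 1 / (1 - x * walk_symbol t)\<^sup>2 \<partial>torus))"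
    unfolding integral_complex_of_real by simp
  finally have eq: "(\<integral>w. (green x w)\<^sup>2 \<partial>counting) = 1 / (4 * pi\<^sup>2) * (\<integral>t. 1 / (1 - x * walk_symbol t)\<^sup>2 \<partial>torus)"
    by (simp only: of_real_eq_iff)
  have "(\<integral>\<^sup>+q. ennreal ((green x q)\<^sup>2) \<partial>counting) = ennreal (\<integral>w. (green x w)\<^sup>2 \<partial>counting)"
    using integrable_counting_square[OF green_nonneg[OF x(1)] integrable_green[OF x]] by (intro nn_integral_eq_integral) auto
  also have "\<dots> = ennreal (1 / (4 * pi\<^sup>2)) * ennreal (\<integral>t. 1 / (1 - x * walk_symbol t)\<^sup>2 \<partial>torus)"
    unfolding eq by (intro ennreal_mult) auto
  also have "ennreal (\<integral>t. 1 / (1 - x * walk_symbol t)\<^sup>2 \<partial>torus) = (\<integral>\<^sup>+t. ennreal (1 / (1 - x * walk_symbol t)\<^sup>2) \<partial>torus)"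
    using integrable_symbol_inverse_square[OF x] by (intro nn_integral_eq_integral[symmetric]) auto
  finally show ?thesis .
qed

locale random_coefficient_field = coefficient_density \<alpha> \<Phi> B + white_noise_law Q \<sigma>2
  for \<alpha> \<Phi> B Q \<sigma>2 +
  assumes prob_weight: "prob_space (density lborel (\<lambda>x. ennreal (weight x)))"
begin

definition D :: "real measure" where
  "D = density lborel (\<lambda>x. ennreal (weight x))"

sublocale D: prob_space D unfolding D_def by (rule prob_weight)

sublocale DQ: pair_prob_space D Q ..

lemma sets_D [measurable_cong]: "sets D = sets borel"
  by (simp add: D_def)

lemma D_range: "AE x in D. 0 \<le> x \<and> x < 1/4"
proof -
  have "0 \<le> x \<and> x < 1/4" if "0 < ennreal (weight x)" for x
    using weight_eq_0[of x] that by (cases "x \<in> {0..<1/4}") auto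
  then show ?thesis unfolding D_def by (subst AE_density) auto
qed

lemma nn_integral_D: "f \<in> borel_measurable borel \<Longrightarrow> (\<integral>\<^sup>+x. f x \<partial>D) = (\<integral>\<^sup>+x. ennreal (weight x) * f x \<partial>lborel)"
  unfolding D_def by (rule nn_integral_density) auto

text \<open>A fixed measurable function of the pair (coefficient, noise), so that laws and
  independence of the copies pass through it.\<close>

definition rc_field :: "int \<times> int \<Rightarrow> real \<times> (int \<times> int \<Rightarrow> real) \<Rightarrow> real" where
  "rc_field p z = linear_filter (\<lambda>q. re_laurent q (fst z)) p (snd z)"

definition rc_partial :: "(int \<times> int) set \<Rightarrow> int \<times> int \<Rightarrow> real \<times> (int \<times> int \<Rightarrow> real) \<Rightarrow> real" where
  "rc_partial F p z = (\<Sum>q\<in>F. re_laurent q (fst z) * snd z (p - q))"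

lemma re_laurent_square_measurable: "(\<lambda>x. ennreal ((re_laurent q x)\<^sup>2)) \<in> borel_measurable D"
proof -
  have "re_laurent q \<in> borel_measurable D"
    using re_laurent_measurable[of q] by (simp cong: measurable_cong_sets add: D_def)
  then show ?thesis by (intro measurable_compose[OF _ measurable_ennreal] borel_measurable_power)
qed

lemma rc_summand_measurable:
  "(\<lambda>z. re_laurent q (fst z) * snd z r) \<in> borel_measurable (borel \<Otimes>\<^sub>M PiM UNIV (\<lambda>_. borel :: real measure))"
  by measurable

lemma rc_field_measurable [measurable]:
  "rc_field p \<in> borel_measurable (borel \<Otimes>\<^sub>M PiM UNIV (\<lambda>_. borel))"
proof -
  interpret C: sigma_finite_measure "counting :: (int \<times> int) measure"
    by (rule sigma_finite_measure_count_space)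
  have "(\<lambda>(z, q). re_laurent q (fst z) * snd z (p - q))
      \<in> borel_measurable ((borel \<Otimes>\<^sub>M PiM UNIV (\<lambda>_. borel)) \<Otimes>\<^sub>M (counting :: (int \<times> int) measure))"
    unfolding split_beta'
    by (rule measurable_compose_countable[where f = "\<lambda>q w. re_laurent q (fst (fst w)) * snd (fst w) (p - q)" and g = snd])
      measurable
  from C.borel_measurable_lebesgue_integral[OF this]
  show ?thesis unfolding rc_field_def[abs_def] linear_filter_def by simp
qed

lemma rc_partial_measurable [measurable]:
  "rc_partial F p \<in> borel_measurable (borel \<Otimes>\<^sub>M PiM UNIV (\<lambda>_. borel))"
  unfolding rc_partial_def[abs_def] by (intro borel_measurable_sum rc_summand_measurable)

text \<open>The mean square of the coefficient at lag \<open>q\<close>; times the noise variance,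
  its tail sums bound the squared L^2 error of partial sums.\<close>

definition coeff_energy :: "int \<times> int \<Rightarrow> ennreal" where
  "coeff_energy q = (\<integral>\<^sup>+x. ennreal ((re_laurent q x)\<^sup>2) \<partial>D)"

lemma rc_field_green:
  assumes "0 \<le> x" "x < 1/4"
  shows "rc_field p (x, e) = linear_filter (green x) p e"
  using re_laurent_green[OF assms] by (simp add: rc_field_def)

text \<open>Tonelli and Parseval turn the total energy into a multiple of the finite spectral
  integral; this is why the series converges in L^2 although the coefficient may come arbitrarily
  close to 1/4.\<close>

lemma coeff_energy_finite: "(\<integral>\<^sup>+q. coeff_energy q \<partial>counting) < \<infinity>"
proof -
  interpret T: sigma_finite_measure torus by (rule sigma_finite_torus)
  have m: "(\<lambda>x. \<integral>\<^sup>+t. ennreal (1 / (1 - x * walk_symbol t)\<^sup>2) \<partial>torus) \<in> borel_measurable borel"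
    by measurable
  have "(\<integral>\<^sup>+q. coeff_energy q \<partial>counting) = (\<integral>\<^sup>+x. \<integral>\<^sup>+q. ennreal ((re_laurent q x)\<^sup>2) \<partial>counting \<partial>D)"
    unfolding coeff_energy_def by (rule nn_integral_count_space_nn_integral[symmetric])
      (simp, rule re_laurent_square_measurable)
  also have "\<dots> = (\<integral>\<^sup>+x. ennreal (1 / (4 * pi\<^sup>2)) * (\<integral>\<^sup>+t. ennreal (1 / (1 - x * walk_symbol t)\<^sup>2) \<partial>torus) \<partial>D)"
  proof (rule nn_integral_cong_AE)
    show "AE x in D. (\<integral>\<^sup>+q. ennreal ((re_laurent q x)\<^sup>2) \<partial>counting)
        = ennreal (1 / (4 * pi\<^sup>2)) * (\<integral>\<^sup>+t. ennreal (1 / (1 - x * walk_symbol t)\<^sup>2) \<partial>torus)"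
      using D_range
    proof eventually_elim
      case (elim x)
      then show ?case using nn_integral_green_square[of x] by (simp add: re_laurent_green)
    qed
  qed
  also have "\<dots> = ennreal (1 / (4 * pi\<^sup>2)) * (\<integral>\<^sup>+x. \<integral>\<^sup>+t. ennreal (1 / (1 - x * walk_symbol t)\<^sup>2) \<partial>torus \<partial>D)"
    using m by (intro nn_integral_cmult) (simp add: D_def)
  also have "(\<integral>\<^sup>+x. \<integral>\<^sup>+t. ennreal (1 / (1 - x * walk_symbol t)\<^sup>2) \<partial>torus \<partial>D)
      = (\<integral>\<^sup>+x. \<integral>\<^sup>+t. ennreal (weight x / (1 - x * walk_symbol t)\<^sup>2) \<partial>torus \<partial>lborel)"
    unfolding nn_integral_D[OF m]
  proof (intro nn_integral_cong)
    fix x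
    have "ennreal (weight x) * (\<integral>\<^sup>+t. ennreal (1 / (1 - x * walk_symbol t)\<^sup>2) \<partial>torus)
       = (\<integral>\<^sup>+t. ennreal (weight x) * ennreal (1 / (1 - x * walk_symbol t)\<^sup>2) \<partial>torus)"
      by (rule nn_integral_cmult[symmetric]) measurable
    then show "ennreal (weight x) * (\<integral>\<^sup>+t. ennreal (1 / (1 - x * walk_symbol t)\<^sup>2) \<partial>torus)
       = (\<integral>\<^sup>+t. ennreal (weight x / (1 - x * walk_symbol t)\<^sup>2) \<partial>torus)"
      using weight_nonneg[of x] by (simp add: ennreal_mult[symmetric])
  qed
  finally show ?thesis
    using spectral_nn_integral_finite by (simp add: ennreal_mult_less_top)
qed

text \<open>For almost every coefficient this is \<open>filter_tail_bound\<close>; Tonelli then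
  moves the average over the coefficient inside the sum over lags.\<close>

lemma rc_tail_bound:
  assumes F: "finite F"
  shows "(\<integral>\<^sup>+z. ennreal ((rc_field p z - rc_partial F p z)\<^sup>2) \<partial>(D \<Otimes>\<^sub>M Q))
    \<le> ennreal \<sigma>2 * (\<integral>\<^sup>+q. coeff_energy q * indicator (- F) q \<partial>counting)"
proof -
  have "(\<integral>\<^sup>+z. ennreal ((rc_field p z - rc_partial F p z)\<^sup>2) \<partial>(D \<Otimes>\<^sub>M Q))
      = (\<integral>\<^sup>+x. \<integral>\<^sup>+e. ennreal ((rc_field p (x, e) - rc_partial F p (x, e))\<^sup>2) \<partial>Q \<partial>D)"
    by (rule Q.nn_integral_fst[symmetric]) measurable
  also have "\<dots> \<le> (\<integral>\<^sup>+x. ennreal \<sigma>2 * (\<integral>\<^sup>+q. ennreal ((re_laurent q x)\<^sup>2) * indicator (- F) q \<partial>counting) \<partial>D)"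
  proof (rule nn_integral_mono_AE)
    show "AE x in D. (\<integral>\<^sup>+e. ennreal ((rc_field p (x, e) - rc_partial F p (x, e))\<^sup>2) \<partial>Q)
        \<le> ennreal \<sigma>2 * (\<integral>\<^sup>+q. ennreal ((re_laurent q x)\<^sup>2) * indicator (- F) q \<partial>counting)"
      using D_range
    proof eventually_elim
      case (elim x)
      then have x: "0 \<le> x" "x < 1/4" by auto
      show ?case
        using filter_tail_bound[OF green_nonneg[OF x(1)] integrable_green[OF x] F, of p]
        by (simp add: rc_field_green[OF x] rc_partial_def re_laurent_green[OF x])
    qed
  qed
  also have "\<dots> = ennreal \<sigma>2 * (\<integral>\<^sup>+x. (\<integral>\<^sup>+q. ennreal ((re_laurent q x)\<^sup>2) * indicator (- F) q \<partial>counting) \<partial>D)"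
    by (rule nn_integral_cmult, rule borel_measurable_nn_integral_counting)
      (intro borel_measurable_times_ennreal re_laurent_square_measurable borel_measurable_const)
  also have "(\<integral>\<^sup>+x. (\<integral>\<^sup>+q. ennreal ((re_laurent q x)\<^sup>2) * indicator (- F) q \<partial>counting) \<partial>D)
      = (\<integral>\<^sup>+q. (\<integral>\<^sup>+x. ennreal ((re_laurent q x)\<^sup>2) * indicator (- F) q \<partial>D) \<partial>counting)"
    by (rule nn_integral_count_space_nn_integral)
      (simp, intro borel_measurable_times_ennreal re_laurent_square_measurable borel_measurable_const)
  also have "\<dots> = (\<integral>\<^sup>+q. coeff_energy q * indicator (- F) q \<partial>counting)"
    unfolding coeff_energy_def by (intro nn_integral_cong nn_integral_multc re_laurent_square_measurable)
  finally show ?thesis .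
qed

lemma rc_field_DQ_measurable [measurable]: "rc_field p \<in> borel_measurable (D \<Otimes>\<^sub>M Q)"
  by measurable

lemma rc_field_square_integrable: "integrable (D \<Otimes>\<^sub>M Q) (\<lambda>z. (rc_field p z)\<^sup>2)"
proof (rule integrableI_bounded)
  have "(\<integral>\<^sup>+z. ennreal ((rc_field p z)\<^sup>2) \<partial>(D \<Otimes>\<^sub>M Q)) \<le> ennreal \<sigma>2 * (\<integral>\<^sup>+q. coeff_energy q \<partial>counting)"
    using rc_tail_bound[of "{}" p] by (simp add: rc_partial_def)
  also have "\<dots> < \<infinity>" using coeff_energy_finite by (simp add: ennreal_mult_less_top)
  finally show "(\<integral>\<^sup>+z. ennreal (norm ((rc_field p z)\<^sup>2)) \<partial>(D \<Otimes>\<^sub>M Q)) < \<infinity>" by simp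
qed measurable

lemma rc_series_converges:
  assumes "e > 0"
  shows "\<exists>F0. finite F0 \<and> (\<forall>F. finite F \<and> F0 \<subseteq> F \<longrightarrow>
    (\<integral>\<^sup>+z. ennreal ((rc_field p z - rc_partial F p z)\<^sup>2) \<partial>(D \<Otimes>\<^sub>M Q)) < ennreal e)"
proof -
  have "0 < ennreal (e / \<sigma>2)" using assms sigma_pos by simp
  then obtain F0 where F0: "finite F0" "\<And>F. F0 \<subseteq> F \<Longrightarrow> (\<integral>\<^sup>+q. coeff_energy q * indicator (- F) q \<partial>counting) < ennreal (e / \<sigma>2)"
    using counting_tail_small[OF coeff_energy_finite] by blast
  have "(\<integral>\<^sup>+z. ennreal ((rc_field p z - rc_partial F p z)\<^sup>2) \<partial>(D \<Otimes>\<^sub>M Q)) < ennreal e"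
    if "finite F" "F0 \<subseteq> F" for F
  proof -
    have "ennreal \<sigma>2 * (\<integral>\<^sup>+q. coeff_energy q * indicator (- F) q \<partial>counting) < ennreal \<sigma>2 * ennreal (e / \<sigma>2)"
      using F0(2)[OF that(2)] sigma_pos by (intro ennreal_mult_strict_left_mono) auto
    also have "\<dots> = ennreal e" using sigma_pos assms by (simp add: ennreal_mult[symmetric])
    finally show ?thesis using rc_tail_bound[OF that(1), of p] by (rule le_less_trans[rotated])
  qed
  then show ?thesis using F0(1) by blast
qed

lemma rc_field_integrable: "integrable (D \<Otimes>\<^sub>M Q) (rc_field p)"
  by (rule DQ.square_integrable_imp_integrable[OF rc_field_DQ_measurable rc_field_square_integrable])

lemma rc_field_mult_integrable: "integrable (D \<Otimes>\<^sub>M Q) (\<lambda>z. rc_field p z * rc_field q z)"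
  by (intro integrable_mult_of_squares rc_field_square_integrable) measurable

lemma rc_field_mean: "(\<integral>z. rc_field p z \<partial>(D \<Otimes>\<^sub>M Q)) = 0"
proof -
  have "(\<integral>z. rc_field p z \<partial>(D \<Otimes>\<^sub>M Q)) = (\<integral>x. \<integral>e. rc_field p (x, e) \<partial>Q \<partial>D)"
    by (rule DQ.integral_fst'[OF rc_field_integrable, symmetric])
  also have "\<dots> = (\<integral>x. 0 \<partial>D)"
  proof (rule integral_cong_AE)
    show "AE x in D. (\<integral>e. rc_field p (x, e) \<partial>Q) = 0"
      using D_range
    proof eventually_elim
      case (elim x)
      then have x: "0 \<le> x" "x < 1/4" by auto
      show ?case
        using filter_mean[OF green_nonneg[OF x(1)] integrable_green[OF x], of p] by (simp add: rc_field_green[OF x])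
    qed
  qed measurable
  finally show ?thesis by simp
qed

lemma spec_cov_torus:
  "spec_cov f k l = (\<integral>t. cis (phase t (k, l)) * complex_of_real (f t) \<partial>torus)"
  unfolding spec_cov_def torus_integral[symmetric]
  by (intro arg_cong[where f = "set_lebesgue_integral lborel _"]) (auto simp: fun_eq_iff cis_conv_exp phase_def)

text \<open>Given the coefficient, the covariance is a Green autocorrelation, hence by Parseval a
  Fourier coefficient of the inverse squared symbol; exchanging the averages over coefficient and
  frequency produces the spectral density.\<close>

lemma rc_field_cov:
  "complex_of_real (\<integral>z. rc_field p z * rc_field q z \<partial>(D \<Otimes>\<^sub>M Q))
    = spec_cov (spec_dens \<sigma>2 \<Phi> \<alpha>) (fst q - fst p) (snd q - snd p)"
proof -
  interpret T: sigma_finite_measure torus by (rule sigma_finite_torus)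
  interpret LT: pair_sigma_finite "lborel :: real measure" torus ..
  define h where "h = q - p"
  define c where "c = complex_of_real (\<sigma>2 / (4 * pi\<^sup>2))"
  define F where "F x t = complex_of_real (weight x / (1 - x * walk_symbol t)\<^sup>2) * cis (phase t h)" for x t
  have Fm [measurable]: "(\<lambda>(x, t). F x t) \<in> borel_measurable (lborel \<Otimes>\<^sub>M torus)"
    unfolding F_def by measurable
  \<comment> \<open>The norm of \<open>F\<close> is the integrand of
    \<open>spectral_nn_integral_finite\<close>, since characters have modulus 1.\<close>
  have Fint: "integrable (lborel \<Otimes>\<^sub>M torus) (\<lambda>(x, t). F x t)"
  proof (rule integrableI_bounded)
    have "(\<integral>\<^sup>+z. ennreal (norm ((\<lambda>(x, t). F x t) z)) \<partial>(lborel \<Otimes>\<^sub>M torus))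
        = (\<integral>\<^sup>+x. \<integral>\<^sup>+t. ennreal (norm ((\<lambda>(x, t). F x t) (x, t))) \<partial>torus \<partial>lborel)"
      by (rule T.nn_integral_fst[symmetric]) measurable
    also have "\<dots> = (\<integral>\<^sup>+x. \<integral>\<^sup>+t. ennreal (weight x / (1 - x * walk_symbol t)\<^sup>2) \<partial>torus \<partial>lborel)"
      using weight_nonneg by (intro nn_integral_cong) (simp add: F_def norm_mult del: of_real_divide)
    also have "\<dots> < \<infinity>" by (rule spectral_nn_integral_finite)
    finally show "(\<integral>\<^sup>+z. ennreal (norm ((\<lambda>(x, t). F x t) z)) \<partial>(lborel \<Otimes>\<^sub>M torus)) < \<infinity>" .
  qed (rule Fm)
  have "(\<integral>z. rc_field p z * rc_field q z \<partial>(D \<Otimes>\<^sub>M Q)) = (\<integral>x. \<integral>e. rc_field p (x, e) * rc_field q (x, e) \<partial>Q \<partial>D)"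
    by (rule DQ.integral_fst'[OF rc_field_mult_integrable, symmetric])
  then have "complex_of_real (\<integral>z. rc_field p z * rc_field q z \<partial>(D \<Otimes>\<^sub>M Q))
      = (\<integral>x. complex_of_real (\<integral>e. rc_field p (x, e) * rc_field q (x, e) \<partial>Q) \<partial>D)"
    by simp
  also have "\<dots> = (\<integral>x. c * (\<integral>t. cis (phase t h) * complex_of_real (1 / (1 - x * walk_symbol t)\<^sup>2) \<partial>torus) \<partial>D)"
  proof (rule integral_cong_AE)
    show "AE x in D. complex_of_real (\<integral>e. rc_field p (x, e) * rc_field q (x, e) \<partial>Q)
        = c * (\<integral>t. cis (phase t h) * complex_of_real (1 / (1 - x * walk_symbol t)\<^sup>2) \<partial>torus)"
      using D_range
    proof eventually_elim
      case (elim x)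
      then have x: "0 \<le> x" "x < 1/4" by auto
      have "w - (q - p) = (fst w - fst h, snd w - snd h)" for w :: "int \<times> int"
        by (simp add: h_def prod_eq_iff)
      then have eq: "(\<integral>e. rc_field p (x, e) * rc_field q (x, e) \<partial>Q)
          = \<sigma>2 * (\<integral>w. green x w * green x (fst w - fst h, snd w - snd h) \<partial>counting)"
        unfolding rc_field_green[OF x] filter_cov[OF green_nonneg[OF x(1)] integrable_green[OF x]] by (simp only:)
      have "complex_of_real (\<integral>e. rc_field p (x, e) * rc_field q (x, e) \<partial>Q)
          = (complex_of_real \<sigma>2 * (1 / (4 * complex_of_real (pi\<^sup>2)))) *
            (\<integral>t. cis (phase t h) * complex_of_real (1 / (1 - x * walk_symbol t)\<^sup>2) \<partial>torus)"
        unfolding eq of_real_mult green_convolution[OF x] by (rule mult.assoc[symmetric])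
      also have "complex_of_real \<sigma>2 * (1 / (4 * complex_of_real (pi\<^sup>2))) = c"
        by (simp add: c_def)
      finally show ?case .
    qed
  qed measurable
  also have "\<dots> = (\<integral>x. weight x *\<^sub>R (c * (\<integral>t. cis (phase t h) * complex_of_real (1 / (1 - x * walk_symbol t)\<^sup>2) \<partial>torus)) \<partial>lborel)"
    unfolding D_def using weight_nonneg by (intro integral_density) auto
  also have "\<dots> = (\<integral>x. c * (\<integral>t. F x t \<partial>torus) \<partial>lborel)"
  proof (intro Bochner_Integration.integral_cong refl)
    fix x
    have "F x t = complex_of_real (weight x) * (cis (phase t h) * complex_of_real (1 / (1 - x * walk_symbol t)\<^sup>2))" for t
      by (simp add: F_def)
    then have "(\<integral>t. F x t \<partial>torus) = complex_of_real (weight x) * (\<integral>t. cis (phase t h) * complex_of_real (1 / (1 - x * walk_symbol t)\<^sup>2) \<partial>torus)"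
      by (simp only: integral_mult_right_zero)
    then show "weight x *\<^sub>R (c * (\<integral>t. cis (phase t h) * complex_of_real (1 / (1 - x * walk_symbol t)\<^sup>2) \<partial>torus)) = c * (\<integral>t. F x t \<partial>torus)"
      by (simp only: scaleR_conv_of_real mult.left_commute)
  qed
  also have "\<dots> = c * (\<integral>x. \<integral>t. F x t \<partial>torus \<partial>lborel)" by (rule integral_mult_right_zero)
  also have "(\<integral>x. \<integral>t. F x t \<partial>torus \<partial>lborel) = (\<integral>t. \<integral>x. F x t \<partial>lborel \<partial>torus)"
    by (rule LT.Fubini_integral[OF Fint, symmetric])
  also have "c * \<dots> = (\<integral>t. c * (\<integral>x. F x t \<partial>lborel) \<partial>torus)" by (rule integral_mult_right_zero[symmetric])
  also have "\<dots> = (\<integral>t. cis (phase t h) * complex_of_real (spec_dens \<sigma>2 \<Phi> \<alpha> t) \<partial>torus)"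
  proof (intro Bochner_Integration.integral_cong refl)
    fix t
    have "(\<integral>x. F x t \<partial>lborel) = complex_of_real (\<integral>x. weight x / (1 - x * walk_symbol t)\<^sup>2 \<partial>lborel) * cis (phase t h)"
      unfolding F_def integral_mult_left_zero integral_complex_of_real ..
    then show "c * (\<integral>x. F x t \<partial>lborel) = cis (phase t h) * complex_of_real (spec_dens \<sigma>2 \<Phi> \<alpha> t)"
      unfolding spec_dens_weight c_def by (simp only: of_real_mult mult_ac)
  qed
  finally show ?thesis by (simp add: spec_cov_torus h_def minus_prod_def)
qed

text \<open>The quadratic form of the covariance is the second moment of a linear combination of the
  field, hence nonnegative.\<close>

lemma limit_field_exists: "\<exists>\<mu>. gaussian_field_spec \<mu> (spec_dens \<sigma>2 \<Phi> \<alpha>)"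
proof (rule gaussian_field_exists)
  show "complex_of_real (\<integral>z. rc_field p z * rc_field q z \<partial>(D \<Otimes>\<^sub>M Q)) = spec_cov (spec_dens \<sigma>2 \<Phi> \<alpha>) (fst q - fst p) (snd q - snd p)" for p q
    by (rule rc_field_cov)
  show "(\<integral>z. rc_field p z * rc_field q z \<partial>(D \<Otimes>\<^sub>M Q)) = (\<integral>z. rc_field q z * rc_field p z \<partial>(D \<Otimes>\<^sub>M Q))" for p q
    by (simp only: mult.commute)
  show "0 \<le> (\<Sum>i<N. \<Sum>j<N. a i * a j * (\<integral>z. rc_field (r i) z * rc_field (r j) z \<partial>(D \<Otimes>\<^sub>M Q)))" for N :: nat and r a
  proof -
    have "(\<Sum>i<N. \<Sum>j<N. a i * a j * (\<integral>z. rc_field (r i) z * rc_field (r j) z \<partial>(D \<Otimes>\<^sub>M Q)))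
        = (\<integral>z. (\<Sum>i<N. a i * rc_field (r i) z)\<^sup>2 \<partial>(D \<Otimes>\<^sub>M Q))"
      by (rule integrable_square_sum(2)[symmetric]) (auto intro: rc_field_square_integrable)
    then show ?thesis by simp
  qed
qed

end

section \<open>Aggregation\<close>

lemma L2_series_convD:
  assumes "L2_series_conv M Y X" "e > 0"
  obtains F0 where "finite F0"
    "\<And>F. finite F \<Longrightarrow> F0 \<subseteq> F \<Longrightarrow> (\<integral>\<^sup>+\<omega>. ennreal ((X \<omega> - (\<Sum>q\<in>F. Y q \<omega>))\<^sup>2) \<partial>M) < ennreal e"
proof -
  have "\<exists>F0. finite F0 \<and> (\<forall>F. finite F \<and> F0 \<subseteq> F \<longrightarrow>
      (\<integral>\<^sup>+\<omega>. ennreal ((X \<omega> - (\<Sum>q\<in>F. Y q \<omega>))\<^sup>2) \<partial>M) < ennreal e)"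
    using assms by (simp add: L2_series_conv_def)
  then show ?thesis by (elim exE conjE) (rule that, auto)
qed

text \<open>The aggregation statement concerns arbitrary L^2 sums of the series; almost sure
  uniqueness identifies them with the explicitly constructed ones.\<close>

lemma L2_series_conv_unique:
  assumes X: "L2_series_conv M Y X" and X': "L2_series_conv M Y X'"
    and Y [measurable]: "\<And>q. Y q \<in> borel_measurable M"
  shows "AE \<omega> in M. X \<omega> = X' \<omega>"
proof -
  have [measurable]: "X \<in> borel_measurable M" "X' \<in> borel_measurable M"
    using X X' by (auto simp: L2_series_conv_def)
  have small: "(\<integral>\<^sup>+\<omega>. ennreal ((X \<omega> - X' \<omega>)\<^sup>2) \<partial>M) \<le> ennreal (4 * e)" if e: "e > 0" for e
  proof -
    obtain F1 where F1: "finite F1" "\<And>F. finite F \<Longrightarrow> F1 \<subseteq> F \<Longrightarrow> (\<integral>\<^sup>+\<omega>. ennreal ((X \<omega> - (\<Sum>q\<in>F. Y q \<omega>))\<^sup>2) \<partial>M) < ennreal e"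
      by (rule L2_series_convD[OF X e]) (rule that, assumption, assumption)
    obtain F2 where F2: "finite F2" "\<And>F. finite F \<Longrightarrow> F2 \<subseteq> F \<Longrightarrow> (\<integral>\<^sup>+\<omega>. ennreal ((X' \<omega> - (\<Sum>q\<in>F. Y q \<omega>))\<^sup>2) \<partial>M) < ennreal e"
      by (rule L2_series_convD[OF X' e]) (rule that, assumption, assumption)
    \<comment> \<open>The union lies beyond both thresholds, so one partial sum is close to both
      limits.\<close>
    define S where "S \<omega> = (\<Sum>q\<in>F1 \<union> F2. Y q \<omega>)" for \<omega>
    have [measurable]: "S \<in> borel_measurable M" unfolding S_def[abs_def] by measurable
    have sq: "(a - b)\<^sup>2 \<le> 2 * (a - c)\<^sup>2 + 2 * (b - c)\<^sup>2" for a b c :: real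
    proof -
      have "0 \<le> ((a - c) + (b - c))\<^sup>2" by simp
      then show ?thesis by (simp add: power2_eq_square algebra_simps)
    qed
    have "(\<integral>\<^sup>+\<omega>. ennreal ((X \<omega> - X' \<omega>)\<^sup>2) \<partial>M)
        \<le> (\<integral>\<^sup>+\<omega>. 2 * ennreal ((X \<omega> - S \<omega>)\<^sup>2) + 2 * ennreal ((X' \<omega> - S \<omega>)\<^sup>2) \<partial>M)"
    proof (rule nn_integral_mono)
      fix \<omega>
      have "ennreal ((X \<omega> - X' \<omega>)\<^sup>2) \<le> ennreal (2 * (X \<omega> - S \<omega>)\<^sup>2 + 2 * (X' \<omega> - S \<omega>)\<^sup>2)"
        by (intro ennreal_leI sq)
      also have "\<dots> = 2 * ennreal ((X \<omega> - S \<omega>)\<^sup>2) + 2 * ennreal ((X' \<omega> - S \<omega>)\<^sup>2)"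
        by (simp add: ennreal_plus ennreal_mult)
      finally show "ennreal ((X \<omega> - X' \<omega>)\<^sup>2) \<le> 2 * ennreal ((X \<omega> - S \<omega>)\<^sup>2) + 2 * ennreal ((X' \<omega> - S \<omega>)\<^sup>2)" .
    qed
    also have "\<dots> = 2 * (\<integral>\<^sup>+\<omega>. ennreal ((X \<omega> - S \<omega>)\<^sup>2) \<partial>M) + 2 * (\<integral>\<^sup>+\<omega>. ennreal ((X' \<omega> - S \<omega>)\<^sup>2) \<partial>M)"
      by (simp add: nn_integral_add nn_integral_cmult)
    also have "\<dots> \<le> 2 * ennreal e + 2 * ennreal e"
      using F1(2)[of "F1 \<union> F2"] F2(2)[of "F1 \<union> F2"] F1(1) F2(1)
      by (intro add_mono mult_left_mono) (auto simp: S_def less_imp_le)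
    also have "\<dots> = ennreal (4 * e)"
      using e by (simp add: ennreal_mult distrib_right[symmetric])
    finally show ?thesis .
  qed
  have "(\<integral>\<^sup>+\<omega>. ennreal ((X \<omega> - X' \<omega>)\<^sup>2) \<partial>M) \<le> 0 + ennreal e" if "e > 0" for e
    using small[of "e / 4"] that by simp
  then have "(\<integral>\<^sup>+\<omega>. ennreal ((X \<omega> - X' \<omega>)\<^sup>2) \<partial>M) \<le> 0"
    by (rule ennreal_le_epsilon)
  then have "(\<integral>\<^sup>+\<omega>. ennreal ((X \<omega> - X' \<omega>)\<^sup>2) \<partial>M) = 0" by simp
  then have "AE \<omega> in M. ennreal ((X \<omega> - X' \<omega>)\<^sup>2) = 0"
    by (subst (asm) nn_integral_0_iff_AE) auto
  then show ?thesis by eventually_elim (auto simp: ennreal_eq_0_iff)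
qed

lemma gaussian_field_spec_cov:
  assumes "gaussian_field_spec \<mu> f"
  shows "complex_of_real (\<integral>x. x p * x q \<partial>\<mu>) = spec_cov f (fst q - fst p) (snd q - snd p)"
proof -
  have "\<forall>p q. complex_of_real (\<integral>x. x p * x q \<partial>\<mu>) = spec_cov f (fst q - fst p) (snd q - snd p)"
    using assms unfolding gaussian_field_spec_def by (elim conjE)
  then show ?thesis by (elim allE)
qed

lemma fidi_conv_cong_AE:
  assumes ae: "AE \<omega> in M. \<forall>N p. Zs N p \<omega> = Zs' N p \<omega>"
    and m: "\<And>N p. Zs N p \<in> borel_measurable M" "\<And>N p. Zs' N p \<in> borel_measurable M"
    and conv: "fidi_conv M Zs \<mu>"
  shows "fidi_conv M Zs' \<mu>"
  unfolding fidi_conv_def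
proof (intro allI impI)
  fix S and g :: "(int \<times> int \<Rightarrow> real) \<Rightarrow> real"
  assume g: "finite S \<and> continuous_on UNIV g \<and> bounded (range g) \<and> (\<forall>x y. (\<forall>p\<in>S. x p = y p) \<longrightarrow> g x = g y)"
  have gm: "g \<in> borel_measurable (PiM UNIV (\<lambda>_. borel))"
    using g by (intro borel_measurable_continuous_PiM) auto
  have gZ: "(\<lambda>\<omega>. g (\<lambda>p. W p \<omega>)) \<in> borel_measurable M" if "\<And>p. W p \<in> borel_measurable M" for W
    by (rule measurable_compose[OF _ gm], rule measurable_PiM_single') (use that in auto)
  have eq: "(\<integral>\<omega>. g (\<lambda>p. Zs N p \<omega>) \<partial>M) = (\<integral>\<omega>. g (\<lambda>p. Zs' N p \<omega>) \<partial>M)" for N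
  proof (rule integral_cong_AE[OF gZ[OF m(1)] gZ[OF m(2)]])
    show "AE \<omega> in M. g (\<lambda>p. Zs N p \<omega>) = g (\<lambda>p. Zs' N p \<omega>)"
      using ae
    proof eventually_elim
      case (elim \<omega>)
      then have "(\<lambda>p. Zs N p \<omega>) = (\<lambda>p. Zs' N p \<omega>)" by (intro ext) (elim allE)
      then show ?case by (simp only:)
    qed
  qed
  show "(\<lambda>N. \<integral>\<omega>. g (\<lambda>p. Zs' N p \<omega>) \<partial>M) \<longlonglongrightarrow> (\<integral>x. g x \<partial>\<mu>)"
    using conv[unfolded fidi_conv_def, rule_format, OF g] unfolding eq .
qed

theorem theorem1:
  fixes \<alpha> \<sigma>2 :: real
    and \<Phi> :: "real \<Rightarrow> real"
    and M :: "'a measure"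
    and \<theta> :: "nat \<Rightarrow> 'a \<Rightarrow> real"
    and \<epsilon> :: "nat \<Rightarrow> int \<times> int \<Rightarrow> 'a \<Rightarrow> real"
  assumes alpha_pos: "\<alpha> > 0"
    and Phi_meas: "set_borel_measurable borel {0..1/4} \<Phi>"
    and Phi_bdd: "bounded (\<Phi> ` {0..1/4})"
    and Phi_nonneg: "\<forall>x\<in>{0..1/4}. \<Phi> x \<ge> 0"
    and Phi_cont: "continuous (at (1/4) within {0..1/4}) \<Phi>"
    and Phi_quarter: "\<Phi> (1/4) \<noteq> 0"
    and density: "(LBINT x:{0..1/4}. \<Phi> x * (1/4 - x) powr \<alpha>) = 1"
    and Phi_hoelder: "\<alpha> = 1 \<longrightarrow> (\<exists>\<beta>>0. \<exists>C>0. \<forall>x\<in>{0..1/4}. \<forall>y\<in>{0..1/4}.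
                        \<bar>\<Phi> x - \<Phi> y\<bar> \<le> C * \<bar>x - y\<bar> powr \<beta>)"
    and M_prob: "prob_space M"
    and theta_distr: "\<forall>n. distributed M lborel (\<theta> n)
                        (\<lambda>x. ennreal (indicator {0..1/4} x * \<Phi> x * (1/4 - x) powr \<alpha>))"
    and eps_meas: "\<forall>n p. \<epsilon> n p \<in> borel_measurable M"
    and indep_pairs: "prob_space.indep_vars M (\<lambda>_. borel \<Otimes>\<^sub>M PiM UNIV (\<lambda>_. borel))
                        (\<lambda>n \<omega>. (\<theta> n \<omega>, \<lambda>p. \<epsilon> n p \<omega>)) UNIV"
    and indep_theta_eps: "\<forall>n. distr M (borel \<Otimes>\<^sub>M PiM UNIV (\<lambda>_. borel)) (\<lambda>\<omega>. (\<theta> n \<omega>, \<lambda>p. \<epsilon> n p \<omega>))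
                        = distr M borel (\<theta> n) \<Otimes>\<^sub>M distr M (PiM UNIV (\<lambda>_. borel)) (\<lambda>\<omega> p. \<epsilon> n p \<omega>)"
    and eps_ident: "\<forall>n m. distr M (PiM UNIV (\<lambda>_. borel)) (\<lambda>\<omega> p. \<epsilon> n p \<omega>)
                          = distr M (PiM UNIV (\<lambda>_. borel)) (\<lambda>\<omega> p. \<epsilon> m p \<omega>)"
    and sigma_pos: "\<sigma>2 > 0"
    and eps_L2: "\<forall>n p. integrable M (\<lambda>\<omega>. (\<epsilon> n p \<omega>)\<^sup>2)"
    and eps_centered: "\<forall>n p. (\<integral>\<omega>. \<epsilon> n p \<omega> \<partial>M) = 0"
    and eps_var: "\<forall>n p. (\<integral>\<omega>. (\<epsilon> n p \<omega>)\<^sup>2 \<partial>M) = \<sigma>2"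
    and eps_uncorr: "\<forall>n p q. p \<noteq> q \<longrightarrow> (\<integral>\<omega>. \<epsilon> n p \<omega> * \<epsilon> n q \<omega> \<partial>M) = 0"
  shows "(\<forall>n i j. \<exists>X. L2_series_conv M
            (\<lambda>(k, l) \<omega>. Re (laurent_coeff k l (\<theta> n \<omega>)) * \<epsilon> n (i - k, j - l) \<omega>) X)
    \<and> (\<exists>\<mu>. gaussian_field_spec \<mu> (spec_dens \<sigma>2 \<Phi> \<alpha>) \<and>
         (\<forall>X :: nat \<Rightarrow> int \<times> int \<Rightarrow> 'a \<Rightarrow> real.
            (\<forall>n i j. L2_series_conv M
               (\<lambda>(k, l) \<omega>. Re (laurent_coeff k l (\<theta> n \<omega>)) * \<epsilon> n (i - k, j - l) \<omega>) (X n (i, j)))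
            \<longrightarrow> fidi_conv M (\<lambda>N p \<omega>. (\<Sum>n<N. X n p \<omega>) / sqrt (real N)) \<mu>))
    \<and> (\<alpha> > 1 \<longrightarrow> continuous_on ({-pi..pi} \<times> {-pi..pi}) (spec_dens \<sigma>2 \<Phi> \<alpha>))
    \<and> (\<alpha> < 1 \<longrightarrow>
         (\<forall>B \<delta>. \<delta> > 0 \<longrightarrow> (\<exists>x. x \<in> ball (0, 0) \<delta> \<and> x \<noteq> (0, 0) \<and> spec_dens \<sigma>2 \<Phi> \<alpha> x > B)) \<and>
         (spec_dens \<sigma>2 \<Phi> \<alpha> \<sim>[at (0, 0)]
            (\<lambda>(l1, l2). \<sigma>2 / (4 * pi ^ 2) * 16 powr (- \<alpha>) * \<Phi> (1/4)
                * (LBINT u:{0<..}. u powr \<alpha> / (1 + u)\<^sup>2) * (l1\<^sup>2 + l2\<^sup>2) powr (\<alpha> - 1))))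
    \<and> (\<alpha> = 1 \<longrightarrow>
         (\<forall>B \<delta>. \<delta> > 0 \<longrightarrow> (\<exists>x. x \<in> ball (0, 0) \<delta> \<and> x \<noteq> (0, 0) \<and> spec_dens \<sigma>2 \<Phi> \<alpha> x > B)) \<and>
         (spec_dens \<sigma>2 \<Phi> \<alpha> \<sim>[at (0, 0)]
            (\<lambda>(l1, l2). \<sigma>2 / (4 * pi ^ 2) * 16 powr (- 1) * \<Phi> (1/4) * \<bar>ln (l1\<^sup>2 + l2\<^sup>2)\<bar>)))"
proof -
  interpret prob_space M by (rule M_prob)
  obtain b where b: "\<And>x. x \<in> {0..1/4} \<Longrightarrow> \<bar>\<Phi> x\<bar> \<le> b"
  proof -
    from Phi_bdd obtain b where "\<forall>y\<in>\<Phi> ` {0..1/4}. norm y \<le> b" unfolding bounded_iff by blast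
    then show ?thesis by (intro that[of b]) simp
  qed
  interpret C: coefficient_density_limit \<alpha> \<Phi> b
  proof
    show "\<Phi> x \<le> b" if "x \<in> {0..1/4}" for x using b[OF that] by simp
    show "(\<Phi> \<longlongrightarrow> \<Phi> (1/4)) (at (1/4) within {0..1/4})"
      using Phi_cont by (simp add: continuous_within)
  qed (use alpha_pos Phi_meas Phi_nonneg Phi_quarter in auto)
  have weight: "(\<lambda>x. ennreal (indicator {0..1/4} x * \<Phi> x * (1/4 - x) powr \<alpha>)) = (\<lambda>x. ennreal (C.weight x))"
    by (simp add: C.weight_def)
  have theta_law: "distr M lborel (\<theta> n) = density lborel (\<lambda>x. ennreal (C.weight x))"
    and theta_meas [measurable]: "\<theta> n \<in> borel_measurable M" for n
    using theta_distr unfolding distributed_def weight by auto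
  have prob_weight: "prob_space (density lborel (\<lambda>x. ennreal (C.weight x)))"
    unfolding theta_law[of 0, symmetric] by (rule prob_space_distr) simp
  define E where "E n \<omega> = (\<lambda>p. \<epsilon> n p \<omega>)" for n \<omega>
  have em [measurable]: "\<epsilon> n p \<in> borel_measurable M" for n p using eps_meas by blast
  have Em [measurable]: "E n \<in> measurable M (PiM UNIV (\<lambda>_. borel))" for n
    unfolding E_def[abs_def] by (rule measurable_PiM_single') auto
  \<comment> \<open>Copy 0 represents the common noise law of all copies.\<close>
  define Q where "Q = distr M (PiM UNIV (\<lambda>_. borel)) (E 0)"
  have "white_noise_law Q \<sigma>2"
  proof (rule white_noise_law.intro)
    show "prob_space Q" unfolding Q_def by (rule prob_space_distr) measurable
    show "sets Q = sets (PiM UNIV (\<lambda>_. borel))" by (simp add: Q_def)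
    have int: "(\<integral>e. f e \<partial>Q) = (\<integral>\<omega>. f (E 0 \<omega>) \<partial>M)"
      if "f \<in> borel_measurable (PiM UNIV (\<lambda>_. borel))" for f :: "_ \<Rightarrow> real"
      unfolding Q_def by (rule integral_distr[OF Em that])
    show "integrable Q (\<lambda>e. (e p)\<^sup>2)" for p
    proof -
      have "(\<lambda>e. (e p)\<^sup>2) \<in> borel_measurable (PiM UNIV (\<lambda>_. borel :: real measure))" by measurable
      moreover have "integrable M (\<lambda>\<omega>. (E 0 \<omega> p)\<^sup>2)" unfolding E_def using eps_L2 by blast
      ultimately show ?thesis unfolding Q_def by (simp only: integrable_distr_eq[OF Em])
    qed
    show "(\<integral>e. e p \<partial>Q) = 0" for p
      using int[of "\<lambda>e. e p"] eps_centered unfolding E_def by simp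
    show "(\<integral>e. (e p)\<^sup>2 \<partial>Q) = \<sigma>2" for p
      using int[of "\<lambda>e. (e p)\<^sup>2"] eps_var[rule_format, of 0 p] unfolding E_def by simp
    show "(\<integral>e. e p * e q \<partial>Q) = 0" if "p \<noteq> q" for p q
      using int[of "\<lambda>e. e p * e q"] eps_uncorr[rule_format, OF that, of 0] unfolding E_def by simp
  qed (rule sigma_pos)
  then interpret R: random_coefficient_field \<alpha> \<Phi> b Q \<sigma>2
    by (intro random_coefficient_field.intro C.coefficient_density_axioms
        random_coefficient_field_axioms.intro prob_weight)
  define P where "P n \<omega> = (\<theta> n \<omega>, E n \<omega>)" for n \<omega>
  have Pm [measurable]: "P n \<in> measurable M (borel \<Otimes>\<^sub>M PiM UNIV (\<lambda>_. borel))" for n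
    unfolding P_def[abs_def] by measurable
  \<comment> \<open>Every pair has the same product law: the noise law does not depend on
    \<open>n\<close>, and within a copy coefficient and noise are independent.\<close>
  have P_law: "distr M (borel \<Otimes>\<^sub>M PiM UNIV (\<lambda>_. borel)) (P n) = R.D \<Otimes>\<^sub>M Q" for n
  proof -
    have "distr M borel (\<theta> n) = distr M lborel (\<theta> n)" by (rule distr_cong) auto
    then have "distr M borel (\<theta> n) = R.D" by (simp add: theta_law R.D_def)
    moreover have "distr M (PiM UNIV (\<lambda>_. borel)) (\<lambda>\<omega> p. \<epsilon> n p \<omega>) = Q"
      using eps_ident[rule_format, of n 0] by (simp add: Q_def E_def[abs_def])
    ultimately show ?thesis
      using indep_theta_eps[rule_format, of n] by (simp add: P_def[abs_def] E_def[abs_def])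
  qed
  \<comment> \<open>The canonical versions of the fields; their moments, common law and independence
    are inherited from the pairs \<open>P n\<close>.\<close>
  define U where "U n p \<omega> = R.rc_field p (P n \<omega>)" for n p \<omega>
  have Um [measurable]: "U n p \<in> borel_measurable M" for n p
    unfolding U_def[abs_def] by measurable
  have U_integral: "(\<integral>\<omega>. f (P n \<omega>) \<partial>M) = (\<integral>z. f z \<partial>(R.D \<Otimes>\<^sub>M Q))"
    and U_integrable: "integrable M (\<lambda>\<omega>. f (P n \<omega>)) \<longleftrightarrow> integrable (R.D \<Otimes>\<^sub>M Q) f"
    if "f \<in> borel_measurable (borel \<Otimes>\<^sub>M PiM UNIV (\<lambda>_. borel))" for f :: "_ \<Rightarrow> real" and n
    unfolding P_law[of n, symmetric] using that by (auto simp: integral_distr integrable_distr_eq)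
  have U_sq: "integrable M (\<lambda>\<omega>. (U n p \<omega>)\<^sup>2)" for n p
    unfolding U_def using R.rc_field_square_integrable by (subst U_integrable[of "\<lambda>z. (R.rc_field p z)\<^sup>2"]) auto
  let ?Y = "\<lambda>n i j. \<lambda>(k, l) \<omega>. Re (laurent_coeff k l (\<theta> n \<omega>)) * \<epsilon> n (i - k, j - l) \<omega>"
  have Y_meas: "?Y n i j q \<in> borel_measurable M" for n i j q
  proof -
    have "(\<lambda>\<omega>. re_laurent q (\<theta> n \<omega>) * \<epsilon> n ((i, j) - q) \<omega>) \<in> borel_measurable M"
      by (intro borel_measurable_times measurable_compose[OF theta_meas re_laurent_measurable] em)
    then show ?thesis by (cases q) (simp add: re_laurent_def)
  qed
  have series: "L2_series_conv M (?Y n i j) (U n (i, j))" for n i j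
    unfolding L2_series_conv_def
  proof (intro conjI allI impI)
    have partial: "(\<Sum>q\<in>F. ?Y n i j q \<omega>) = R.rc_partial F (i, j) (P n \<omega>)" for F \<omega>
    proof -
      have "?Y n i j q \<omega> = re_laurent q (fst (P n \<omega>)) * snd (P n \<omega>) ((i, j) - q)" for q
        by (cases q) (simp add: P_def E_def re_laurent_def)
      then show ?thesis unfolding R.rc_partial_def by (simp only:)
    qed
    have "(\<integral>\<^sup>+\<omega>. ennreal ((U n (i, j) \<omega> - (\<Sum>q\<in>F. ?Y n i j q \<omega>))\<^sup>2) \<partial>M)
        = (\<integral>\<^sup>+z. ennreal ((R.rc_field (i, j) z - R.rc_partial F (i, j) z)\<^sup>2) \<partial>(R.D \<Otimes>\<^sub>M Q))" for F
      unfolding P_law[of n, symmetric] partial U_def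
      by (rule nn_integral_distr[OF Pm, symmetric]) measurable
    then show "\<exists>F0. finite F0 \<and> (\<forall>F. finite F \<and> F0 \<subseteq> F \<longrightarrow>
        (\<integral>\<^sup>+\<omega>. ennreal ((U n (i, j) \<omega> - (\<Sum>q\<in>F. ?Y n i j q \<omega>))\<^sup>2) \<partial>M) < ennreal e)" if "e > 0" for e
      using R.rc_series_converges[OF that, of "(i, j)"] by (simp only:)
    show "U n (i, j) \<in> borel_measurable M" by measurable
    show "integrable M (\<lambda>\<omega>. (U n (i, j) \<omega>)\<^sup>2)" by (rule U_sq)
  qed
  obtain \<mu> where \<mu>: "gaussian_field_spec \<mu> (spec_dens \<sigma>2 \<Phi> \<alpha>)"
    using R.limit_field_exists by blast
  have fidi_U: "fidi_conv M (\<lambda>N p \<omega>. (\<Sum>n<N. U n p \<omega>) / sqrt (real N)) \<mu>"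
  proof (rule multivariate_clt_fidi[OF M_prob _ _ U_sq _ _ \<mu>])
    have field_meas: "(\<lambda>z p. R.rc_field p z) \<in> measurable (borel \<Otimes>\<^sub>M PiM UNIV (\<lambda>_. borel)) (PiM UNIV (\<lambda>_. borel))"
      by (rule measurable_PiM_single') auto
    have "indep_vars (\<lambda>_. borel \<Otimes>\<^sub>M PiM UNIV (\<lambda>_. borel)) P UNIV"
      using indep_pairs by (simp add: P_def[abs_def] E_def[abs_def])
    from indep_vars_compose2[OF this field_meas]
    show "indep_vars (\<lambda>_. PiM UNIV (\<lambda>_. borel)) (\<lambda>n \<omega> p. U n p \<omega>) UNIV"
      by (simp add: U_def)
    have "distr M (PiM UNIV (\<lambda>_. borel)) (\<lambda>\<omega> p. U n p \<omega>) = distr (R.D \<Otimes>\<^sub>M Q) (PiM UNIV (\<lambda>_. borel)) (\<lambda>z p. R.rc_field p z)" for n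
      unfolding P_law[of n, symmetric] by (subst distr_distr[OF field_meas Pm]) (simp add: comp_def U_def)
    then show "distr M (PiM UNIV (\<lambda>_. borel)) (\<lambda>\<omega> p. U n p \<omega>) = distr M (PiM UNIV (\<lambda>_. borel)) (\<lambda>\<omega> p. U 0 p \<omega>)" for n
      by simp
    show "expectation (U n p) = 0" for n p
      unfolding U_def[abs_def] U_integral[OF R.rc_field_measurable] by (rule R.rc_field_mean)
    show "expectation (\<lambda>\<omega>. U n p \<omega> * U n q \<omega>) = (\<integral>x. x p * x q \<partial>\<mu>)" for n p q
    proof -
      have "expectation (\<lambda>\<omega>. U n p \<omega> * U n q \<omega>) = (\<integral>z. R.rc_field p z * R.rc_field q z \<partial>(R.D \<Otimes>\<^sub>M Q))"
        unfolding U_def by (rule U_integral) measurable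
      moreover have "complex_of_real (\<integral>x. x p * x q \<partial>\<mu>) = complex_of_real (\<integral>z. R.rc_field p z * R.rc_field q z \<partial>(R.D \<Otimes>\<^sub>M Q))"
        unfolding R.rc_field_cov by (rule gaussian_field_spec_cov[OF \<mu>])
      ultimately show ?thesis by (simp only: of_real_eq_iff)
    qed
  qed
  \<comment> \<open>Passage from the canonical versions to arbitrary ones, which agree with them
    almost surely.\<close>
  have fidi: "fidi_conv M (\<lambda>N p \<omega>. (\<Sum>n<N. X n p \<omega>) / sqrt (real N)) \<mu>"
    if X: "\<forall>n i j. L2_series_conv M (?Y n i j) (X n (i, j))" for X
  proof -
    have Xm: "X n p \<in> borel_measurable M" for n p
    proof (cases p)
      case (Pair i j)
      then show ?thesis using X[rule_format, of n i j] by (simp add: L2_series_conv_def)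
    qed
    show ?thesis
    proof (rule fidi_conv_cong_AE[OF _ _ _ fidi_U])
      have "AE \<omega> in M. U n p \<omega> = X n p \<omega>" for n p
      proof (cases p)
        case (Pair i j)
        then show ?thesis using L2_series_conv_unique[OF series X[rule_format] Y_meas] by simp
      qed
      \<comment> \<open>Copies and sites are countable, so the exceptional null sets can be
        united.\<close>
      then have "AE \<omega> in M. \<forall>n p. U n p \<omega> = X n p \<omega>" by (simp only: AE_all_countable) auto
      then show "AE \<omega> in M. \<forall>N p. (\<Sum>n<N. U n p \<omega>) / sqrt (real N) = (\<Sum>n<N. X n p \<omega>) / sqrt (real N)"
        by eventually_elim simp
    qed (intro borel_measurable_divide borel_measurable_sum borel_measurable_const Um Xm)+
  qed
  have sq: "sq_norm t = (fst t)\<^sup>2 + (snd t)\<^sup>2" for t by (rule sq_norm_def)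
  have K: "\<sigma>2 / (4 * pi\<^sup>2) > 0" using sigma_pos by simp
  have power_law: "(\<forall>B \<delta>. \<delta> > 0 \<longrightarrow> (\<exists>x. x \<in> ball (0, 0) \<delta> \<and> x \<noteq> (0, 0) \<and> spec_dens \<sigma>2 \<Phi> \<alpha> x > B)) \<and>
         (spec_dens \<sigma>2 \<Phi> \<alpha> \<sim>[at (0, 0)]
            (\<lambda>(l1, l2). \<sigma>2 / (4 * pi ^ 2) * 16 powr (- \<alpha>) * \<Phi> (1/4)
                * (LBINT u:{0<..}. u powr \<alpha> / (1 + u)\<^sup>2) * (l1\<^sup>2 + l2\<^sup>2) powr (\<alpha> - 1)))" if a: "\<alpha> < 1"
  proof -
    define c where "c = \<sigma>2 / (4 * pi ^ 2) * 16 powr (- \<alpha>) * \<Phi> (1/4) * (LBINT u:{0<..}. u powr \<alpha> / (1 + u)\<^sup>2)"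
    have LB: "(LBINT u:{0<..}. u powr \<alpha> / (1 + u)\<^sup>2) = (\<integral>u. indicator {0<..} u * (u powr \<alpha> / (1 + u)\<^sup>2) \<partial>lborel)"
      by (simp only: set_lebesgue_integral_def real_scaleR_def)
    have ratio: "((\<lambda>t. spec_dens \<sigma>2 \<Phi> \<alpha> t / sq_norm t powr (\<alpha> - 1)) \<longlongrightarrow> c) (at (0, 0))"
      unfolding c_def LB by (rule C.power_law_ratio[OF a])
    have c: "c > 0"
      unfolding c_def LB by (intro mult_pos_pos K C.Phi_quarter_pos beta_integral_pos alpha_pos a) simp
    have "filterlim (\<lambda>r :: real. r powr (\<alpha> - 1)) at_top (at_right 0)" using a by real_asymp
    then have "filterlim (\<lambda>t. sq_norm t powr (\<alpha> - 1)) at_top (at (0, 0))"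
      by (rule filterlim_compose[OF _ sq_norm_at_right])
    note unbounded = unbounded_near_origin[OF ratio c this]
    have "spec_dens \<sigma>2 \<Phi> \<alpha> \<sim>[at (0, 0)] (\<lambda>(l1, l2). c * (l1\<^sup>2 + l2\<^sup>2) powr (\<alpha> - 1))"
      using asymp_equivI'_const[OF ratio less_imp_neq[OF c, symmetric]] unfolding sq split_beta' .
    then show ?thesis unfolding c_def by (intro conjI allI impI unbounded)
  qed
  have log_law: "(\<forall>B \<delta>. \<delta> > 0 \<longrightarrow> (\<exists>x. x \<in> ball (0, 0) \<delta> \<and> x \<noteq> (0, 0) \<and> spec_dens \<sigma>2 \<Phi> \<alpha> x > B)) \<and>
         (spec_dens \<sigma>2 \<Phi> \<alpha> \<sim>[at (0, 0)]
            (\<lambda>(l1, l2). \<sigma>2 / (4 * pi ^ 2) * 16 powr (- 1) * \<Phi> (1/4) * \<bar>ln (l1\<^sup>2 + l2\<^sup>2)\<bar>))" if a: "\<alpha> = 1"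
  proof -
    define c where "c = \<sigma>2 / (4 * pi ^ 2) * 16 powr (- 1) * \<Phi> (1/4)"
    have ratio: "((\<lambda>t. spec_dens \<sigma>2 \<Phi> \<alpha> t / \<bar>ln (sq_norm t)\<bar>) \<longlongrightarrow> c) (at (0, 0))"
      unfolding c_def by (rule C.log_law_ratio[OF a])
    have c: "c > 0" unfolding c_def by (intro mult_pos_pos K C.Phi_quarter_pos) simp
    have "filterlim (\<lambda>r :: real. \<bar>ln r\<bar>) at_top (at_right 0)" by real_asymp
    then have "filterlim (\<lambda>t. \<bar>ln (sq_norm t)\<bar>) at_top (at (0, 0))"
      by (rule filterlim_compose[OF _ sq_norm_at_right])
    note unbounded = unbounded_near_origin[OF ratio c this]
    have "spec_dens \<sigma>2 \<Phi> \<alpha> \<sim>[at (0, 0)] (\<lambda>(l1, l2). c * \<bar>ln (l1\<^sup>2 + l2\<^sup>2)\<bar>)"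
      using asymp_equivI'_const[OF ratio less_imp_neq[OF c, symmetric]] unfolding sq split_beta' .
    then show ?thesis unfolding c_def by (intro conjI allI impI unbounded)
  qed
  show ?thesis
  proof (intro conjI)
    show "\<forall>n i j. \<exists>X. L2_series_conv M (?Y n i j) X"
      by (intro allI exI) (rule series)
    show "\<exists>\<mu>. gaussian_field_spec \<mu> (spec_dens \<sigma>2 \<Phi> \<alpha>) \<and>
         (\<forall>X :: nat \<Rightarrow> int \<times> int \<Rightarrow> 'a \<Rightarrow> real. (\<forall>n i j. L2_series_conv M (?Y n i j) (X n (i, j)))
            \<longrightarrow> fidi_conv M (\<lambda>N p \<omega>. (\<Sum>n<N. X n p \<omega>) / sqrt (real N)) \<mu>)"
      by (intro exI conjI allI impI) (rule \<mu>, erule fidi)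
    show "\<alpha> > 1 \<longrightarrow> continuous_on ({-pi..pi} \<times> {-pi..pi}) (spec_dens \<sigma>2 \<Phi> \<alpha>)"
      by (intro impI C.spec_dens_continuous)
  qed (rule impI, erule power_law, rule impI, erule log_law)
qed

end
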